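(* Let $\mathcal{A}$ be a unital $C^*$-algebra and let $\mathrm{rk}$ be a Sylvester matrix rank function for $\mathcal{A}$. Define $\mathrm{rk}': M(\mathcal{A})\rightarrow \mathbb{R}_{\ge 0}$ by $\mathrm{rk}'(A)=\sup_{\varepsilon>0}\mathrm{rk}((|A|-\varepsilon)_+)$. Then $\mathrm{rk}'$ is the largest lower semicontinuous dimension function for $\mathcal{A}$ bounded above by $\mathrm{rk}$ (i.e. $\mathrm{rk}'$ is a lower semicontinuous dimension function with $\mathrm{rk}'\le\mathrm{rk}$ pointwise, and every lower semicontinuous dimension function $\mathrm{rk}''\le\mathrm{rk}$ satisfies $\mathrm{rk}''\le\mathrm{rk}'$). In particular, if $\mathcal{A}$ has a Sylvester matrix rank function, then it has a lower semicontinuous dimension function.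
   Context: $M(\mathcal{A})$ is the set of all rectangular matrices over $\mathcal{A}$; $|A|=(A^*A)^{1/2}$; $(|A|-\varepsilon)_+$ is defined by functional calculus with $x\mapsto\max(x-\varepsilon,0)$. $\mathrm{diag}(A,B)$ is the block diagonal matrix. A Sylvester matrix rank function for a unital (nonzero) ring $R$ is a function $\mathrm{rk}:M(R)\to\mathbb{R}_{\ge0}$ such that (i) $\mathrm{rk}(0)=0$ (for every zero matrix) and $\mathrm{rk}(1)=1$; (ii) $\mathrm{rk}(AB)\le\min(\mathrm{rk}(A),\mathrm{rk}(B))$ whenever $AB$ is defined; (iii) $\mathrm{rk}(\mathrm{diag}(A,B))=\mathrm{rk}(A)+\mathrm{rk}(B)$; (iv) $\mathrm{rk}\left(\begin{bmatrix}A&C\\0&B\end{bmatrix}\right)\ge\mathrm{rk}(A)+\mathrm{rk}(B)$. For $A,B\in M(\mathcal{A})$, $A\preceq_{\mathrm{C}}B$ means there are sequences $\{C_n\},\{D_n\}$ in $M(\mathcal{A})$ with $C_nBD_n\to A$ in norm. A dimension function for $\mathcal{A}$ is a function $\varphi:M(\mathcal{A})\to\mathbb{R}_{\ge0}$ such that $\varphi(A)\le\varphi(B)$ whenever $A\preceq_{\mathrm{C}}B$, $\varphi(1)=1$, and $\varphi(\mathrm{diag}(A,B))=\varphi(A)+\varphi(B)$. A function $\varphi:M(\mathcal{A})\to\mathbb{R}$ is lower semicontinuous if for all $n,m\ge1$ and every sequence $\{A_k\}$ in $M_{n,m}(\mathcal{A})$ converging in norm to $A$, $\varphi(A)\le\liminf_{k\to\infty}\varphi(A_k)$.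 *)

theory Defs
  imports
    "HOL-Analysis.Uniform_Limit"
    "HOL-Computational_Algebra.Polynomial"
    "Jordan_Normal_Form.Matrix"
begin

section \<open>Unital C*-algebras\<close>

text \<open>A nonzero unital C*-algebra: a complex Banach algebra with a conjugate-linear
  anti-multiplicative involution satisfying the C*-identity. The superclasses provide the
  underlying real Banach algebra (complete, submultiplicative norm, \<open>norm 1 = 1\<close>).\<close>

class unital_cstar_algebra = real_normed_algebra_1 + banach +
  fixes scaleC :: "complex \<Rightarrow> 'a \<Rightarrow> 'a"
    and star :: "'a \<Rightarrow> 'a"
  assumes scaleC_add_right: "scaleC c (x + y) = scaleC c x + scaleC c y"
    and scaleC_add_left: "scaleC (c + d) x = scaleC c x + scaleC d x"
    and scaleC_scaleC: "scaleC c (scaleC d x) = scaleC (c * d) x"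
    and scaleR_scaleC: "scaleR r x = scaleC (complex_of_real r) x"
    and mult_scaleC_left: "scaleC c x * y = scaleC c (x * y)"
    and mult_scaleC_right: "x * scaleC c y = scaleC c (x * y)"
    and norm_scaleC: "norm (scaleC c x) = cmod c * norm x"
    and star_star: "star (star x) = x"
    and star_add: "star (x + y) = star x + star y"
    and star_scaleC: "star (scaleC c x) = scaleC (cnj c) (star x)"
    and star_mult: "star (x * y) = star y * star x"
    and cstar_identity: "norm (star x * x) = (norm x)\<^sup>2"

section \<open>Rectangular matrices and Sylvester matrix rank functions\<close>

text \<open>Only sizes \<open>n, m \<ge> 1\<close> are admitted. Functions on \<open>M(R)\<close> are total functions on the type of
  matrices, of which only the values on this set are ever used.\<close>

definition rect_mats :: "'a mat set" where
  "rect_mats = {A. dim_row A \<ge> 1 \<and> dim_col A \<ge> 1}"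

definition block_diag :: "'a::zero mat \<Rightarrow> 'a mat \<Rightarrow> 'a mat" where
  "block_diag A B =
     four_block_mat A (0\<^sub>m (dim_row A) (dim_col B)) (0\<^sub>m (dim_row B) (dim_col A)) B"

definition sylvester_rank_function :: "('a::ring_1 mat \<Rightarrow> real) \<Rightarrow> bool" where
  "sylvester_rank_function rk \<longleftrightarrow>
     rk \<in> rect_mats \<rightarrow> {0..} \<and>
     (\<forall>n\<ge>1. \<forall>m\<ge>1. rk (0\<^sub>m n m) = 0) \<and>
     rk (1\<^sub>m 1) = 1 \<and>
     (\<forall>A\<in>rect_mats. \<forall>B\<in>rect_mats. dim_col A = dim_row B \<longrightarrow>
        rk (A * B) \<le> min (rk A) (rk B)) \<and>
     (\<forall>A\<in>rect_mats. \<forall>B\<in>rect_mats. rk (block_diag A B) = rk A + rk B) \<and>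
     (\<forall>A\<in>rect_mats. \<forall>B\<in>rect_mats. \<forall>C\<in>carrier_mat (dim_row A) (dim_col B).
        rk (four_block_mat A C (0\<^sub>m (dim_row B) (dim_col A)) B) \<ge> rk A + rk B)"

section \<open>The C*-norm on matrices\<close>

definition mat_star :: "'a::unital_cstar_algebra mat \<Rightarrow> 'a mat" where
  "mat_star A = mat (dim_col A) (dim_row A) (\<lambda>(i, j). star (A $$ (j, i)))"

text \<open>The norm of the right Hilbert module \<open>\<A>\<^sup>n\<close> with inner product
  \<open>\<langle>x, y\<rangle> = \<Sum>i. x\<^sub>i\<^sup>* y\<^sub>i\<close>. An \<open>n \<times> m\<close> matrix acts by left multiplication as an adjointable
  operator \<open>\<A>\<^sup>m \<rightarrow> \<A>\<^sup>n\<close>; its operator norm is the C*-norm, for which \<open>M\<^sub>n(\<A>)\<close> is a C*-algebra.\<close>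

definition vec_norm :: "'a::unital_cstar_algebra vec \<Rightarrow> real" where
  "vec_norm x = sqrt (norm (\<Sum>i<dim_vec x. star (x $ i) * x $ i))"

definition mat_norm :: "'a::unital_cstar_algebra mat \<Rightarrow> real" where
  "mat_norm A = (SUP x \<in> {x \<in> carrier_vec (dim_col A). vec_norm x \<le> 1}. vec_norm (A *\<^sub>v x))"

text \<open>Only to be used when all \<open>X k\<close> have the size of \<open>A\<close>: subtraction of matrices silently takes
  the size of its second argument.\<close>

definition mat_converges :: "(nat \<Rightarrow> 'a::unital_cstar_algebra mat) \<Rightarrow> 'a mat \<Rightarrow> bool" where
  "mat_converges X A \<longleftrightarrow> (\<lambda>k. mat_norm (X k - A)) \<longlonglongrightarrow> 0"

section \<open>Functional calculus for self-adjoint square matrices\<close>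

definition mat_spectrum :: "'a::unital_cstar_algebra mat \<Rightarrow> complex set" where
  "mat_spectrum A = {z. \<not> invertible_mat (scaleC z 1 \<cdot>\<^sub>m 1\<^sub>m (dim_row A) - A)}"

definition poly_mat :: "real poly \<Rightarrow> 'a::unital_cstar_algebra mat \<Rightarrow> 'a mat" where
  "poly_mat p A = mat (dim_row A) (dim_row A)
     (\<lambda>ij. \<Sum>k\<le>degree p. coeff p k *\<^sub>R ((A ^\<^sub>m k) $$ ij))"

text \<open>For self-adjoint \<open>A\<close>, whose spectrum is real, and \<open>f\<close> continuous on the spectrum, \<open>f(A)\<close> is the
  norm limit of \<open>p\<^sub>k(A)\<close> for real polynomials \<open>p\<^sub>k\<close> converging to \<open>f\<close> uniformly on the spectrum. Such
  polynomials exist by the Weierstrass theorem, and the limit does not depend on their choice.\<close>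

definition mat_cfc :: "(real \<Rightarrow> real) \<Rightarrow> 'a::unital_cstar_algebra mat \<Rightarrow> 'a mat" where
  "mat_cfc f A = (THE B. B \<in> carrier_mat (dim_row A) (dim_row A) \<and>
     (\<exists>p. uniform_limit {t. complex_of_real t \<in> mat_spectrum A} (\<lambda>k. poly (p k)) f sequentially \<and>
          mat_converges (\<lambda>k. poly_mat (p k) A) B))"

definition mat_abs :: "'a::unital_cstar_algebra mat \<Rightarrow> 'a mat" where
  "mat_abs A = mat_cfc sqrt (mat_star A * A)"

definition mat_cut_down :: "real \<Rightarrow> 'a::unital_cstar_algebra mat \<Rightarrow> 'a mat" where
  "mat_cut_down \<epsilon> A = mat_cfc (\<lambda>t. max (t - \<epsilon>) 0) A"

section \<open>Dimension functions\<close>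

definition cuntz_le :: "'a::unital_cstar_algebra mat \<Rightarrow> 'a mat \<Rightarrow> bool" where
  "cuntz_le A B \<longleftrightarrow>
     (\<exists>C D. (\<forall>k. C k \<in> carrier_mat (dim_row A) (dim_row B)) \<and>
            (\<forall>k. D k \<in> carrier_mat (dim_col B) (dim_col A)) \<and>
            mat_converges (\<lambda>k. C k * B * D k) A)"

definition dimension_function :: "('a::unital_cstar_algebra mat \<Rightarrow> real) \<Rightarrow> bool" where
  "dimension_function \<phi> \<longleftrightarrow>
     \<phi> \<in> rect_mats \<rightarrow> {0..} \<and>
     (\<forall>A\<in>rect_mats. \<forall>B\<in>rect_mats. cuntz_le A B \<longrightarrow> \<phi> A \<le> \<phi> B) \<and>
     \<phi> (1\<^sub>m 1) = 1 \<and>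
     (\<forall>A\<in>rect_mats. \<forall>B\<in>rect_mats. \<phi> (block_diag A B) = \<phi> A + \<phi> B)"

definition mat_lower_semicontinuous :: "('a::unital_cstar_algebra mat \<Rightarrow> real) \<Rightarrow> bool" where
  "mat_lower_semicontinuous \<phi> \<longleftrightarrow>
     (\<forall>n\<ge>1. \<forall>m\<ge>1. \<forall>X. \<forall>A\<in>carrier_mat n m.
        (\<forall>k. X k \<in> carrier_mat n m) \<longrightarrow> mat_converges X A \<longrightarrow>
        ereal (\<phi> A) \<le> liminf (\<lambda>k. ereal (\<phi> (X k))))"

text \<open>The supremum is over a set bounded by \<open>rk (1\<^sub>m (dim_col A))\<close> when \<open>rk\<close> is a Sylvester matrix
  rank function.\<close>

definition regularized_rank ::
    "('a::unital_cstar_algebra mat \<Rightarrow> real) \<Rightarrow> 'a mat \<Rightarrow> real" where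
  "regularized_rank rk A = (SUP \<epsilon>\<in>{0<..}. rk (mat_cut_down \<epsilon> (mat_abs A)))"

end

theory Submission
  imports Defs "HOL-Analysis.Analysis" "HOL-Computational_Algebra.Fundamental_Theorem_Algebra"
begin

text \<open>The regularized rank of \<open>A\<close> turns out to be the lower semicontinuous hull
  \<open>sup\<^sub>\<delta> inf {rk Z | \<parallel>A - Z\<parallel> < \<delta>}\<close> of \<open>rk\<close>, and from this description all assertions follow
  by elementary estimates. Write \<open>c = (\<bar>A\<bar> - \<epsilon>)\<^sub>+\<close>. On the one hand \<open>c = X A c\<close> for some \<open>X\<close>, so
  for \<open>Z\<close> close to \<open>A\<close> we get \<open>(1 - X (A - Z)) c = X Z c\<close> with an invertible factor on the left,
  whence \<open>rk c \<le> rk Z\<close>. On the other hand \<open>A c K\<close> is within \<open>\<epsilon>\<close> of \<open>A\<close> for some \<open>K\<close>, and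
  \<open>rk (A c K) \<le> rk c\<close>. Both facts are functional calculus in a matrix algebra over \<open>\<A>\<close>, which rests
  on the spectral radius formula for self-adjoint elements, the positivity of \<open>x\<^sup>* x\<close> and the
  Cauchy-Schwarz inequality for the Hilbert module \<open>\<A>\<^sup>n\<close>.\<close>

section \<open>Invertible elements of Banach algebras\<close>

text \<open>The two sides of the hull do different work. Approximants \<open>Z\<close> of small rank
  near \<open>A\<close> give the upper estimates: monotonicity under \<open>cuntz_le\<close>,
  subadditivity on block diagonals, maximality. They do not give superadditivity, since a matrix
  near \<open>block_diag A B\<close> need not be block diagonal. There the relation
  \<open>c = X * A * c\<close> is decisive: it passes to block diagonals, so that the absolute value
  and the cut-downs of a block matrix never have to be computed. Two obstacles shape the
  C*-algebraic part. A rectangular \<open>A\<close> lies in no algebra, so nonnegativity of the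
  spectrum of \<open>mat_star A * A\<close> does not follow from positivity of
  \<open>star x * x\<close>; the argument is repeated with the Hilbert module as the place where
  \<open>A\<close> acts. Moreover, the size \<open>n\<close> is a variable and not a type, so
  results for the type class must be transported to the \<open>n\<close> by \<open>n\<close>
  matrices. The delicate point is that a lift of a matrix must have the same spectrum as the matrix,
  because both functional calculi are defined by approximation on the spectrum.\<close>

definition inverse_pair :: "'a::ring_1 \<Rightarrow> 'a \<Rightarrow> bool" where
  "inverse_pair x y \<longleftrightarrow> x * y = 1 \<and> y * x = 1"

definition invertible_elt :: "'a::ring_1 \<Rightarrow> bool" where
  "invertible_elt x \<longleftrightarrow> (\<exists>y. inverse_pair x y)"

lemma inverse_pair_unique:
  assumes "inverse_pair x y" "inverse_pair x z" shows "y = z"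
proof -
  have "y = y * (x * z)" using assms by (simp add: inverse_pair_def)
  also have "\<dots> = (y * x) * z" by (simp only: mult.assoc)
  finally show ?thesis using assms by (simp add: inverse_pair_def)
qed

lemma inverse_pair_mult:
  assumes "inverse_pair x x'" "inverse_pair y y'" shows "inverse_pair (x * y) (y' * x')"
proof -
  have "(x * y) * (y' * x') = x * (y * y') * x'" by (simp only: mult.assoc)
  moreover have "(y' * x') * (x * y) = y' * (x' * x) * y" by (simp only: mult.assoc)
  ultimately show ?thesis using assms by (simp add: inverse_pair_def)
qed

lemma invertible_elt_mult: "invertible_elt x \<Longrightarrow> invertible_elt y \<Longrightarrow> invertible_elt (x * y)"
  unfolding invertible_elt_def using inverse_pair_mult by blast

lemma invertible_elt_uminus: "invertible_elt (- x) \<longleftrightarrow> invertible_elt x" for x :: "'a::ring_1"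
proof -
  have "inverse_pair x y \<Longrightarrow> inverse_pair (- x) (- y)" for x y :: 'a
    by (simp add: inverse_pair_def)
  then show ?thesis unfolding invertible_elt_def by (metis minus_minus)
qed

lemma geometric_sum_noncomm:
  fixes x :: "'a::ring_1"
  shows "(1 - x) * (\<Sum>k<n. x ^ k) = 1 - x ^ n" "(\<Sum>k<n. x ^ k) * (1 - x) = 1 - x ^ n"
proof -
  have "(1 - x) * (s + p) = (1 - x) * s + (p - x * p)" "(s + p) * (1 - x) = s * (1 - x) + (p - p * x)"
    for s p :: 'a by (simp_all add: algebra_simps)
  note d = this
  show "(1 - x) * (\<Sum>k<n. x ^ k) = 1 - x ^ n" by (induction n) (simp_all add: d)
  show "(\<Sum>k<n. x ^ k) * (1 - x) = 1 - x ^ n"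
    by (induction n) (simp_all add: d power_commutes)
qed

text \<open>Neumann series. The norm bound comes from the identity
  \<open>y = 1 + x * y\<close>.\<close>

lemma inverse_pair_one_minus:
  fixes x :: "'a::{real_normed_algebra_1, banach}"
  assumes "norm x < 1"
  shows "\<exists>y. inverse_pair (1 - x) y \<and> norm y \<le> 1 / (1 - norm x)"
proof -
  have s: "summable (\<lambda>n. x ^ n)" using assms by (rule complete_algebra_summable_geometric)
  define y where "y = (\<Sum>n. x ^ n)"
  have y: "(\<lambda>n. \<Sum>k<n. x ^ k) \<longlonglongrightarrow> y" unfolding y_def using s by (rule summable_LIMSEQ)
  have z: "(\<lambda>n. 1 - x ^ n) \<longlonglongrightarrow> 1 - 0"
    by (intro tendsto_intros summable_LIMSEQ_zero[OF s])
  have "(\<lambda>n. (1 - x) * (\<Sum>k<n. x ^ k)) \<longlonglongrightarrow> (1 - x) * y" by (intro tendsto_intros y)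
  then have 1: "(1 - x) * y = 1" using z by (simp add: geometric_sum_noncomm LIMSEQ_unique)
  have "(\<lambda>n. (\<Sum>k<n. x ^ k) * (1 - x)) \<longlonglongrightarrow> y * (1 - x)" by (intro tendsto_intros y)
  then have 2: "y * (1 - x) = 1" using z by (simp add: geometric_sum_noncomm LIMSEQ_unique)
  have "y = 1 + x * y" using 1 by (simp add: algebra_simps)
  then have "norm y \<le> 1 + norm x * norm y"
    by (metis norm_triangle_le norm_one norm_mult_ineq add_left_mono)
  then have "norm y * (1 - norm x) \<le> 1" by (simp add: algebra_simps)
  then have "norm y \<le> 1 / (1 - norm x)" using assms by (simp add: pos_le_divide_eq)
  then show ?thesis using 1 2 by (auto simp: inverse_pair_def)
qed

text \<open>The factorisation \<open>x - h = x * (1 - y * h)\<close> reduces this to the Neumann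
  series. The explicit bound later controls the resolvent near a given point.\<close>

lemma inverse_pair_perturb:
  fixes x y h :: "'a::{real_normed_algebra_1, banach}"
  assumes xy: "inverse_pair x y" and h: "norm h * norm y < 1"
  shows "\<exists>z. inverse_pair (x - h) z \<and> norm z \<le> norm y / (1 - norm h * norm y)"
proof -
  have yh: "norm (y * h) \<le> norm h * norm y" by (metis norm_mult_ineq mult.commute)
  then have "norm (y * h) < 1" using h by linarith
  then obtain w where w: "inverse_pair (1 - y * h) w" "norm w \<le> 1 / (1 - norm (y * h))"
    using inverse_pair_one_minus by blast
  have "x * (1 - y * h) = x - (x * y) * h" by (simp add: algebra_simps)
  then have "x - h = x * (1 - y * h)" using xy by (simp add: inverse_pair_def)
  then have 1: "inverse_pair (x - h) (w * y)" using inverse_pair_mult[OF xy w(1)] by simp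
  have "norm (w * y) \<le> norm w * norm y" by (rule norm_mult_ineq)
  also have "\<dots> \<le> 1 / (1 - norm (y * h)) * norm y" using w by (intro mult_right_mono) auto
  also have "\<dots> \<le> 1 / (1 - norm h * norm y) * norm y"
    using yh h by (intro mult_right_mono divide_left_mono) auto
  finally show ?thesis using 1 by auto
qed

section \<open>Elementary identities in a unital C*-algebra\<close>

lemma scaleC_one [simp]: "scaleC 1 x = x"
  using scaleR_scaleC[of 1 x] by simp

lemma scaleC_zero_left [simp]: "scaleC 0 x = 0"
  using scaleR_scaleC[of 0 x] by simp

lemma scaleC_zero_right [simp]: "scaleC c 0 = 0"
  by (metis norm_scaleC norm_zero mult_zero_right norm_eq_zero)

lemma scaleC_minus_left [simp]: "scaleC (- c) x = - scaleC c x"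
  by (metis add.right_inverse add_eq_0_iff scaleC_add_left scaleC_zero_left)

lemma scaleC_minus_right [simp]: "scaleC c (- x) = - scaleC c x"
  by (metis add.right_inverse add_eq_0_iff scaleC_add_right scaleC_zero_right)

lemma scaleC_diff_left: "scaleC (c - d) x = scaleC c x - scaleC d x"
  using scaleC_add_left[of c "- d" x] by simp

lemma scaleC_diff_right: "scaleC c (x - y) = scaleC c x - scaleC c y"
  using scaleC_add_right[of c x "- y"] by simp

lemma scaleC_sum_left: "scaleC (\<Sum>i\<in>I. f i) x = (\<Sum>i\<in>I. scaleC (f i) x)"
  by (induction I rule: infinite_finite_induct) (simp_all add: scaleC_add_left)

lemma scaleC_power: "scaleC c x ^ n = scaleC (c ^ n) (x ^ n)"
  by (induction n) (simp_all add: mult_scaleC_left mult_scaleC_right scaleC_scaleC mult.commute)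

lemma star_one [simp]: "star 1 = 1"
  by (metis mult.right_neutral star_mult star_star)

lemma star_zero [simp]: "star 0 = 0"
  by (metis add_cancel_right_right star_add)

lemma star_minus [simp]: "star (- x) = - star x"
  by (metis add.right_inverse add_eq_0_iff star_add star_zero)

lemma star_diff: "star (x - y) = star x - star y"
  using star_add[of x "- y"] by simp

lemma star_scaleR [simp]: "star (c *\<^sub>R x) = c *\<^sub>R star x"
  by (simp add: scaleR_scaleC star_scaleC)

lemma star_sum: "star (\<Sum>i\<in>I. f i) = (\<Sum>i\<in>I. star (f i))"
  by (induction I rule: infinite_finite_induct) (simp_all add: star_add)

lemma star_power: "star (x ^ n) = star x ^ n"
  by (induction n) (simp_all add: star_mult power_commutes)

declare star_star [simp]

text \<open>The C*-identity and submultiplicativity give one inequality for all \<open>x\<close>;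
  its instance at \<open>star x\<close> is the other.\<close>

lemma norm_star [simp]: "norm (star x) = norm (x :: 'a::unital_cstar_algebra)"
proof -
  have le: "norm x \<le> norm (star x)" for x :: 'a
  proof (cases "x = 0")
    case False
    have "norm x * norm x \<le> norm (star x) * norm x"
      using norm_mult_ineq[of "star x" x] by (simp add: cstar_identity power2_eq_square)
    then show ?thesis using False by simp
  qed simp
  show ?thesis using le[of x] le[of "star x"] by simp
qed

lemma tendsto_star: "f \<longlonglongrightarrow> l \<Longrightarrow> (\<lambda>n. star (f n :: 'a::unital_cstar_algebra)) \<longlonglongrightarrow> star l"
  unfolding tendsto_iff dist_norm star_diff[symmetric] norm_star .

section \<open>Resolvents and the spectral radius\<close>

text \<open>Orthogonality of characters of a cyclic group: the sum is geometric with a ratio whose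
  \<open>n\<close>-th power is 1.\<close>

lemma sum_powers_root_unity:
  assumes "0 < n"
  shows "(\<Sum>k<n. (exp (2 * of_real pi * \<i> * of_nat k / of_nat n) :: complex) ^ j) =
         (if n dvd j then of_nat n else 0)"
proof -
  let ?w = "exp (2 * of_real pi * \<i> * of_nat j / of_nat n) :: complex"
  have sw: "(exp (2 * of_real pi * \<i> * of_nat k / of_nat n) :: complex) ^ j = ?w ^ k" for k
    unfolding exp_of_nat_mult[symmetric] by (intro arg_cong[of _ _ exp]) (simp add: field_simps)
  have w1: "?w = 1 \<longleftrightarrow> n dvd j" using assms by (intro complex_root_unity_eq_1) auto
  have wn: "?w ^ n = 1"
    using assms complex_root_unity_eq_1[of 1 j] unfolding exp_of_nat_mult[symmetric] by simp
  show ?thesis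
  proof (cases "?w = 1")
    case True then show ?thesis using w1 by (simp add: sw)
  next
    case False then show ?thesis using w1 wn by (simp add: sw geometric_sum)
  qed
qed

text \<open>Partial fractions for \<open>1 / (1 - a ^ n)\<close> over the \<open>n\<close>-th roots
  of unity. Each \<open>R k * (1 - a ^ n)\<close> is a finite geometric sum, and summing over
  \<open>k\<close> cancels all powers of \<open>a\<close> except the zeroth.\<close>

lemma inverse_pair_average:
  fixes a :: "'a::unital_cstar_algebra"
  assumes n: "0 < n"
    and R: "\<And>k. k < n \<Longrightarrow>
      inverse_pair (1 - scaleC (exp (2 * of_real pi * \<i> * of_nat k / of_nat n)) a) (R k)"
  shows "inverse_pair (1 - a ^ n) ((1 / real n) *\<^sub>R (\<Sum>k<n. R k))"
proof -
  define w where "w k = (exp (2 * of_real pi * \<i> * of_nat k / of_nat n) :: complex)" for k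
  have wn: "w k ^ n = 1" for k
    using n complex_root_unity_eq_1[of 1 k] unfolding w_def exp_of_nat_mult[symmetric] by simp
  have p: "scaleC (w k) a ^ n = a ^ n" for k by (simp add: scaleC_power wn)
  have 1: "R k * (1 - a ^ n) = (\<Sum>j<n. scaleC (w k ^ j) (a ^ j))" if "k < n" for k
  proof -
    have "R k * (1 - a ^ n) = R k * ((1 - scaleC (w k) a) * (\<Sum>j<n. scaleC (w k) a ^ j))"
      unfolding geometric_sum_noncomm p ..
    also have "\<dots> = (\<Sum>j<n. scaleC (w k) a ^ j)"
      using R[OF that] by (simp add: mult.assoc[symmetric] inverse_pair_def w_def)
    finally show ?thesis by (simp add: scaleC_power)
  qed
  have 2: "(1 - a ^ n) * R k = (\<Sum>j<n. scaleC (w k ^ j) (a ^ j))" if "k < n" for k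
  proof -
    have "(1 - a ^ n) * R k = ((\<Sum>j<n. scaleC (w k) a ^ j) * (1 - scaleC (w k) a)) * R k"
      unfolding geometric_sum_noncomm p ..
    also have "\<dots> = (\<Sum>j<n. scaleC (w k) a ^ j)"
      using R[OF that] by (simp add: mult.assoc inverse_pair_def w_def)
    finally show ?thesis by (simp add: scaleC_power)
  qed
  have "(\<Sum>k<n. \<Sum>j<n. scaleC (w k ^ j) (a ^ j)) = (\<Sum>j<n. \<Sum>k<n. scaleC (w k ^ j) (a ^ j))"
    by (rule sum.swap)
  also have "\<dots> = (\<Sum>j<n. scaleC (if n dvd j then of_nat n else 0) (a ^ j))"
    unfolding scaleC_sum_left[symmetric] w_def sum_powers_root_unity[OF n] ..
  \<comment> \<open>Among the exponents below \<open>n\<close> only 0 is divisible by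
    \<open>n\<close>.\<close>
  also have "\<dots> = (\<Sum>j<n. if j = 0 then scaleC (of_nat n) 1 else 0)"
    by (intro sum.cong refl) (auto dest: dvd_imp_le)
  also have "\<dots> = real n *\<^sub>R 1" using n by (simp add: scaleR_scaleC)
  finally have s: "(\<Sum>k<n. \<Sum>j<n. scaleC (w k ^ j) (a ^ j)) = real n *\<^sub>R 1" .
  have "(\<Sum>k<n. R k) * (1 - a ^ n) = real n *\<^sub>R 1" "(1 - a ^ n) * (\<Sum>k<n. R k) = real n *\<^sub>R 1"
    unfolding sum_distrib_left sum_distrib_right using 1 2 s by simp_all
  then show ?thesis using n by (simp add: inverse_pair_def)
qed

text \<open>The resolvent identity bounds differences by a product of two resolvent norms, so a
  Lipschitz constant follows from a uniform bound on \<open>R\<close>. That bound comes from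
  continuity on the compact disc, and continuity from the local bound in
  \<open>inverse_pair_perturb\<close>.\<close>

lemma resolvent_lipschitz:
  fixes a :: "'a::unital_cstar_algebra"
  assumes inv: "\<And>z. cmod z \<le> 1 \<Longrightarrow> invertible_elt (1 - scaleC z a)"
  obtains R L where "\<And>z. cmod z \<le> 1 \<Longrightarrow> inverse_pair (1 - scaleC z a) (R z)" "0 \<le> L"
    "\<And>z w. cmod z \<le> 1 \<Longrightarrow> cmod w \<le> 1 \<Longrightarrow> norm (R z - R w) \<le> L * cmod (z - w)"
proof -
  define R where "R z = (SOME y. inverse_pair (1 - scaleC z a) y)" for z
  have R: "inverse_pair (1 - scaleC z a) (R z)" if "cmod z \<le> 1" for z
    using inv[OF that] unfolding invertible_elt_def R_def by (rule someI_ex)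
  have diff: "norm (R z - R w) \<le> norm (R z) * norm a * norm (R w) * cmod (z - w)"
    if "cmod z \<le> 1" "cmod w \<le> 1" for z w
  proof -
    \<comment> \<open>With the two inverses as \<open>p\<close> and \<open>q\<close> this is the
      resolvent identity.\<close>
    have "p * (x - y) * q = p * (x * q) - (p * y) * q" for p q x y :: 'a
      by (simp add: algebra_simps)
    from this[of "R z" "1 - scaleC w a" "1 - scaleC z a" "R w"]
    have "R z * ((1 - scaleC w a) - (1 - scaleC z a)) * R w = R z - R w"
      using R[OF that(1)] R[OF that(2)] by (simp only: inverse_pair_def) simp
    moreover have "(1 - scaleC w a) - (1 - scaleC z a) = scaleC (z - w) a"
      by (simp add: scaleC_diff_left)
    ultimately have e: "R z - R w = R z * scaleC (z - w) a * R w" by simp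
    have "norm (R z - R w) \<le> norm (R z) * norm (scaleC (z - w) a) * norm (R w)"
      unfolding e by (meson norm_mult_ineq order_trans mult_right_mono norm_ge_zero)
    then show ?thesis by (simp add: norm_scaleC mult_ac)
  qed
  have "continuous_on (cball 0 1) R"
    unfolding continuous_on_iff
  proof (intro ballI allI impI)
    fix w :: complex and e :: real assume w: "w \<in> cball 0 1" and e: "0 < e"
    define B where "B = norm a * norm (R w) + 1"
    have B: "B > 0" unfolding B_def by (intro add_nonneg_pos) auto
    \<comment> \<open>The first entry keeps the perturbation of \<open>1 - scaleC w a\<close> small
      enough for \<open>norm (R z) \<le> 2 * norm (R w)\<close>; the second makes the final product
      of constants equal to \<open>e\<close>.\<close>
    define d where "d = min (1 / (2 * B)) (e / (2 * B * (norm (R w) + 1)))"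
    have d: "d > 0" using B e by (auto simp: d_def intro!: divide_pos_pos mult_pos_pos add_nonneg_pos)
    have "dist (R z) (R w) < e" if z: "z \<in> cball 0 1" "dist z w < d" for z
    proof -
      have zw: "cmod (z - w) < d" using z by (simp add: dist_norm)
      have "cmod (z - w) * B \<le> d * B" using zw B by (intro mult_right_mono) auto
      also have "\<dots> \<le> 1 / (2 * B) * B" using B by (intro mult_right_mono) (auto simp: d_def)
      finally have h: "cmod (z - w) * B \<le> 1 / 2" using B by simp
      have "cmod (z - w) * (norm a * norm (R w)) \<le> cmod (z - w) * B"
        by (intro mult_left_mono) (auto simp: B_def)
      then have h2: "norm (scaleC (z - w) a) * norm (R w) \<le> 1 / 2"
        using h by (simp add: norm_scaleC mult_ac)
      have e1: "(1 - scaleC w a) - scaleC (z - w) a = 1 - scaleC z a" by (simp add: scaleC_diff_left)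
      have "inverse_pair (1 - scaleC w a) (R w)" using R w by simp
      then obtain y where y: "inverse_pair (1 - scaleC z a) y"
        "norm y \<le> norm (R w) / (1 - norm (scaleC (z - w) a) * norm (R w))"
        using inverse_pair_perturb[of "1 - scaleC w a" "R w" "scaleC (z - w) a"] h2 e1 by auto
      have "y = R z" using y(1) R[of z] z inverse_pair_unique by auto
      moreover have "norm (R w) / (1 - norm (scaleC (z - w) a) * norm (R w)) \<le> norm (R w) / (1 / 2)"
        using h2 by (intro divide_left_mono) auto
      ultimately have Rz: "norm (R z) \<le> 2 * norm (R w)" using y(2) by simp
      have "norm (R z - R w) \<le> norm (R z) * norm a * norm (R w) * cmod (z - w)"
        using diff z w by simp
      also have "\<dots> \<le> 2 * norm (R w) * norm a * norm (R w) * cmod (z - w)"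
        using Rz by (intro mult_right_mono) auto
      also have "\<dots> = 2 * norm (R w) * (norm a * norm (R w)) * cmod (z - w)" by simp
      also have "\<dots> \<le> 2 * (norm (R w) + 1) * B * cmod (z - w)"
        by (intro mult_right_mono mult_mono) (auto simp: B_def)
      also have "\<dots> < 2 * (norm (R w) + 1) * B * d"
        using zw B by (intro mult_strict_left_mono) (auto intro!: mult_pos_pos add_nonneg_pos)
      also have "\<dots> \<le> 2 * (norm (R w) + 1) * B * (e / (2 * B * (norm (R w) + 1)))"
        using B by (intro mult_left_mono) (auto simp: d_def)
      also have "\<dots> = e" using B by (simp add: field_simps add_nonneg_eq_0_iff)
      finally show ?thesis by (simp add: dist_norm)
    qed
    then show "\<exists>d>0. \<forall>z\<in>cball 0 1. dist z w < d \<longrightarrow> dist (R z) (R w) < e" using d by blast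
  qed
  then have "bounded (R ` cball 0 1)"
    by (intro compact_imp_bounded compact_continuous_image) auto
  then obtain M where "\<forall>z\<in>cball 0 1. norm (R z) \<le> M"
    unfolding bounded_iff by auto
  then have M: "norm (R z) \<le> M" if "cmod z \<le> 1" for z using that by simp
  have M0: "0 \<le> M" using M[of 0] norm_ge_zero[of "R 0"] by (simp del: norm_ge_zero)
  have "norm (R z - R w) \<le> M * norm a * M * cmod (z - w)" if "cmod z \<le> 1" "cmod w \<le> 1" for z w
  proof -
    have "norm (R z) * norm a * norm (R w) * cmod (z - w) \<le> M * norm a * M * cmod (z - w)"
      using M that M0 by (intro mult_right_mono mult_mono) auto
    then show ?thesis using diff[OF that] by linarith
  qed
  moreover have "0 \<le> M * norm a * M" using M0 by simp
  ultimately show thesis using that R by blast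
qed

text \<open>Rickart's proof of the spectral radius formula: the averages in \<open>inverse_pair_average\<close>
  are Lipschitz in the radius uniformly in \<open>n\<close>, so smallness of \<open>\<rho>\<^sup>n a\<^sup>n\<close> propagates from
  \<open>\<rho> = 0\<close> to \<open>\<rho> = 1\<close> in finitely many steps of fixed length.\<close>

lemma eventually_norm_power_le_one:
  fixes a :: "'a::unital_cstar_algebra"
  assumes inv: "\<And>z. cmod z \<le> 1 \<Longrightarrow> invertible_elt (1 - scaleC z a)"
  shows "\<forall>\<^sub>F n in sequentially. norm (a ^ n) \<le> 1"
proof -
  obtain R L where R: "\<And>z. cmod z \<le> 1 \<Longrightarrow> inverse_pair (1 - scaleC z a) (R z)" and L: "0 \<le> L"
    "\<And>z w. cmod z \<le> 1 \<Longrightarrow> cmod w \<le> 1 \<Longrightarrow> norm (R z - R w) \<le> L * cmod (z - w)"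
    using resolvent_lipschitz[OF inv] by blast
  define w where "w n k = (exp (2 * of_real pi * \<i> * of_nat k / of_nat n) :: complex)" for n k :: nat
  have cw: "cmod (w n k) = 1" for n k
  proof -
    have "w n k = exp (\<i> * of_real (2 * pi * real k / real n))" by (simp add: w_def mult_ac)
    then show ?thesis by (simp only: norm_exp_i_times)
  qed
  \<comment> \<open>By \<open>inverse_pair_average\<close> this is the inverse of
    \<open>1 - (\<rho> *\<^sub>R a) ^ n\<close>.\<close>
  define g where "g n \<rho> = (1 / real n) *\<^sub>R (\<Sum>k<n. R (w n k * of_real \<rho>))" for n \<rho>
  have g: "inverse_pair (1 - (\<rho> *\<^sub>R a) ^ n) (g n \<rho>)" if "0 < n" "0 \<le> \<rho>" "\<rho> \<le> 1" for n \<rho>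
    unfolding g_def
  proof (rule inverse_pair_average[OF that(1)])
    fix k assume "k < n"
    have "inverse_pair (1 - scaleC (w n k * of_real \<rho>) a) (R (w n k * of_real \<rho>))"
      using that by (intro R) (simp add: norm_mult cw)
    then show "inverse_pair (1 - scaleC (exp (2 * of_real pi * \<i> * of_nat k / of_nat n)) (\<rho> *\<^sub>R a))
       (R (w n k * of_real \<rho>))" by (simp add: scaleR_scaleC scaleC_scaleC w_def)
  qed
  \<comment> \<open>The constant does not depend on \<open>n\<close>, because the roots of unity
    have modulus 1 and the average has total weight 1.\<close>
  have gl: "norm (g n \<rho> - g n \<sigma>) \<le> L * \<bar>\<rho> - \<sigma>\<bar>"
    if "0 < n" "0 \<le> \<rho>" "\<rho> \<le> 1" "0 \<le> \<sigma>" "\<sigma> \<le> 1" for n \<rho> \<sigma>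
  proof -
    have "norm (\<Sum>k<n. R (w n k * of_real \<rho>) - R (w n k * of_real \<sigma>)) \<le> (\<Sum>k<n. L * \<bar>\<rho> - \<sigma>\<bar>)"
    proof (rule sum_norm_le)
      fix k
      have "norm (R (w n k * of_real \<rho>) - R (w n k * of_real \<sigma>))
          \<le> L * cmod (w n k * of_real \<rho> - w n k * of_real \<sigma>)"
        using that by (intro L) (simp_all add: norm_mult cw)
      also have "w n k * of_real \<rho> - w n k * of_real \<sigma> = w n k * of_real (\<rho> - \<sigma>)"
        by (simp add: algebra_simps)
      finally show "norm (R (w n k * of_real \<rho>) - R (w n k * of_real \<sigma>)) \<le> L * \<bar>\<rho> - \<sigma>\<bar>"
        by (simp only: norm_mult cw norm_of_real)
    qed
    then have "norm ((1 / real n) *\<^sub>R (\<Sum>k<n. R (w n k * of_real \<rho>) - R (w n k * of_real \<sigma>)))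
        \<le> L * \<bar>\<rho> - \<sigma>\<bar>" using that by (simp add: field_simps)
    then show ?thesis unfolding g_def by (simp add: sum_subtractf scaleR_right_diff_distrib)
  qed
  \<comment> \<open>An element within 1/5 of 1 has inverse within (1/5)/(4/5) = 1/4 of 1. Moving the
    radius adds at most 1/4, and the inverse of an element within 1/2 of 1 is within 1 of 1.\<close>
  have step: "\<forall>\<^sub>F n in sequentially. norm ((\<sigma> *\<^sub>R a) ^ n) \<le> 1"
    if P: "(\<lambda>n. (\<rho> *\<^sub>R a) ^ n) \<longlonglongrightarrow> 0" and r: "0 \<le> \<rho>" "\<rho> \<le> \<sigma>" "\<sigma> \<le> 1" "L * (\<sigma> - \<rho>) \<le> 1 / 4" for \<rho> \<sigma>
  proof -
    have "\<forall>\<^sub>F n in sequentially. norm ((\<rho> *\<^sub>R a) ^ n) < 1 / 5"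
      using order_tendstoD(2)[OF tendsto_norm_zero[OF P], of "1 / 5"] by simp
    then have "\<forall>\<^sub>F n in sequentially. norm ((\<rho> *\<^sub>R a) ^ n) < 1 / 5 \<and> 0 < n"
      using eventually_gt_at_top[of "0::nat"] by (rule eventually_conj)
    then show ?thesis
    proof (rule eventually_mono)
      fix n assume elim: "norm ((\<rho> *\<^sub>R a) ^ n) < 1 / 5 \<and> 0 < n"
      have small: "norm (y - 1) \<le> norm h / (1 - norm h)"
        if "inverse_pair (1 - h) y" "norm h < 1" for h y :: 'a
      proof -
        obtain y' where y': "inverse_pair (1 - h) y'" "norm y' \<le> 1 / (1 - norm h)"
          using inverse_pair_one_minus \<open>norm h < 1\<close> by blast
        have "norm y \<le> 1 / (1 - norm h)" using y' that inverse_pair_unique by blast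
        moreover have "y - 1 = h * y" using that by (simp add: inverse_pair_def algebra_simps)
        moreover have "norm (h * y) \<le> norm h * norm y" by (rule norm_mult_ineq)
        ultimately have "norm (y - 1) \<le> norm h * (1 / (1 - norm h))"
          by (metis mult_left_mono norm_ge_zero order_trans)
        then show ?thesis by simp
      qed
      have "norm (g n \<rho> - 1) \<le> norm ((\<rho> *\<^sub>R a) ^ n) / (1 - norm ((\<rho> *\<^sub>R a) ^ n))"
        using elim r by (intro small g) auto
      also have "\<dots> \<le> (1 / 5) / (1 - 1 / 5)" using elim by (intro frac_le) auto
      finally have "norm (g n \<rho> - 1) \<le> 1 / 4" by simp
      moreover have "norm (g n \<sigma> - g n \<rho>) \<le> L * \<bar>\<sigma> - \<rho>\<bar>" using elim r by (intro gl) auto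
      moreover have "norm (g n \<sigma> - 1) \<le> norm (g n \<sigma> - g n \<rho>) + norm (g n \<rho> - 1)"
        using norm_triangle_ineq[of "g n \<sigma> - g n \<rho>" "g n \<rho> - 1"] by simp
      ultimately have h: "norm (1 - g n \<sigma>) \<le> 1 / 2" using r by (simp add: norm_minus_commute)
      have "inverse_pair (1 - (1 - g n \<sigma>)) (1 - (\<sigma> *\<^sub>R a) ^ n)"
        using g[of n \<sigma>] elim r by (auto simp: inverse_pair_def)
      then have "norm (1 - (\<sigma> *\<^sub>R a) ^ n - 1) \<le> norm (1 - g n \<sigma>) / (1 - norm (1 - g n \<sigma>))"
        using h by (intro small) auto
      also have "\<dots> \<le> (1 / 2) / (1 - 1 / 2)" using h by (intro frac_le) auto
      finally show "norm ((\<sigma> *\<^sub>R a) ^ n) \<le> 1" by simp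
    qed
  qed
  \<comment> \<open>\<open>step\<close> returns a bound but consumes convergence to 0; a strictly
    smaller radius recovers convergence through the factor
    \<open>(\<rho> / \<sigma>) ^ n\<close>.\<close>
  have shrink: "(\<lambda>n. (\<rho> *\<^sub>R a) ^ n) \<longlonglongrightarrow> 0"
    if Q: "\<forall>\<^sub>F n in sequentially. norm ((\<sigma> *\<^sub>R a) ^ n) \<le> 1" and r: "0 \<le> \<rho>" "\<rho> < \<sigma>" for \<rho> \<sigma>
  proof (rule Lim_null_comparison)
    show "\<forall>\<^sub>F n in sequentially. norm ((\<rho> *\<^sub>R a) ^ n) \<le> (\<rho> / \<sigma>) ^ n"
      using Q
    proof (rule eventually_mono)
      fix n assume elim: "norm ((\<sigma> *\<^sub>R a) ^ n) \<le> 1"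
      have "(\<rho> *\<^sub>R a) ^ n = (\<rho> / \<sigma>) ^ n *\<^sub>R (\<sigma> *\<^sub>R a) ^ n"
        using r by (simp add: power_divide)
      then have "norm ((\<rho> *\<^sub>R a) ^ n) = (\<rho> / \<sigma>) ^ n * norm ((\<sigma> *\<^sub>R a) ^ n)"
        using r by (simp only: norm_scaleR) simp
      also have "\<dots> \<le> (\<rho> / \<sigma>) ^ n * 1" using elim r by (intro mult_left_mono) auto
      finally show "norm ((\<rho> *\<^sub>R a) ^ n) \<le> (\<rho> / \<sigma>) ^ n" by simp
    qed
    show "(\<lambda>n. (\<rho> / \<sigma>) ^ n) \<longlonglongrightarrow> 0" using r by (intro LIMSEQ_realpow_zero) auto
  qed
  \<comment> \<open>A grid of mesh \<open>1 / N\<close> on which even a double step satisfies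
    \<open>L * (2 / N) \<le> 1 / 4\<close>.\<close>
  obtain N :: nat where N: "8 * L + 2 \<le> real N" using real_arch_simple by blast
  then have N2: "2 \<le> N" "8 * L \<le> real N" using L by linarith+
  have chain: "(\<lambda>n. ((real j / real N) *\<^sub>R a) ^ n) \<longlonglongrightarrow> 0" if "j + 1 \<le> N" for j
    using that
  proof (induction j)
    case 0
    have "(\<lambda>n. (0 :: 'a) ^ n) \<longlonglongrightarrow> 0"
      using eventually_gt_at_top[of "0::nat"]
      by (intro tendsto_eventually) (auto elim: eventually_mono simp: power_0_left)
    then show ?case by simp
  next
    case (Suc j)
    \<comment> \<open>Advance two grid points, which yields a bound only, then retreat one to regain
      convergence.\<close>
    have "\<forall>\<^sub>F n in sequentially. norm (((real (j + 2) / real N) *\<^sub>R a) ^ n) \<le> 1"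
      using Suc N2 by (intro step[of "real j / real N"]) (auto simp: field_simps)
    then show ?case by (rule shrink) (use N2 in \<open>auto simp: field_simps\<close>)
  qed
  have "\<forall>\<^sub>F n in sequentially. norm ((1 *\<^sub>R a) ^ n) \<le> 1"
    using chain[of "N - 1"] N2 by (intro step[of "real (N - 1) / real N"]) (auto simp: field_simps)
  then show ?thesis by simp
qed

section \<open>Spectrum of self-adjoint elements\<close>

definition spectrum :: "'a::unital_cstar_algebra \<Rightarrow> complex set" where
  "spectrum a = {z. \<not> invertible_elt (scaleC z 1 - a)}"

definition real_spectrum :: "'a::unital_cstar_algebra \<Rightarrow> real set" where
  "real_spectrum a = {t. complex_of_real t \<in> spectrum a}"

lemma invertible_elt_scaleC:
  assumes "c \<noteq> 0" shows "invertible_elt (scaleC c x) \<longleftrightarrow> invertible_elt x"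
proof -
  have "inverse_pair x y \<Longrightarrow> inverse_pair (scaleC d x) (scaleC (1 / d) y)" if "d \<noteq> 0" for d and x y :: 'a
    using that by (simp add: inverse_pair_def mult_scaleC_left mult_scaleC_right scaleC_scaleC)
  then have *: "invertible_elt x \<Longrightarrow> invertible_elt (scaleC d x)" if "d \<noteq> 0" for d and x :: 'a
    using that unfolding invertible_elt_def by blast
  show ?thesis using *[OF assms, of x] *[of "1 / c" "scaleC c x"] assms by (auto simp: scaleC_scaleC)
qed

lemma invertible_one_minus_iff:
  assumes "z \<noteq> 0"
  shows "invertible_elt (1 - scaleC z a) \<longleftrightarrow> 1 / z \<notin> spectrum a"
proof -
  have "1 - scaleC z a = scaleC z (scaleC (1 / z) 1 - a)"
    using assms by (simp add: scaleC_diff_right scaleC_scaleC)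
  then show ?thesis using assms by (simp add: spectrum_def invertible_elt_scaleC)
qed

lemma spectrum_norm_le: "z \<in> spectrum a \<Longrightarrow> cmod z \<le> norm a"
proof (rule ccontr)
  assume z: "z \<in> spectrum a" and n: "\<not> cmod z \<le> norm a"
  then have z0: "0 < cmod z" using norm_ge_zero[of a] by linarith
  then have "norm (scaleC (1 / z) a) < 1" using n by (simp add: norm_scaleC norm_divide)
  then have "invertible_elt (1 - scaleC (1 / z) a)"
    using inverse_pair_one_minus invertible_elt_def by blast
  then show False using z z0 invertible_one_minus_iff[of "1 / z" a] by simp
qed

lemma spectrum_shift: "z \<in> spectrum a \<longleftrightarrow> z + w \<in> spectrum (a + scaleC w 1)"
  by (simp add: spectrum_def scaleC_add_left)

text \<open>Arens' argument: shifting by a large imaginary scalar would violate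
  \<open>spectrum_norm_le\<close>.\<close>

lemma selfadjoint_spectrum_real:
  assumes a: "star a = a" and z: "z \<in> spectrum a"
  shows "Im z = 0"
proof -
  \<comment> \<open>The shift adds \<open>l\<^sup>2\<close> to both sides of the estimate; after
    cancellation the left side is still linear in \<open>l\<close>.\<close>
  have key: "(Re z)\<^sup>2 + (Im z)\<^sup>2 + 2 * Im z * l \<le> (norm a)\<^sup>2" for l :: real
  proof -
    define b where "b = a + scaleC (\<i> * of_real l) 1"
    have "star b * b = a * a + (l * l) *\<^sub>R 1"
      unfolding b_def by (simp add: a star_add star_scaleC algebra_simps mult_scaleC_left
          mult_scaleC_right scaleC_scaleC scaleR_scaleC scaleC_diff_right scaleC_add_right)
    then have "(norm b)\<^sup>2 = norm (a * a + (l * l) *\<^sub>R 1)" by (metis cstar_identity)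
    also have "\<dots> \<le> norm (a * a) + norm ((l * l) *\<^sub>R (1 :: 'a))" by (rule norm_triangle_ineq)
    also have "norm (a * a) = (norm a)\<^sup>2" by (metis cstar_identity a)
    finally have "(norm b)\<^sup>2 \<le> (norm a)\<^sup>2 + l\<^sup>2" by (simp add: power2_eq_square abs_mult_self)
    moreover have "(cmod (z + \<i> * of_real l))\<^sup>2 \<le> (norm b)\<^sup>2"
      using spectrum_norm_le[of "z + \<i> * of_real l" b] z spectrum_shift[of z a "\<i> * of_real l"]
      by (intro power_mono) (auto simp: b_def)
    ultimately show ?thesis by (simp add: cmod_power2 power2_sum)
  qed
  show ?thesis
  proof (rule ccontr)
    assume y: "Im z \<noteq> 0"
    \<comment> \<open>With this value of \<open>l\<close> the bound \<open>key\<close> would give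
      \<open>(norm a)\<^sup>2 + 1 \<le> (norm a)\<^sup>2\<close>.\<close>
    have "2 * Im z * (((norm a)\<^sup>2 + 1) / (2 * Im z)) = (norm a)\<^sup>2 + 1" using y by simp
    then show False using key[of "((norm a)\<^sup>2 + 1) / (2 * Im z)"]
      by (smt (verit) zero_le_power2)
  qed
qed

lemma selfadjoint_spectrum_of_real:
  assumes "star a = a" "z \<in> spectrum a" shows "z = of_real (Re z)" "Re z \<in> real_spectrum a"
proof -
  show "z = of_real (Re z)" using selfadjoint_spectrum_real[OF assms] by (simp add: complex_eq_iff)
  then show "Re z \<in> real_spectrum a" using assms(2) by (simp add: real_spectrum_def)
qed

lemma real_spectrum_abs_le: "t \<in> real_spectrum a \<Longrightarrow> \<bar>t\<bar> \<le> norm a"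
  using spectrum_norm_le[of "of_real t" a] by (simp add: real_spectrum_def)

text \<open>Iterated C*-identity. Along these exponents a bound on powers turns into a bound on
  \<open>norm a\<close> itself.\<close>

lemma norm_selfadjoint_power2:
  assumes "star a = a" shows "norm (a ^ (2 ^ k)) = norm a ^ (2 ^ k)"
proof (induction k)
  case (Suc k)
  have "a ^ (2 ^ Suc k) = star (a ^ 2 ^ k) * (a ^ 2 ^ k)"
    by (simp add: star_power assms power_add[symmetric] mult_2)
  then have "norm (a ^ (2 ^ Suc k)) = (norm (a ^ 2 ^ k))\<^sup>2" by (simp only: cstar_identity)
  then show ?case using Suc by (simp add: power_mult[symmetric] mult.commute)
qed simp

text \<open>The norm of a self-adjoint element is at most its spectral radius: after scaling, all
  \<open>1 - scaleC z b\<close> in the unit disc are invertible, so powers of \<open>b\<close> are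
  eventually bounded by 1, and an exponent \<open>2 ^ N\<close> gives
  \<open>norm b \<le> 1\<close>.\<close>

lemma norm_le_real_spectrum:
  assumes a: "star a = a" and B: "0 \<le> B" and s: "\<And>t. t \<in> real_spectrum a \<Longrightarrow> \<bar>t\<bar> \<le> B"
  shows "norm a \<le> B"
proof (rule field_le_epsilon)
  fix e :: real assume "0 < e"
  \<comment> \<open>Strictly above \<open>B\<close>, so that \<open>r / z\<close> avoids the
    spectrum also when \<open>z\<close> has modulus 1.\<close>
  define r where "r = B + e"
  have r: "0 < r" "B < r" using B \<open>0 < e\<close> by (auto simp: r_def)
  define b where "b = scaleC (of_real (1 / r)) a"
  have inv: "invertible_elt (1 - scaleC z b)" if "cmod z \<le> 1" for z
  proof (cases "z = 0")
    case True
    then show ?thesis by (auto simp: invertible_elt_def inverse_pair_def)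
  next
    case False
    have "r / z \<notin> spectrum a"
    proof
      assume h: "r / z \<in> spectrum a"
      then have "\<bar>Re (r / z)\<bar> \<le> B" by (intro s selfadjoint_spectrum_of_real[OF a])
      moreover have "cmod (r / z) = \<bar>Re (r / z)\<bar>"
        by (metis selfadjoint_spectrum_of_real(1)[OF a h] norm_of_real)
      ultimately have "r / cmod z \<le> B" using r by (simp add: norm_divide)
      moreover have "r \<le> r / cmod z" using that False r by (simp add: field_simps)
      ultimately show False using r by linarith
    qed
    moreover have "scaleC z b = scaleC (z / of_real r) a" by (simp add: b_def scaleC_scaleC)
    ultimately show ?thesis using invertible_one_minus_iff[of "z / of_real r" a] False r by simp
  qed
  have sb: "star b = b" by (simp add: b_def star_scaleC a)
  obtain N where N: "\<And>n. N \<le> n \<Longrightarrow> norm (b ^ n) \<le> 1"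
    using eventually_norm_power_le_one[OF inv] by (auto simp: eventually_sequentially)
  have "norm (b ^ (2 ^ N)) \<le> 1" by (intro N) (simp add: less_imp_le)
  then have "norm b ^ (2 ^ N) \<le> 1" by (simp only: norm_selfadjoint_power2[OF sb])
  then have "norm b \<le> 1" by (meson not_le one_less_power zero_less_numeral zero_less_power)
  then show "norm a \<le> B + e" using r by (simp add: b_def norm_scaleC norm_divide r_def[symmetric] field_simps)
qed

text \<open>With no spectrum the previous bound would force \<open>a = 0\<close>, but 0 lies in the
  spectrum of 0.\<close>

lemma real_spectrum_nonempty:
  assumes "star a = a" shows "real_spectrum a \<noteq> {}"
proof
  assume e: "real_spectrum a = {}"
  then have "norm a \<le> 0" using assms by (intro norm_le_real_spectrum) auto
  then have "(0 :: complex) \<in> spectrum a"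
    by (simp add: spectrum_def invertible_elt_def inverse_pair_def)
  then have "0 \<in> real_spectrum a" by (simp add: real_spectrum_def)
  then show False using e by blast
qed

section \<open>Polynomials in an element\<close>

text \<open>Complex coefficients let polynomials split into linear factors in
  \<open>invertible_cpoly_eval\<close>.\<close>

definition cpoly_eval :: "complex poly \<Rightarrow> 'a::unital_cstar_algebra \<Rightarrow> 'a" where
  "cpoly_eval p a = (\<Sum>k\<le>degree p. scaleC (coeff p k) (a ^ k))"

lemma cpoly_eval_bound:
  assumes "degree p \<le> n" shows "cpoly_eval p a = (\<Sum>k\<le>n. scaleC (coeff p k) (a ^ k))"
  unfolding cpoly_eval_def using assms
  by (intro sum.mono_neutral_left) (auto simp: coeff_eq_0)

lemma cpoly_eval_0 [simp]: "cpoly_eval 0 a = 0"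
  by (simp add: cpoly_eval_def)

lemma cpoly_eval_pCons [simp]: "cpoly_eval (pCons c p) a = scaleC c 1 + a * cpoly_eval p a"
proof -
  have "cpoly_eval (pCons c p) a = (\<Sum>k\<le>Suc (degree p). scaleC (coeff (pCons c p) k) (a ^ k))"
    by (rule cpoly_eval_bound) (rule degree_pCons_le)
  also have "\<dots> = scaleC c 1 + (\<Sum>k\<le>degree p. scaleC (coeff p k) (a ^ Suc k))"
    by (subst sum.atMost_Suc_shift) simp
  finally show ?thesis by (simp add: cpoly_eval_def sum_distrib_left mult_scaleC_right)
qed

lemma cpoly_eval_add: "cpoly_eval (p + q) a = cpoly_eval p a + cpoly_eval q a"
proof -
  let ?n = "max (degree p) (degree q)"
  have "cpoly_eval (p + q) a = (\<Sum>k\<le>?n. scaleC (coeff (p + q) k) (a ^ k))"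
    by (rule cpoly_eval_bound) (rule degree_add_le_max)
  then show ?thesis
    using cpoly_eval_bound[of p ?n a] cpoly_eval_bound[of q ?n a]
    by (simp add: scaleC_add_left sum.distrib)
qed

lemma cpoly_eval_smult: "cpoly_eval (Polynomial.smult c p) a = scaleC c (cpoly_eval p a)"
  by (induction p) (simp_all add: scaleC_add_right scaleC_scaleC mult_scaleC_right)

lemma cpoly_eval_mult: "cpoly_eval (p * q) a = cpoly_eval p a * cpoly_eval q a"
  by (induction p) (simp_all add: cpoly_eval_add cpoly_eval_smult algebra_simps mult_scaleC_left)

text \<open>A root of \<open>q\<close> is outside the spectrum, so its linear factor evaluates to an
  invertible element; splitting it off lowers the degree.\<close>

lemma invertible_cpoly_eval:
  assumes "q \<noteq> 0" "\<And>z. z \<in> spectrum a \<Longrightarrow> poly q z \<noteq> 0"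
  shows "invertible_elt (cpoly_eval q a)"
  using assms
proof (induction "degree q" arbitrary: q)
  case 0
  then obtain c where "q = [:c:]" "c \<noteq> 0" by (metis degree_eq_zeroE pCons_0_0)
  moreover have "invertible_elt (1 :: 'a)" by (auto simp: invertible_elt_def inverse_pair_def)
  ultimately show ?case by (simp add: invertible_elt_scaleC)
next
  case (Suc n)
  then have "\<not> constant (poly q)" by (simp add: constant_degree)
  then obtain z where z: "poly q z = 0" using fundamental_theorem_of_algebra by blast
  then obtain r where r: "q = [:- z, 1:] * r" by (metis poly_eq_0_iff_dvd dvdE)
  have "r \<noteq> 0" using r Suc.prems(1) by auto
  then have "degree q = Suc (degree r)" using r by (simp add: degree_mult_eq del: mult_pCons_left)
  then have "invertible_elt (cpoly_eval r a)"
    using Suc.prems(2) Suc.hyps(2) r \<open>r \<noteq> 0\<close> by (intro Suc.hyps(1)) auto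
  moreover have "invertible_elt (cpoly_eval [:- z, 1:] a)"
  proof -
    have "z \<notin> spectrum a" using z Suc.prems(2) by blast
    then have "invertible_elt (- (scaleC z 1 - a))"
      unfolding invertible_elt_uminus by (simp add: spectrum_def)
    then show ?thesis by simp
  qed
  ultimately show ?case unfolding r cpoly_eval_mult by (intro invertible_elt_mult)
qed

section \<open>Real polynomials and spectral mapping\<close>

abbreviation complex_poly :: "real poly \<Rightarrow> complex poly" where
  "complex_poly \<equiv> map_poly complex_of_real"

definition poly_eval :: "real poly \<Rightarrow> 'a::unital_cstar_algebra \<Rightarrow> 'a" where
  "poly_eval p a = (\<Sum>k\<le>degree p. coeff p k *\<^sub>R a ^ k)"

lemma poly_eval_cpoly_eval: "poly_eval p a = cpoly_eval (complex_poly p) a"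
  by (simp add: poly_eval_def cpoly_eval_def degree_map_poly coeff_map_poly scaleR_scaleC)

lemma complex_poly_add: "complex_poly (p + q) = complex_poly p + complex_poly q"
  by (rule poly_eqI) (simp add: coeff_map_poly)

lemma complex_poly_mult: "complex_poly (p * q) = complex_poly p * complex_poly q"
  by (rule poly_eqI) (simp add: coeff_map_poly coeff_mult)

lemma poly_complex_poly: "poly (complex_poly p) (of_real t) = of_real (poly p t)"
  by (induction p) (simp_all add: map_poly_pCons)

lemma poly_eval_add: "poly_eval (p + q) a = poly_eval p a + poly_eval q a"
  by (simp add: poly_eval_cpoly_eval complex_poly_add cpoly_eval_add)

lemma poly_eval_diff: "poly_eval (p - q) a = poly_eval p a - poly_eval q a"
  using poly_eval_add[of "p - q" q a] by simp

lemma poly_eval_mult: "poly_eval (p * q) a = poly_eval p a * poly_eval q a"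
  by (simp add: poly_eval_cpoly_eval complex_poly_mult cpoly_eval_mult)

lemma poly_eval_const [simp]: "poly_eval [:c:] a = c *\<^sub>R 1"
  by (simp add: poly_eval_def)

lemma poly_eval_ident [simp]: "poly_eval [:0, 1:] a = a"
  by (simp add: poly_eval_cpoly_eval map_poly_pCons)

lemma star_poly_eval: "star a = a \<Longrightarrow> star (poly_eval p a) = poly_eval p a"
  by (simp add: poly_eval_def star_sum star_power)

text \<open>One inclusion of the spectral mapping theorem: if \<open>t - p\<close> has no zero on
  the spectrum, then \<open>invertible_cpoly_eval\<close> makes \<open>t - p(a)\<close>
  invertible.\<close>

lemma real_spectrum_poly_eval:
  assumes a: "star a = a" and t: "t \<in> real_spectrum (poly_eval p a)"
  shows "\<exists>s\<in>real_spectrum a. poly p s = t"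
proof (rule ccontr)
  assume n: "\<not> (\<exists>s\<in>real_spectrum a. poly p s = t)"
  \<comment> \<open>A point of the spectrum is what excludes \<open>q = 0\<close>, the case of
    \<open>p\<close> constantly \<open>t\<close>.\<close>
  obtain s where s: "s \<in> real_spectrum a" using real_spectrum_nonempty[OF a] by blast
  define q where "q = complex_poly ([:t:] - p)"
  have qv: "poly q (of_real s) \<noteq> 0" if "s \<in> real_spectrum a" for s
    using n that unfolding q_def poly_complex_poly by auto
  have "q \<noteq> 0" using qv[OF s] by auto
  moreover have "poly q z \<noteq> 0" if "z \<in> spectrum a" for z
    using qv[of "Re z"] selfadjoint_spectrum_of_real[OF a that] by simp
  ultimately have "invertible_elt (cpoly_eval q a)" by (rule invertible_cpoly_eval)
  then have "invertible_elt (scaleC (of_real t) 1 - poly_eval p a)"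
    unfolding q_def poly_eval_cpoly_eval[symmetric] poly_eval_diff by (simp add: scaleR_scaleC)
  then show False using t by (simp add: real_spectrum_def spectrum_def)
qed

text \<open>The contractivity estimate that lets the functional calculus extend from polynomials to
  uniform limits.\<close>

lemma norm_poly_eval_le:
  assumes "star a = a" "0 \<le> B" "\<And>t. t \<in> real_spectrum a \<Longrightarrow> \<bar>poly p t\<bar> \<le> B"
  shows "norm (poly_eval p a) \<le> B"
  using assms real_spectrum_poly_eval[OF assms(1)]
  by (intro norm_le_real_spectrum star_poly_eval) auto

section \<open>Continuous functional calculus\<close>

text \<open>Shaped like \<open>mat_cfc\<close>, so that \<open>mat_cfc_lift\<close> can match the
  two descriptions.\<close>

definition cfc :: "(real \<Rightarrow> real) \<Rightarrow> 'a::unital_cstar_algebra \<Rightarrow> 'a" where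
  "cfc f a = (THE b. \<exists>p. uniform_limit (real_spectrum a) (\<lambda>k. poly (p k)) f sequentially \<and>
     (\<lambda>k. poly_eval (p k) a) \<longlonglongrightarrow> b)"

text \<open>Used with \<open>p = q\<close> for the Cauchy property and with two sequences for
  independence of the choice.\<close>

lemma uniform_limit_poly_eval_diff:
  assumes a: "star a = a"
    and p: "uniform_limit (real_spectrum a) (\<lambda>k. poly (p k)) f sequentially"
    and q: "uniform_limit (real_spectrum a) (\<lambda>k. poly (q k)) f sequentially" and e: "0 < e"
  shows "\<exists>N. \<forall>m\<ge>N. \<forall>n\<ge>N. norm (poly_eval (p m) a - poly_eval (q n) a) \<le> e"
proof -
  have e2: "0 < e / 2" using e by simp
  obtain M where M: "\<forall>n\<ge>M. \<forall>t\<in>real_spectrum a. \<bar>poly (p n) t - f t\<bar> < e / 2"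
    using p e2 unfolding uniform_limit_sequentially_iff dist_real_def by blast
  obtain N where N: "\<forall>n\<ge>N. \<forall>t\<in>real_spectrum a. \<bar>poly (q n) t - f t\<bar> < e / 2"
    using q e2 unfolding uniform_limit_sequentially_iff dist_real_def by blast
  have "norm (poly_eval (p m) a - poly_eval (q n) a) \<le> e" if "max M N \<le> m" "max M N \<le> n" for m n
  proof -
    have "\<bar>poly (p m - q n) t\<bar> \<le> e" if "t \<in> real_spectrum a" for t
    proof -
      have "\<bar>poly (p m) t - f t\<bar> < e / 2" "\<bar>poly (q n) t - f t\<bar> < e / 2"
        using M N that \<open>max M N \<le> m\<close> \<open>max M N \<le> n\<close> by auto
      then show ?thesis unfolding poly_diff by linarith
    qed
    then show ?thesis unfolding poly_eval_diff[symmetric] using a e by (intro norm_poly_eval_le) auto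
  qed
  then show ?thesis by blast
qed

lemma cfc_eqI:
  assumes a: "star a = a" and p: "uniform_limit (real_spectrum a) (\<lambda>k. poly (p k)) f sequentially"
    and b: "(\<lambda>k. poly_eval (p k) a) \<longlonglongrightarrow> b"
  shows "cfc f a = b"
  unfolding cfc_def
proof (rule the_equality)
  show "\<exists>p. uniform_limit (real_spectrum a) (\<lambda>k. poly (p k)) f sequentially \<and>
     (\<lambda>k. poly_eval (p k) a) \<longlonglongrightarrow> b" using p b by blast
  fix c assume "\<exists>p. uniform_limit (real_spectrum a) (\<lambda>k. poly (p k)) f sequentially \<and>
     (\<lambda>k. poly_eval (p k) a) \<longlonglongrightarrow> c"
  then obtain q where q: "uniform_limit (real_spectrum a) (\<lambda>k. poly (q k)) f sequentially"
    "(\<lambda>k. poly_eval (q k) a) \<longlonglongrightarrow> c" by blast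
  have "(\<lambda>k. poly_eval (p k) a - poly_eval (q k) a) \<longlonglongrightarrow> b - c" by (intro tendsto_diff b q)
  then have lim: "(\<lambda>k. norm (poly_eval (p k) a - poly_eval (q k) a)) \<longlonglongrightarrow> norm (b - c)"
    by (rule tendsto_norm)
  have "norm (b - c) \<le> 0 + e" if "0 < e" for e
    using uniform_limit_poly_eval_diff[OF a p q(1) that]
    by (intro LIMSEQ_le_const2[OF lim]) auto
  then have "norm (b - c) \<le> 0" by (rule field_le_epsilon)
  then show "c = b" by simp
qed

text \<open>Continuity on the whole line allows Stone-Weierstrass on an interval around
  \<open>S\<close>, so boundedness of \<open>S\<close> suffices.\<close>

lemma uniform_limit_polys_exist:
  fixes f :: "real \<Rightarrow> real"
  assumes "continuous_on UNIV f" "bounded S"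
  shows "\<exists>p. uniform_limit S (\<lambda>k. poly (p k)) f sequentially"
proof -
  obtain M where M: "\<And>x. x \<in> S \<Longrightarrow> \<bar>x\<bar> \<le> M" using assms(2) by (auto simp: bounded_iff)
  have "\<exists>p. \<forall>x\<in>{-M..M}. \<bar>f x - poly p x\<bar> < inverse (real (Suc k))" for k
  proof -
    obtain g where g: "real_polynomial_function g"
      "\<And>x. x \<in> {-M..M} \<Longrightarrow> \<bar>f x - g x\<bar> < inverse (real (Suc k))"
      using Stone_Weierstrass_real_polynomial_function[of "{-M..M}" f "inverse (real (Suc k))"]
        assms(1) continuous_on_subset by (metis compact_Icc inverse_positive_iff_positive
          of_nat_0_less_iff subset_UNIV zero_less_Suc)
    then obtain c n where "g = (\<lambda>x. \<Sum>i\<le>n::nat. c i * x ^ i)"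
      using real_polynomial_function_imp_sum by blast
    then have "g = poly (\<Sum>i\<le>n. monom (c i) i)" by (auto simp: poly_sum poly_monom)
    then show ?thesis using g by blast
  qed
  then obtain p where p: "\<And>k x. x \<in> {-M..M} \<Longrightarrow> \<bar>f x - poly (p k) x\<bar> < inverse (real (Suc k))"
    by metis
  have "uniform_limit S (\<lambda>k. poly (p k)) f sequentially"
    unfolding uniform_limit_iff
  proof (intro allI impI)
    fix e :: real assume "0 < e"
    then have "\<forall>\<^sub>F k in sequentially. inverse (real (Suc k)) < e"
      using LIMSEQ_inverse_real_of_nat order_tendstoD(2) by blast
    then show "\<forall>\<^sub>F k in sequentially. \<forall>x\<in>S. dist (poly (p k) x) (f x) < e"
    proof (rule eventually_mono)
      fix k assume k: "inverse (real (Suc k)) < e"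
      show "\<forall>x\<in>S. dist (poly (p k) x) (f x) < e"
      proof
        fix x assume "x \<in> S"
        then have "x \<in> {-M..M}" using M[of x] by (auto simp: abs_le_iff)
        then show "dist (poly (p k) x) (f x) < e"
          using p[of x k] k by (simp add: dist_real_def abs_minus_commute)
      qed
    qed
  qed
  then show ?thesis by blast
qed

lemma bounded_real_spectrum: "bounded (real_spectrum a)"
  unfolding bounded_iff using real_spectrum_abs_le by auto

lemma cfc_approximation:
  assumes a: "star a = a" and f: "continuous_on UNIV f"
  obtains p where "uniform_limit (real_spectrum a) (\<lambda>k. poly (p k)) f sequentially"
    "(\<lambda>k. poly_eval (p k) a) \<longlonglongrightarrow> cfc f a"
proof -
  obtain p where p: "uniform_limit (real_spectrum a) (\<lambda>k. poly (p k)) f sequentially"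
    using uniform_limit_polys_exist[OF f bounded_real_spectrum] by blast
  have "Cauchy (\<lambda>k. poly_eval (p k) a)"
    unfolding Cauchy_def dist_norm
  proof (intro allI impI)
    fix e :: real assume "0 < e"
    then obtain N where "\<forall>m\<ge>N. \<forall>n\<ge>N. norm (poly_eval (p m) a - poly_eval (p n) a) \<le> e / 2"
      using uniform_limit_poly_eval_diff[OF a p p, of "e / 2"] by auto
    then show "\<exists>M. \<forall>m\<ge>M. \<forall>n\<ge>M. norm (poly_eval (p m) a - poly_eval (p n) a) < e"
      using \<open>0 < e\<close> by (intro exI[of _ N]) force
  qed
  then obtain b where "(\<lambda>k. poly_eval (p k) a) \<longlonglongrightarrow> b" using Cauchy_convergent convergent_def by blast
  then show thesis using that p cfc_eqI[OF a p] by blast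
qed

text \<open>The sequence is arbitrary because \<open>mat_cfc\<close> quantifies over all
  approximating sequences.\<close>

lemma tendsto_cfc:
  assumes a: "star a = a" and f: "continuous_on UNIV f"
    and q: "uniform_limit (real_spectrum a) (\<lambda>k. poly (q k)) f sequentially"
  shows "(\<lambda>k. poly_eval (q k) a) \<longlonglongrightarrow> cfc f a"
proof -
  obtain p where p: "uniform_limit (real_spectrum a) (\<lambda>k. poly (p k)) f sequentially"
    "(\<lambda>k. poly_eval (p k) a) \<longlonglongrightarrow> cfc f a" using cfc_approximation[OF a f] .
  have "(\<lambda>k. poly_eval (q k) a - poly_eval (p k) a) \<longlonglongrightarrow> 0"
    unfolding LIMSEQ_def dist_norm
  proof (intro allI impI)
    fix e :: real assume "0 < e"
    then obtain N where "\<forall>m\<ge>N. \<forall>n\<ge>N. norm (poly_eval (q m) a - poly_eval (p n) a) \<le> e / 2"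
      using uniform_limit_poly_eval_diff[OF a q p(1), of "e / 2"] by auto
    then show "\<exists>N. \<forall>n\<ge>N. norm (poly_eval (q n) a - poly_eval (p n) a - 0) < e"
      using \<open>0 < e\<close> by (intro exI[of _ N]) force
  qed
  from tendsto_add[OF this p(2)] show ?thesis by simp
qed

lemma cfc_cong:
  assumes "\<And>t. t \<in> real_spectrum a \<Longrightarrow> f t = g t" shows "cfc f a = cfc g a"
proof -
  have "uniform_limit (real_spectrum a) q f sequentially \<longleftrightarrow>
        uniform_limit (real_spectrum a) q g sequentially" for q :: "nat \<Rightarrow> real \<Rightarrow> real"
    using assms by (intro uniform_limit_cong') auto
  then show ?thesis unfolding cfc_def by simp
qed

lemma cfc_poly: "star a = a \<Longrightarrow> cfc (poly p) a = poly_eval p a"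
  by (rule cfc_eqI[where p = "\<lambda>_. p"]) (auto intro: uniform_limit_const)

lemma cfc_const: "star a = a \<Longrightarrow> cfc (\<lambda>_. c) a = c *\<^sub>R 1"
  using cfc_poly[of a "[:c:]"] cfc_cong[of a "poly [:c:]" "\<lambda>_. c"] by simp

lemma cfc_ident: "star a = a \<Longrightarrow> cfc (\<lambda>t. t) a = a"
  using cfc_poly[of a "[:0, 1:]"] cfc_cong[of a "poly [:0, 1:]" "\<lambda>t. t"] by simp

lemma cfc_add:
  assumes a: "star a = a" and f: "continuous_on UNIV f" and g: "continuous_on UNIV g"
  shows "cfc (\<lambda>t. f t + g t) a = cfc f a + cfc g a"
proof -
  obtain p where p: "uniform_limit (real_spectrum a) (\<lambda>k. poly (p k)) f sequentially"
    "(\<lambda>k. poly_eval (p k) a) \<longlonglongrightarrow> cfc f a" using cfc_approximation[OF a f] .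
  obtain q where q: "uniform_limit (real_spectrum a) (\<lambda>k. poly (q k)) g sequentially"
    "(\<lambda>k. poly_eval (q k) a) \<longlonglongrightarrow> cfc g a" using cfc_approximation[OF a g] .
  show ?thesis
  proof (rule cfc_eqI[OF a])
    show "uniform_limit (real_spectrum a) (\<lambda>k. poly (p k + q k)) (\<lambda>t. f t + g t) sequentially"
      using uniform_limit_add[OF p(1) q(1)] by (simp only: poly_add[abs_def])
    show "(\<lambda>k. poly_eval (p k + q k) a) \<longlonglongrightarrow> cfc f a + cfc g a"
      unfolding poly_eval_add by (intro tendsto_add p q)
  qed
qed

text \<open>Supplies the boundedness of the limits that a product of uniform limits
  requires.\<close>

lemma bounded_continuous_image:
  fixes f :: "real \<Rightarrow> real"
  assumes "continuous_on UNIV f" "bounded S" shows "bounded (f ` S)"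
proof -
  have "compact (f ` closure S)"
    using assms by (intro compact_continuous_image) (auto intro: continuous_on_subset)
  then show ?thesis by (meson bounded_subset closure_subset compact_imp_bounded image_mono)
qed

lemma cfc_mult:
  assumes a: "star a = a" and f: "continuous_on UNIV f" and g: "continuous_on UNIV g"
  shows "cfc (\<lambda>t. f t * g t) a = cfc f a * cfc g a"
proof -
  obtain p where p: "uniform_limit (real_spectrum a) (\<lambda>k. poly (p k)) f sequentially"
    "(\<lambda>k. poly_eval (p k) a) \<longlonglongrightarrow> cfc f a" using cfc_approximation[OF a f] .
  obtain q where q: "uniform_limit (real_spectrum a) (\<lambda>k. poly (q k)) g sequentially"
    "(\<lambda>k. poly_eval (q k) a) \<longlonglongrightarrow> cfc g a" using cfc_approximation[OF a g] .
  show ?thesis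
  proof (rule cfc_eqI[OF a])
    show "uniform_limit (real_spectrum a) (\<lambda>k. poly (p k * q k)) (\<lambda>t. f t * g t) sequentially"
      unfolding poly_mult[abs_def]
      by (intro uniform_lim_mult p q bounded_continuous_image f g bounded_real_spectrum)
    show "(\<lambda>k. poly_eval (p k * q k) a) \<longlonglongrightarrow> cfc f a * cfc g a"
      unfolding poly_eval_mult by (intro tendsto_mult p q)
  qed
qed

lemma star_cfc:
  assumes a: "star a = a" and f: "continuous_on UNIV f"
  shows "star (cfc f a) = cfc f a"
proof -
  obtain p where p: "uniform_limit (real_spectrum a) (\<lambda>k. poly (p k)) f sequentially"
    "(\<lambda>k. poly_eval (p k) a) \<longlonglongrightarrow> cfc f a" using cfc_approximation[OF a f] .
  have "(\<lambda>k. star (poly_eval (p k) a)) \<longlonglongrightarrow> star (cfc f a)" by (intro tendsto_star p)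
  then show ?thesis using p(2) LIMSEQ_unique unfolding star_poly_eval[OF a] by blast
qed

lemma norm_cfc_le:
  assumes a: "star a = a" and f: "continuous_on UNIV f"
    and B: "0 \<le> B" "\<And>t. t \<in> real_spectrum a \<Longrightarrow> \<bar>f t\<bar> \<le> B"
  shows "norm (cfc f a) \<le> B"
proof (rule field_le_epsilon)
  fix e :: real assume e: "0 < e"
  obtain p where p: "uniform_limit (real_spectrum a) (\<lambda>k. poly (p k)) f sequentially"
    "(\<lambda>k. poly_eval (p k) a) \<longlonglongrightarrow> cfc f a" using cfc_approximation[OF a f] .
  obtain N where N: "\<forall>n\<ge>N. \<forall>t\<in>real_spectrum a. \<bar>poly (p n) t - f t\<bar> < e"
    using p(1) e unfolding uniform_limit_sequentially_iff dist_real_def by blast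
  have "norm (poly_eval (p n) a) \<le> B + e" if "N \<le> n" for n
  proof (rule norm_poly_eval_le[OF a])
    fix t assume "t \<in> real_spectrum a"
    then have "\<bar>f t\<bar> \<le> B" "\<bar>poly (p n) t - f t\<bar> < e" using B(2) N that by auto
    then show "\<bar>poly (p n) t\<bar> \<le> B + e" by linarith
  qed (use B e in auto)
  then show "norm (cfc f a) \<le> B + e"
    by (intro LIMSEQ_le_const2[OF tendsto_norm[OF p(2)]]) auto
qed

section \<open>Positive elements\<close>

definition positive_elt :: "'a::unital_cstar_algebra \<Rightarrow> bool" where
  "positive_elt a \<longleftrightarrow> star a = a \<and> (\<forall>t\<in>real_spectrum a. 0 \<le> t)"

lemma positive_star: "positive_elt a \<Longrightarrow> star a = a"
  by (simp add: positive_elt_def)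

lemma real_spectrum_scaleR_one_minus:
  "t \<in> real_spectrum (c *\<^sub>R 1 - a) \<longleftrightarrow> c - t \<in> real_spectrum a"
proof -
  have "scaleC (of_real t) 1 - (c *\<^sub>R 1 - a) = - (scaleC (of_real (c - t)) 1 - a)"
    by (simp add: scaleR_scaleC scaleC_diff_left)
  then show ?thesis
    unfolding real_spectrum_def spectrum_def mem_Collect_eq by (metis invertible_elt_uminus)
qed

text \<open>Together with \<open>norm_le_if_positive\<close> this is the metric criterion for
  positivity; unlike the spectral definition it behaves well under sums.\<close>

lemma positive_if_norm_le:
  assumes "star a = a" "norm (s *\<^sub>R 1 - a) \<le> s" shows "positive_elt a"
  unfolding positive_elt_def
proof (intro conjI ballI)
  fix t assume "t \<in> real_spectrum a"
  then have "s - t \<in> real_spectrum (s *\<^sub>R 1 - a)" by (simp add: real_spectrum_scaleR_one_minus)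
  then show "0 \<le> t" using real_spectrum_abs_le assms(2) by fastforce
qed (rule assms)

lemma norm_le_if_positive:
  assumes "positive_elt a" "norm a \<le> s" shows "norm (s *\<^sub>R 1 - a) \<le> s"
proof (rule norm_le_real_spectrum)
  show "star (s *\<^sub>R 1 - a) = s *\<^sub>R 1 - a" using assms by (simp add: star_diff positive_star)
  show "0 \<le> s" using assms(2) norm_ge_zero order_trans by blast
  fix t assume "t \<in> real_spectrum (s *\<^sub>R 1 - a)"
  then have "s - t \<in> real_spectrum a" by (simp add: real_spectrum_scaleR_one_minus)
  then show "\<bar>t\<bar> \<le> s"
    using assms real_spectrum_abs_le[of "s - t" a] unfolding positive_elt_def by fastforce
qed

text \<open>The metric criterion with \<open>s = norm a + norm b\<close>, by the triangle
  inequality.\<close>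

lemma positive_add:
  assumes "positive_elt a" "positive_elt b" shows "positive_elt (a + b)"
proof (rule positive_if_norm_le)
  show "star (a + b) = a + b" using assms by (simp add: star_add positive_star)
  have "(norm a + norm b) *\<^sub>R 1 - (a + b) = (norm a *\<^sub>R 1 - a) + (norm b *\<^sub>R 1 - b)"
    by (simp add: scaleR_left_distrib)
  then show "norm ((norm a + norm b) *\<^sub>R 1 - (a + b)) \<le> norm a + norm b"
    using norm_le_if_positive[OF assms(1) order_refl] norm_le_if_positive[OF assms(2) order_refl]
    by (metis add_mono norm_triangle_le)
qed

lemma positive_square:
  assumes "star a = a" shows "positive_elt (a * a)"
proof -
  have e: "poly_eval ([:0, 1:] * [:0, 1:]) a = a * a" unfolding poly_eval_mult by simp
  have "0 \<le> t" if t: "t \<in> real_spectrum (a * a)" for t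
    using real_spectrum_poly_eval[OF assms, of t "[:0, 1:] * [:0, 1:]"] t unfolding e by auto
  then show ?thesis using assms by (simp add: positive_elt_def star_mult)
qed

lemma positive_0 [simp]: "positive_elt 0"
  using positive_square[of 0] by simp

lemma positive_sum: "(\<And>i. i \<in> I \<Longrightarrow> positive_elt (f i)) \<Longrightarrow> positive_elt (\<Sum>i\<in>I. f i)"
  by (induction I rule: infinite_finite_induct) (simp_all add: positive_add)

text \<open>\<open>sqrt\<close> is extended to negative arguments as an odd function, hence
  continuous on the whole line.\<close>

lemma continuous_on_UNIV_sqrt: "continuous_on UNIV sqrt"
  by (intro continuous_on_real_sqrt continuous_on_id)

lemma positive_sqrt:
  assumes "positive_elt a" obtains d where "star d = d" "d * d = a"
proof -
  have sa: "star a = a" using assms by (rule positive_star)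
  have "cfc sqrt a * cfc sqrt a = cfc (\<lambda>t. sqrt t * sqrt t) a"
    by (rule cfc_mult[symmetric]) (simp_all add: sa continuous_on_UNIV_sqrt)
  also have "\<dots> = cfc (\<lambda>t. t) a" using assms by (intro cfc_cong) (auto simp: positive_elt_def)
  finally show thesis using that star_cfc[OF sa continuous_on_UNIV_sqrt] cfc_ident[OF sa] by simp
qed

text \<open>Jacobson's formula: the inverse of \<open>1 - y * x\<close> is
  \<open>1 + y * z * x\<close> with \<open>z\<close> the inverse of
  \<open>1 - x * y\<close>.\<close>

lemma invertible_one_minus_commute:
  fixes x y :: "'a::ring_1"
  assumes "invertible_elt (1 - x * y)" shows "invertible_elt (1 - y * x)"
proof -
  obtain z where "inverse_pair (1 - x * y) z" using assms by (auto simp: invertible_elt_def)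
  then have z: "z - x * y * z = 1" "z - z * x * y = 1"
    by (simp_all add: inverse_pair_def algebra_simps)
  have "(1 - y * x) * (1 + y * z * x) = 1 - y * x + y * (z - x * y * z) * x"
    "(1 + y * z * x) * (1 - y * x) = 1 - y * x + y * (z - z * x * y) * x"
    by (simp_all add: algebra_simps)
  then have "inverse_pair (1 - y * x) (1 + y * z * x)" unfolding z by (simp add: inverse_pair_def)
  then show ?thesis by (auto simp: invertible_elt_def)
qed

lemma spectrum_mult_commute:
  assumes "z \<in> spectrum (x * y)" "z \<noteq> 0" shows "z \<in> spectrum (y * x)"
proof (rule ccontr)
  assume "z \<notin> spectrum (y * x)"
  then have "invertible_elt (1 - y * scaleC (1 / z) x)"
    using invertible_one_minus_iff[of "1 / z" "y * x"] assms(2) by (simp add: mult_scaleC_right)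
  then have "invertible_elt (1 - scaleC (1 / z) x * y)" by (rule invertible_one_minus_commute)
  then show False
    using invertible_one_minus_iff[of "1 / z" "x * y"] assms by (simp add: mult_scaleC_left)
qed

lemma real_spectrum_scaleR:
  assumes "0 < c" "t \<in> real_spectrum a" shows "c * t \<in> real_spectrum (c *\<^sub>R a)"
proof -
  have "scaleC (of_real (c * t)) 1 - c *\<^sub>R a = scaleC (of_real c) (scaleC (of_real t) 1 - a)"
    by (simp add: scaleC_diff_right scaleC_scaleC scaleR_scaleC)
  then show ?thesis using assms invertible_elt_scaleC[of "of_real c" "scaleC (of_real t) 1 - a"]
    unfolding real_spectrum_def spectrum_def mem_Collect_eq by simp
qed

lemma positive_scaleR_cancel:
  assumes "0 < c" "positive_elt (c *\<^sub>R a)" shows "positive_elt a"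
proof -
  have "c *\<^sub>R star a = c *\<^sub>R a" using assms(2) by (metis positive_star star_scaleR)
  then have "star a = a" using assms(1) by simp
  moreover have "0 \<le> t" if "t \<in> real_spectrum a" for t
    using real_spectrum_scaleR[OF assms(1) that] assms by (auto simp: positive_elt_def zero_le_mult_iff)
  ultimately show ?thesis by (simp add: positive_elt_def)
qed

text \<open>With \<open>u = x + x\<^sup>*\<close> and \<open>v = \<i> (x - x\<^sup>*)\<close> self-adjoint,
  \<open>2 x x\<^sup>* = u\<^sup>2 + v\<^sup>2 - 2 x\<^sup>* x\<close>; so \<open>x x\<^sup>*\<close> is positive, while its nonzero spectrum is that of
  \<open>x\<^sup>* x\<close>.\<close>

lemma eq_0_if_positive_uminus:
  fixes x :: "'a::unital_cstar_algebra"
  assumes "positive_elt (- (star x * x))" shows "x = 0"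
proof -
  define u where "u = x + star x"
  define v where "v = scaleC \<i> (x - star x)"
  have su: "star u = u" by (simp add: u_def star_add add.commute)
  have sv: "star v = v" by (simp add: v_def star_scaleC star_diff scaleC_diff_right)
  have vv: "v * v = - ((x - star x) * (x - star x))"
    by (simp add: v_def mult_scaleC_left mult_scaleC_right scaleC_scaleC)
  have "2 *\<^sub>R (x * star x) = u * u + v * v + (- (star x * x)) + (- (star x * x))"
    unfolding vv u_def by (simp add: algebra_simps scaleR_2)
  moreover have "positive_elt (u * u + v * v + (- (star x * x)) + (- (star x * x)))"
    by (intro positive_add positive_square su sv assms)
  ultimately have "positive_elt (2 *\<^sub>R (x * star x))" by simp
  then have p: "positive_elt (x * star x)" by (rule positive_scaleR_cancel[rotated]) simp
  \<comment> \<open>The spectrum of \<open>star x * x\<close> is nonpositive by hypothesis and,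
    through \<open>x * star x\<close>, nonnegative; so it contains only 0.\<close>
  have "norm (star x * x) \<le> 0"
  proof (rule norm_le_real_spectrum)
    show "star (star x * x) = star x * x" by (simp add: star_mult)
    fix t assume t: "t \<in> real_spectrum (star x * x)"
    then have "0 - (- t) \<in> real_spectrum (0 *\<^sub>R 1 - (- (star x * x)))" by simp
    then have "- t \<in> real_spectrum (- (star x * x))"
      using real_spectrum_scaleR_one_minus[of "0 - (- t)" 0 "- (star x * x)"] by simp
    then have "t \<le> 0" using assms by (auto simp: positive_elt_def)
    moreover have "0 \<le> t"
    proof (cases "t = 0")
      case False
      then have "t \<in> real_spectrum (x * star x)"
        using t spectrum_mult_commute by (auto simp: real_spectrum_def)
      then show ?thesis using p by (simp add: positive_elt_def)
    qed simp
    ultimately show "\<bar>t\<bar> \<le> 0" by simp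
  qed simp
  then show ?thesis by (simp add: cstar_identity)
qed

text \<open>Let \<open>n\<close> be the negative part of \<open>a = star x * x\<close> and
  \<open>b = x * n\<close>. Then \<open>star b * b\<close> equals minus the cube of
  \<open>n\<close>, so \<open>eq_0_if_positive_uminus\<close> kills \<open>b\<close>, hence the cube
  of \<open>n\<close>, hence \<open>n\<close>.\<close>

theorem positive_star_mult: "positive_elt (star x * x)"
proof -
  define a where "a = star x * x"
  have sa: "star a = a" by (simp add: a_def star_mult)
  define m :: "real \<Rightarrow> real" where "m t = max (- t) 0" for t
  have cm: "continuous_on UNIV m" unfolding m_def by (intro continuous_intros)
  have csm: "continuous_on UNIV (\<lambda>t. m t * sqrt (m t))"
    by (intro continuous_intros cm)
  define n where "n = cfc m a"
  have sn: "star n = n" unfolding n_def by (intro star_cfc sa cm)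
  define b where "b = x * n"
  have "star b * b = n * a * n" by (simp add: b_def star_mult sn a_def mult.assoc)
  also have "\<dots> = cfc m a * cfc (\<lambda>t. t) a * cfc m a" by (simp add: n_def cfc_ident[OF sa])
  also have "\<dots> = cfc (\<lambda>t. m t * t * m t) a"
    by (simp only: cfc_mult[OF sa cm continuous_on_id]
        cfc_mult[OF sa continuous_on_mult[OF cm continuous_on_id] cm])
  finally have bb: "star b * b = cfc (\<lambda>t. m t * t * m t) a" .
  \<comment> \<open>The cube of \<open>n\<close> is positive, being the square of its self-adjoint
    power with exponent 3/2.\<close>
  have "cfc (\<lambda>t. m t * sqrt (m t)) a * cfc (\<lambda>t. m t * sqrt (m t)) a
      = cfc (\<lambda>t. (m t * sqrt (m t)) * (m t * sqrt (m t))) a"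
    by (intro cfc_mult[symmetric] sa csm)
  also have "\<dots> = cfc (\<lambda>t. - 1 * (m t * t * m t)) a"
  proof (rule cfc_cong)
    fix t
    have "m t * t = - (m t * m t)" "sqrt (m t) * sqrt (m t) = m t" by (simp_all add: m_def max_def)
    then show "(m t * sqrt (m t)) * (m t * sqrt (m t)) = - 1 * (m t * t * m t)" by simp
  qed
  also have "\<dots> = cfc (\<lambda>_. - 1) a * cfc (\<lambda>t. m t * t * m t) a"
    by (intro cfc_mult sa continuous_intros cm)
  also have "\<dots> = - (star b * b)" by (simp add: cfc_const sa bb)
  finally have "positive_elt (- (star b * b))"
    by (metis positive_square star_cfc[OF sa csm])
  then have b0: "b = 0" by (rule eq_0_if_positive_uminus)
  then have "cfc (\<lambda>t. - 1 * (m t * t * m t)) a = 0"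
    using bb cfc_mult[OF sa, of "\<lambda>_. - 1" "\<lambda>t. m t * t * m t"]
    by (simp add: continuous_intros cm)
  moreover have "n * n * n = cfc (\<lambda>t. m t * m t * m t) a"
    by (simp only: n_def cfc_mult[OF sa cm cm] cfc_mult[OF sa continuous_on_mult[OF cm cm] cm])
  moreover have "\<dots> = cfc (\<lambda>t. - 1 * (m t * t * m t)) a"
  proof (rule cfc_cong)
    fix t
    have "m t * t = - (m t * m t)" by (simp add: m_def max_def)
    then show "m t * m t * m t = - 1 * (m t * t * m t)" by simp
  qed
  ultimately have "n * n * n * n = 0" by simp
  then have "norm (n ^ (2 ^ 2)) = 0" by (simp add: power4_eq_xxxx)
  then have n0: "n = 0" unfolding norm_selfadjoint_power2[OF sn] by simp
  define q :: "real \<Rightarrow> real" where "q t = sqrt (max t 0)" for t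
  have cq: "continuous_on UNIV q" unfolding q_def by (intro continuous_intros)
  \<comment> \<open>\<open>t + m t\<close> is the positive part of \<open>t\<close>, so
    \<open>a\<close> becomes the square of the self-adjoint \<open>cfc q a\<close>.\<close>
  have "a = cfc (\<lambda>t. t) a + cfc m a" using n0 by (simp add: n_def cfc_ident[OF sa])
  also have "\<dots> = cfc (\<lambda>t. t + m t) a" by (intro cfc_add[symmetric] sa cm continuous_intros)
  also have "\<dots> = cfc (\<lambda>t. q t * q t) a" by (intro cfc_cong) (auto simp: m_def q_def max_def)
  also have "\<dots> = cfc q a * cfc q a" by (intro cfc_mult sa cq)
  finally show ?thesis unfolding a_def[symmetric] using positive_square star_cfc[OF sa cq] by metis
qed

section \<open>Order estimates for positive elements\<close>

lemma positive_conjugate: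
  assumes "positive_elt a" shows "positive_elt (star c * a * c)"
proof -
  obtain d where d: "star d = d" "d * d = a" using positive_sqrt[OF assms] .
  have "star c * a * c = star (d * c) * (d * c)" by (simp add: star_mult d(1) d(2)[symmetric] mult.assoc)
  then show ?thesis using positive_star_mult by metis
qed

lemma positive_norm_minus: "star a = a \<Longrightarrow> norm a \<le> s \<Longrightarrow> positive_elt (s *\<^sub>R 1 - a)"
  using real_spectrum_abs_le[of _ a]
  by (fastforce simp: positive_elt_def star_diff real_spectrum_scaleR_one_minus)

lemma norm_le_if_positive_minus:
  assumes "positive_elt a" "positive_elt (s *\<^sub>R 1 - a)" "0 \<le> s" shows "norm a \<le> s"
proof (rule norm_le_real_spectrum)
  fix t assume "t \<in> real_spectrum a"
  then have "0 \<le> t" "s - t \<in> real_spectrum (s *\<^sub>R 1 - a)"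
    using assms by (auto simp: positive_elt_def real_spectrum_scaleR_one_minus)
  then show "\<bar>t\<bar> \<le> s" using assms(2) by (auto simp: positive_elt_def)
qed (use assms in \<open>auto simp: positive_star\<close>)

text \<open>In the order of positive elements, \<open>a\<close> is below \<open>a + b\<close>, which
  is below the scalar \<open>norm (a + b)\<close>.\<close>

lemma positive_norm_mono:
  assumes "positive_elt a" "positive_elt b" shows "norm a \<le> norm (a + b)"
proof (rule norm_le_if_positive_minus[OF assms(1)])
  have "positive_elt (norm (a + b) *\<^sub>R 1 - (a + b))"
    using assms by (intro positive_norm_minus) (simp_all add: star_add positive_star)
  from positive_add[OF this assms(2)] show "positive_elt (norm (a + b) *\<^sub>R 1 - a)"
    by (simp add: algebra_simps)
qed simp

section \<open>The Hilbert module of vectors\<close>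

definition hinner :: "'a::unital_cstar_algebra vec \<Rightarrow> 'a vec \<Rightarrow> 'a" where
  "hinner x y = (\<Sum>i<dim_vec x. star (x $ i) * y $ i)"

lemma vec_norm_hinner: "(vec_norm x)\<^sup>2 = norm (hinner x x)"
  by (simp add: vec_norm_def hinner_def)

lemma vec_norm_ge_0 [simp]: "0 \<le> vec_norm x"
  by (simp add: vec_norm_def)

lemma positive_hinner: "positive_elt (hinner x x)"
  unfolding hinner_def by (intro positive_sum positive_star_mult)

lemma star_hinner:
  assumes "dim_vec x = dim_vec y" shows "star (hinner x y) = hinner y x"
  using assms by (simp add: hinner_def star_sum star_mult)

text \<open>Expand the inner product of \<open>x c - y\<close> with itself for
  \<open>c = \<alpha> *\<^sub>R a\<close>, and enlarge \<open>hinner x x\<close> and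
  \<open>hinner y y\<close> to the scalars \<open>s\<close> and \<open>t\<close>. The result is a
  positive element comparing a multiple of \<open>star a * a\<close> with \<open>t\<close>, and
  \<open>\<alpha>\<close> remains free.\<close>

lemma hinner_Cauchy_Schwarz:
  fixes x y :: "'a::unital_cstar_algebra vec"
  assumes "dim_vec x = dim_vec y" shows "norm (hinner x y) \<le> vec_norm x * vec_norm y"
proof -
  define a where "a = hinner x y"
  define s t where "s = norm (hinner x x)" and "t = norm (hinner y y)"
  have key: "(2 * \<alpha> - \<alpha>\<^sup>2 * s) * (norm a)\<^sup>2 \<le> t" if q: "0 \<le> 2 * \<alpha> - \<alpha>\<^sup>2 * s" for \<alpha> :: real
  proof -
    define c where "c = \<alpha> *\<^sub>R a"
    define q where "q = 2 * \<alpha> - \<alpha>\<^sup>2 * s"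
    have "(\<Sum>i<dim_vec x. star (x $ i * c - y $ i) * (x $ i * c - y $ i))
        = star c * hinner x x * c - star c * hinner x y - hinner y x * c + hinner y y"
      using assms by (simp add: hinner_def star_diff star_mult algebra_simps sum.distrib
          sum_subtractf sum_distrib_left sum_distrib_right)
    also have "\<dots> = star c * hinner x x * c - (2 * \<alpha>) *\<^sub>R (star a * a) + hinner y y"
      unfolding star_hinner[OF assms, symmetric] a_def[symmetric] c_def
      by (simp add: algebra_simps scaleR_2[symmetric])
    finally have "positive_elt (star c * hinner x x * c - (2 * \<alpha>) *\<^sub>R (star a * a) + hinner y y)"
      using positive_sum[of "{..<dim_vec x}" "\<lambda>i. star (x $ i * c - y $ i) * (x $ i * c - y $ i)"]
        positive_star_mult by metis
    moreover have "positive_elt (star c * (s *\<^sub>R 1 - hinner x x) * c)"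
      by (intro positive_conjugate positive_norm_minus) (simp_all add: s_def positive_star positive_hinner)
    moreover have "positive_elt (t *\<^sub>R 1 - hinner y y)"
      by (intro positive_norm_minus) (simp_all add: t_def positive_star positive_hinner)
    ultimately have p: "positive_elt ((star c * hinner x x * c - (2 * \<alpha>) *\<^sub>R (star a * a) + hinner y y)
        + star c * (s *\<^sub>R 1 - hinner x x) * c + (t *\<^sub>R 1 - hinner y y))"
      by (intro positive_add[OF positive_add])
    have "star c * (s *\<^sub>R 1 - z) * c = (\<alpha>\<^sup>2 * s) *\<^sub>R (star a * a) - star c * z * c" for z
      by (simp add: c_def right_diff_distrib left_diff_distrib scaleR_diff_right power2_eq_square mult_ac)
    then have "(star c * hinner x x * c - (2 * \<alpha>) *\<^sub>R (star a * a) + hinner y y)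
        + star c * (s *\<^sub>R 1 - hinner x x) * c + (t *\<^sub>R 1 - hinner y y)
        = t *\<^sub>R 1 - q *\<^sub>R (star a * a)"
      by (simp add: q_def scaleR_diff_left)
    with p have p: "positive_elt (t *\<^sub>R 1 - q *\<^sub>R (star a * a))" by simp
    have "q *\<^sub>R (star a * a) = star (sqrt q *\<^sub>R a) * (sqrt q *\<^sub>R a)"
      using that by (simp add: q_def)
    then have "positive_elt (q *\<^sub>R (star a * a))" using positive_star_mult by metis
    then have "norm (q *\<^sub>R (star a * a)) \<le> t"
      using p by (rule norm_le_if_positive_minus) (simp add: t_def)
    then show ?thesis using that by (simp add: q_def cstar_identity)
  qed
  \<comment> \<open>For \<open>s = 0\<close> a large \<open>\<alpha>\<close> forces
    \<open>a = 0\<close>; otherwise \<open>1 / s\<close> maximises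
    \<open>2 * \<alpha> - \<alpha>\<^sup>2 * s\<close>.\<close>
  have "(norm a)\<^sup>2 \<le> s * t"
  proof (cases "s = 0")
    case True
    have "norm a = 0"
    proof (rule ccontr)
      assume "norm a \<noteq> 0"
      then have "2 * ((t + 1) / (2 * (norm a)\<^sup>2)) * (norm a)\<^sup>2 = t + 1" by simp
      then show False using key[of "(t + 1) / (2 * (norm a)\<^sup>2)"] True by (simp add: t_def)
    qed
    then show ?thesis by (simp add: True)
  next
    case False
    then have "0 < s" by (simp add: s_def)
    then show ?thesis using key[of "1 / s"] by (simp add: power2_eq_square field_simps)
  qed
  also have "s * t = (vec_norm x * vec_norm y)\<^sup>2"
    by (simp add: s_def t_def power_mult_distrib vec_norm_hinner)
  finally show ?thesis unfolding a_def by (rule power2_le_imp_le) simp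
qed

lemma vec_norm_le_if_hinner:
  assumes "norm (hinner x x) \<le> K * vec_norm x" "0 \<le> K" shows "vec_norm x \<le> K"
proof (cases "vec_norm x = 0")
  case False
  then have "0 < vec_norm x" by (simp add: less_le)
  then show ?thesis using assms(1) unfolding vec_norm_hinner[symmetric] power2_eq_square by simp
qed (use assms in simp)

lemma vec_norm_triangle:
  assumes "dim_vec x = dim_vec y" shows "vec_norm (x + y) \<le> vec_norm x + vec_norm y"
proof (rule power2_le_imp_le)
  have e: "hinner (x + y) (x + y) = hinner x x + hinner x y + (hinner y x + hinner y y)"
    using assms by (simp add: hinner_def star_add algebra_simps sum.distrib)
  have "norm (hinner (x + y) (x + y))
      \<le> norm (hinner x x) + norm (hinner x y) + (norm (hinner y x) + norm (hinner y y))"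
    unfolding e by (meson norm_triangle_ineq norm_triangle_mono)
  also have "\<dots> \<le> (vec_norm x)\<^sup>2 + vec_norm x * vec_norm y + (vec_norm y * vec_norm x + (vec_norm y)\<^sup>2)"
    using assms unfolding vec_norm_hinner by (intro add_mono hinner_Cauchy_Schwarz) auto
  finally show "(vec_norm (x + y))\<^sup>2 \<le> (vec_norm x + vec_norm y)\<^sup>2"
    by (simp add: vec_norm_hinner[symmetric] power2_eq_square algebra_simps)
qed simp

lemma norm_coord_le_vec_norm:
  assumes "i < dim_vec x" shows "norm (x $ i) \<le> vec_norm x"
proof (rule power2_le_imp_le)
  have "hinner x x = star (x $ i) * x $ i + (\<Sum>j\<in>{..<dim_vec x} - {i}. star (x $ j) * x $ j)"
    unfolding hinner_def using assms by (intro sum.remove) auto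
  moreover have "norm (star (x $ i) * x $ i)
      \<le> norm (star (x $ i) * x $ i + (\<Sum>j\<in>{..<dim_vec x} - {i}. star (x $ j) * x $ j))"
    by (intro positive_norm_mono positive_sum positive_star_mult)
  ultimately have "norm (star (x $ i) * x $ i) \<le> norm (hinner x x)" by simp
  then show "(norm (x $ i))\<^sup>2 \<le> (vec_norm x)\<^sup>2" by (simp add: cstar_identity vec_norm_hinner)
qed simp

lemma vec_norm_le_sum: "vec_norm x \<le> (\<Sum>i<dim_vec x. norm (x $ i))"
proof (rule power2_le_imp_le)
  have "(vec_norm x)\<^sup>2 \<le> (\<Sum>i<dim_vec x. norm (star (x $ i) * x $ i))"
    unfolding vec_norm_hinner hinner_def by (rule norm_sum)
  also have "\<dots> = (\<Sum>i<dim_vec x. norm (x $ i) * norm (x $ i))"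
    by (simp add: cstar_identity power2_eq_square)
  also have "\<dots> \<le> (\<Sum>i<dim_vec x. norm (x $ i) * (\<Sum>j<dim_vec x. norm (x $ j)))"
    by (intro sum_mono mult_left_mono member_le_sum) auto
  finally show "(vec_norm x)\<^sup>2 \<le> (\<Sum>i<dim_vec x. norm (x $ i))\<^sup>2"
    by (simp add: sum_distrib_right[symmetric] power2_eq_square)
qed (simp add: sum_nonneg)

section \<open>The operator norm of matrices\<close>

lemma scaleC_sum_right: "scaleC c (\<Sum>i\<in>I. f i) = (\<Sum>i\<in>I. scaleC c (f i))"
  by (induction I rule: infinite_finite_induct) (simp_all add: scaleC_add_right)

abbreviation scaleC_mat :: "complex \<Rightarrow> 'a::unital_cstar_algebra mat \<Rightarrow> 'a mat" where
  "scaleC_mat c \<equiv> map_mat (scaleC c)"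

abbreviation scaleC_vec :: "complex \<Rightarrow> 'a::unital_cstar_algebra vec \<Rightarrow> 'a vec" where
  "scaleC_vec c \<equiv> map_vec (scaleC c)"

lemma mult_mat_vec_index:
  "i < dim_row A \<Longrightarrow> dim_vec x = dim_col A \<Longrightarrow> (A *\<^sub>v x) $ i = (\<Sum>j<dim_col A. A $$ (i, j) * x $ j)"
  by (simp add: scalar_prod_def atLeast0LessThan)

lemma mult_mat_index:
  "i < dim_row A \<Longrightarrow> j < dim_col B \<Longrightarrow> dim_col A = dim_row B \<Longrightarrow>
    (A * B) $$ (i, j) = (\<Sum>k<dim_col A. A $$ (i, k) * B $$ (k, j))"
  by (simp add: scalar_prod_def atLeast0LessThan)

lemma vec_norm_scaleC: "vec_norm (scaleC_vec c x) = cmod c * vec_norm x"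
proof (rule power2_eq_imp_eq)
  have "hinner (scaleC_vec c x) (scaleC_vec c x) = scaleC (cnj c * c) (hinner x x)"
    by (simp add: hinner_def star_scaleC mult_scaleC_left mult_scaleC_right scaleC_scaleC
        scaleC_sum_right mult.commute)
  then show "(vec_norm (scaleC_vec c x))\<^sup>2 = (cmod c * vec_norm x)\<^sup>2"
    unfolding power_mult_distrib vec_norm_hinner
    by (simp add: norm_scaleC norm_mult power2_eq_square)
qed simp_all

lemma mult_mat_scaleC_vec:
  "dim_vec x = dim_col A \<Longrightarrow> A *\<^sub>v scaleC_vec c x = scaleC_vec c (A *\<^sub>v x)"
  by (rule eq_vecI) (simp_all add: mult_mat_vec_index mult_scaleC_right scaleC_sum_right
      del: index_mult_mat_vec)

lemma scaleC_mat_mult_vec: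
  "dim_vec x = dim_col A \<Longrightarrow> scaleC_mat c A *\<^sub>v x = scaleC_vec c (A *\<^sub>v x)"
  by (rule eq_vecI) (simp_all add: mult_mat_vec_index mult_scaleC_left scaleC_sum_right
      del: index_mult_mat_vec)

lemma vec_norm_mult_le_sum:
  assumes "dim_vec x = dim_col A"
  shows "vec_norm (A *\<^sub>v x) \<le> (\<Sum>i<dim_row A. \<Sum>j<dim_col A. norm (A $$ (i, j))) * vec_norm x"
proof -
  have "vec_norm (A *\<^sub>v x) \<le> (\<Sum>i<dim_row A. norm ((A *\<^sub>v x) $ i))"
    using vec_norm_le_sum[of "A *\<^sub>v x"] by simp
  also have "\<dots> \<le> (\<Sum>i<dim_row A. \<Sum>j<dim_col A. norm (A $$ (i, j)) * vec_norm x)"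
  proof (rule sum_mono)
    fix i assume "i \<in> {..<dim_row A}"
    then have "norm ((A *\<^sub>v x) $ i) \<le> (\<Sum>j<dim_col A. norm (A $$ (i, j) * x $ j))"
      using assms by (simp add: mult_mat_vec_index norm_sum del: index_mult_mat_vec)
    also have "\<dots> \<le> (\<Sum>j<dim_col A. norm (A $$ (i, j)) * vec_norm x)"
      using assms by (intro sum_mono order_trans[OF norm_mult_ineq] mult_left_mono
          norm_coord_le_vec_norm) auto
    finally show "norm ((A *\<^sub>v x) $ i) \<le> (\<Sum>j<dim_col A. norm (A $$ (i, j)) * vec_norm x)" .
  qed
  finally show ?thesis by (simp add: sum_distrib_right)
qed

text \<open>Makes the real-valued supremum in \<open>mat_norm\<close> a genuine one.\<close>

lemma bdd_above_mat_norm: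
  fixes A :: "'a::unital_cstar_algebra mat"
  shows "bdd_above ((\<lambda>x. vec_norm (A *\<^sub>v x)) ` {x \<in> carrier_vec (dim_col A). vec_norm x \<le> 1})"
proof (rule bdd_aboveI2)
  fix x :: "'a vec" assume "x \<in> {x \<in> carrier_vec (dim_col A). vec_norm x \<le> 1}"
  then have x: "dim_vec x = dim_col A" "vec_norm x \<le> 1" by auto
  have "(\<Sum>i<dim_row A. \<Sum>j<dim_col A. norm (A $$ (i, j))) * vec_norm x
      \<le> (\<Sum>i<dim_row A. \<Sum>j<dim_col A. norm (A $$ (i, j))) * 1"
    using x by (intro mult_left_mono sum_nonneg) auto
  then show "vec_norm (A *\<^sub>v x) \<le> (\<Sum>i<dim_row A. \<Sum>j<dim_col A. norm (A $$ (i, j)))"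
    using vec_norm_mult_le_sum[OF x(1)] by linarith
qed

lemma vec_norm_0 [simp]: "vec_norm (0\<^sub>v n) = 0"
  by (simp add: vec_norm_def)

lemma vec_norm_mult_mat_le:
  assumes "dim_vec x = dim_col A" shows "vec_norm (A *\<^sub>v x) \<le> mat_norm A * vec_norm x"
proof (cases "vec_norm x = 0")
  \<comment> \<open>Such an \<open>x\<close> cannot be normalised; the entrywise bound covers
    it.\<close>
  case True
  then show ?thesis using vec_norm_mult_le_sum[OF assms] by simp
next
  case False
  then have p: "0 < vec_norm x" by (simp add: less_le)
  define y where "y = scaleC_vec (of_real (1 / vec_norm x)) x"
  have "vec_norm y = 1"
    using p unfolding y_def vec_norm_scaleC norm_of_real by simp
  moreover have "y \<in> carrier_vec (dim_col A)" by (rule carrier_vecI) (simp add: y_def assms)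
  ultimately have "y \<in> {x \<in> carrier_vec (dim_col A). vec_norm x \<le> 1}" by simp
  then have "vec_norm (A *\<^sub>v y) \<le> mat_norm A"
    unfolding mat_norm_def by (rule cSUP_upper[OF _ bdd_above_mat_norm])
  moreover have "vec_norm (A *\<^sub>v y) = vec_norm (A *\<^sub>v x) / vec_norm x"
    using p unfolding y_def mult_mat_scaleC_vec[OF assms] vec_norm_scaleC norm_of_real by simp
  ultimately show ?thesis using p by (simp add: field_simps)
qed

lemma mat_norm_leI:
  fixes A :: "'a::unital_cstar_algebra mat"
  assumes "0 \<le> K" "\<And>x. dim_vec x = dim_col A \<Longrightarrow> vec_norm (A *\<^sub>v x) \<le> K * vec_norm x"
  shows "mat_norm A \<le> K"
  unfolding mat_norm_def
proof (rule cSUP_least)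
  have "0\<^sub>v (dim_col A) \<in> {x \<in> carrier_vec (dim_col A). vec_norm x \<le> 1}" by simp
  then show "{x \<in> carrier_vec (dim_col A). vec_norm x \<le> 1} \<noteq> {}" by blast
  fix x :: "'a vec" assume "x \<in> {x \<in> carrier_vec (dim_col A). vec_norm x \<le> 1}"
  then have x: "dim_vec x = dim_col A" "vec_norm x \<le> 1" by auto
  then have "vec_norm (A *\<^sub>v x) \<le> K * vec_norm x" by (intro assms)
  also have "\<dots> \<le> K * 1" using x assms by (intro mult_left_mono)
  finally show "vec_norm (A *\<^sub>v x) \<le> K" by simp
qed

lemma mat_norm_ge_0 [simp]: "0 \<le> mat_norm A"
proof -
  have "vec_norm (A *\<^sub>v 0\<^sub>v (dim_col A)) \<le> mat_norm A"
    unfolding mat_norm_def by (intro cSUP_upper[OF _ bdd_above_mat_norm]) simp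
  then show ?thesis using vec_norm_ge_0 order_trans by blast
qed

lemma mat_norm_le_sum: "mat_norm A \<le> (\<Sum>i<dim_row A. \<Sum>j<dim_col A. norm (A $$ (i, j)))"
  by (intro mat_norm_leI vec_norm_mult_le_sum sum_nonneg) auto

lemma norm_entry_le_mat_norm:
  fixes A :: "'a::unital_cstar_algebra mat"
  assumes "i < dim_row A" "j < dim_col A" shows "norm (A $$ (i, j)) \<le> mat_norm A"
proof -
  let ?e = "unit_vec (dim_col A) j :: 'a vec"
  have "hinner ?e ?e = 1" using assms
    by (simp add: hinner_def unit_vec_def if_distrib[of star] if_distrib[of "\<lambda>z. z * _"] cong: if_cong)
  then have e: "vec_norm ?e = 1" using vec_norm_hinner[of ?e]
    by (metis norm_one power2_eq_1_iff vec_norm_ge_0 not_one_le_zero neg_0_le_iff_le)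
  have "norm ((A *\<^sub>v ?e) $ i) \<le> vec_norm (A *\<^sub>v ?e)"
    using assms by (intro norm_coord_le_vec_norm) simp
  also have "\<dots> \<le> mat_norm A * vec_norm ?e" by (rule vec_norm_mult_mat_le) simp
  also have "(A *\<^sub>v ?e) $ i = A $$ (i, j)" using assms by simp
  finally show ?thesis using e by simp
qed

lemma mat_norm_0 [simp]: "mat_norm (0\<^sub>m n m :: 'a::unital_cstar_algebra mat) = 0"
  using mat_norm_le_sum[of "0\<^sub>m n m :: 'a mat"] mat_norm_ge_0[of "0\<^sub>m n m :: 'a mat"]
  by (simp del: mat_norm_ge_0)

lemma mat_norm_eq_0: "mat_norm A = 0 \<Longrightarrow> A = 0\<^sub>m (dim_row A) (dim_col A)"
  using norm_entry_le_mat_norm[of _ A] by (intro eq_matI) auto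

lemma mat_norm_1:
  assumes "1 \<le> n" shows "mat_norm (1\<^sub>m n :: 'a::unital_cstar_algebra mat) = 1"
proof (rule antisym)
  show "mat_norm (1\<^sub>m n :: 'a mat) \<le> 1"
  proof (rule mat_norm_leI)
    fix x :: "'a vec" assume "dim_vec x = dim_col (1\<^sub>m n :: 'a mat)"
    then have "x \<in> carrier_vec n" by (intro carrier_vecI) simp
    then show "vec_norm (1\<^sub>m n *\<^sub>v x) \<le> 1 * vec_norm x" by simp
  qed simp
  show "1 \<le> mat_norm (1\<^sub>m n :: 'a mat)"
    using norm_entry_le_mat_norm[of 0 "1\<^sub>m n :: 'a mat" 0] assms by simp
qed

lemma mat_norm_add:
  assumes "A \<in> carrier_mat n m" "B \<in> carrier_mat n m"
  shows "mat_norm (A + B) \<le> mat_norm A + mat_norm B"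
proof (rule mat_norm_leI)
  fix x :: "'a vec" assume "dim_vec x = dim_col (A + B)"
  then have x: "x \<in> carrier_vec m" using assms by (intro carrier_vecI) simp
  have "vec_norm ((A + B) *\<^sub>v x) = vec_norm (A *\<^sub>v x + B *\<^sub>v x)"
    using add_mult_distrib_mat_vec[OF assms x] by simp
  also have "\<dots> \<le> vec_norm (A *\<^sub>v x) + vec_norm (B *\<^sub>v x)"
    using assms by (intro vec_norm_triangle) auto
  also have "\<dots> \<le> mat_norm A * vec_norm x + mat_norm B * vec_norm x"
    using assms x by (intro add_mono vec_norm_mult_mat_le) auto
  finally show "vec_norm ((A + B) *\<^sub>v x) \<le> (mat_norm A + mat_norm B) * vec_norm x"
    by (simp add: distrib_right)
qed simp

lemma mat_norm_mult:
  assumes "A \<in> carrier_mat n m" "B \<in> carrier_mat m l"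
  shows "mat_norm (A * B) \<le> mat_norm A * mat_norm B"
proof (rule mat_norm_leI)
  fix x :: "'a vec" assume "dim_vec x = dim_col (A * B)"
  then have x: "x \<in> carrier_vec l" using assms by (intro carrier_vecI) simp
  have "vec_norm (A * B *\<^sub>v x) = vec_norm (A *\<^sub>v (B *\<^sub>v x))"
    using assoc_mult_mat_vec[OF assms x] by simp
  also have "\<dots> \<le> mat_norm A * vec_norm (B *\<^sub>v x)" using assms by (intro vec_norm_mult_mat_le) auto
  also have "\<dots> \<le> mat_norm A * (mat_norm B * vec_norm x)"
    using assms x by (intro mult_left_mono vec_norm_mult_mat_le) auto
  finally show "vec_norm (A * B *\<^sub>v x) \<le> mat_norm A * mat_norm B * vec_norm x" by (simp add: mult.assoc)
qed simp

lemma mat_norm_scaleC: "mat_norm (scaleC_mat c A) = cmod c * mat_norm A"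
proof -
  have le: "mat_norm (scaleC_mat c A) \<le> cmod c * mat_norm A" for c and A :: "'a mat"
  proof (rule mat_norm_leI)
    fix x :: "'a vec" assume "dim_vec x = dim_col (scaleC_mat c A)"
    then have x: "dim_vec x = dim_col A" by simp
    show "vec_norm (scaleC_mat c A *\<^sub>v x) \<le> cmod c * mat_norm A * vec_norm x"
      using vec_norm_mult_mat_le[OF x]
      by (simp add: scaleC_mat_mult_vec[OF x] vec_norm_scaleC mult_left_mono mult.assoc)
  qed simp
  show ?thesis
  proof (cases "c = 0")
    case True
    then show ?thesis using le[of c A] by (simp add: order_antisym)
  next
    case False
    have "scaleC_mat (1 / c) (scaleC_mat c A) = A"
      using False by (intro eq_matI) (auto simp: scaleC_scaleC)
    then have "mat_norm A \<le> cmod (1 / c) * mat_norm (scaleC_mat c A)" using le by metis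
    then have "cmod c * mat_norm A \<le> mat_norm (scaleC_mat c A)"
      using False by (simp add: norm_divide field_simps)
    then show ?thesis using le[of c A] by simp
  qed
qed

lemma mat_norm_uminus: "mat_norm (- A) = mat_norm A"
proof -
  have "- A = scaleC_mat (- 1) A" by (intro eq_matI) auto
  then show ?thesis by (simp add: mat_norm_scaleC)
qed

lemma mat_norm_minus_commute:
  assumes "A \<in> carrier_mat n m" "B \<in> carrier_mat n m"
  shows "mat_norm (A - B) = mat_norm (B - A)"
proof -
  have "A - B = - (B - A)" using assms by (intro eq_matI) auto
  then show ?thesis by (simp add: mat_norm_uminus)
qed

lemma mat_norm_triangle3:
  assumes "A \<in> carrier_mat n m" "B \<in> carrier_mat n m" "C \<in> carrier_mat n m"
  shows "mat_norm (A - C) \<le> mat_norm (A - B) + mat_norm (B - C)"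
proof -
  have "A - C = (A - B) + (B - C)" using assms by (intro eq_matI) auto
  then show ?thesis using assms by (metis mat_norm_add minus_carrier_mat)
qed

section \<open>Adjoint matrices and the C*-identity\<close>

lemma mat_star_carrier [simp]: "A \<in> carrier_mat n m \<Longrightarrow> mat_star A \<in> carrier_mat m n"
  by (auto simp: mat_star_def)

lemma dim_mat_star [simp]: "dim_row (mat_star A) = dim_col A" "dim_col (mat_star A) = dim_row A"
  by (auto simp: mat_star_def)

lemma mat_star_index [simp]:
  "i < dim_col A \<Longrightarrow> j < dim_row A \<Longrightarrow> mat_star A $$ (i, j) = star (A $$ (j, i))"
  by (simp add: mat_star_def)

lemma mat_star_star [simp]: "mat_star (mat_star A) = A"
  by (rule eq_matI) auto

lemma mat_star_mult:
  assumes "dim_col A = dim_row B" shows "mat_star (A * B) = mat_star B * mat_star A"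
  using assms by (intro eq_matI)
    (simp_all add: mult_mat_index star_sum star_mult del: index_mult_mat(1))

lemma hinner_mult_mat:
  assumes "dim_vec x = dim_col A" "dim_vec y = dim_row A"
  shows "hinner (A *\<^sub>v x) y = hinner x (mat_star A *\<^sub>v y)"
proof -
  have "hinner (A *\<^sub>v x) y = (\<Sum>i<dim_row A. \<Sum>j<dim_col A. star (x $ j) * star (A $$ (i, j)) * y $ i)"
    using assms by (simp add: hinner_def mult_mat_vec_index star_sum star_mult sum_distrib_right
        del: index_mult_mat_vec)
  also have "\<dots> = (\<Sum>j<dim_col A. \<Sum>i<dim_row A. star (x $ j) * star (A $$ (i, j)) * y $ i)"
    by (rule sum.swap)
  also have "\<dots> = hinner x (mat_star A *\<^sub>v y)"
    using assms by (simp add: hinner_def mult_mat_vec_index sum_distrib_left mult.assoc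
        del: index_mult_mat_vec)
  finally show ?thesis .
qed

text \<open>Moving \<open>mat_star A\<close> across the inner product, Cauchy-Schwarz bounds the
  squared norm of \<open>mat_star A *\<^sub>v y\<close> by \<open>mat_norm A\<close> times that norm
  times the norm of \<open>y\<close>; one factor cancels.\<close>

lemma mat_norm_star [simp]: "mat_norm (mat_star A) = mat_norm A"
proof -
  have le: "mat_norm (mat_star A) \<le> mat_norm A" for A :: "'a mat"
  proof (rule mat_norm_leI)
    fix y :: "'a vec" assume "dim_vec y = dim_col (mat_star A)"
    then have y: "dim_vec y = dim_row A" by simp
    have "hinner (mat_star A *\<^sub>v y) (mat_star A *\<^sub>v y) = hinner (A *\<^sub>v (mat_star A *\<^sub>v y)) y"
      using hinner_mult_mat[of "mat_star A *\<^sub>v y" A y] y by simp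
    then have "norm (hinner (mat_star A *\<^sub>v y) (mat_star A *\<^sub>v y))
        \<le> vec_norm (A *\<^sub>v (mat_star A *\<^sub>v y)) * vec_norm y"
      using hinner_Cauchy_Schwarz[of "A *\<^sub>v (mat_star A *\<^sub>v y)" y] y by simp
    also have "\<dots> \<le> (mat_norm A * vec_norm (mat_star A *\<^sub>v y)) * vec_norm y"
      by (intro mult_right_mono vec_norm_mult_mat_le) auto
    finally show "vec_norm (mat_star A *\<^sub>v y) \<le> mat_norm A * vec_norm y"
      by (intro vec_norm_le_if_hinner) (simp_all add: mult_ac)
  qed simp
  show ?thesis using le[of A] le[of "mat_star A"] by simp
qed

text \<open>The nontrivial inequality is Cauchy-Schwarz for \<open>x\<close> and the image of
  \<open>x\<close> under \<open>mat_star A * A\<close>.\<close>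

lemma mat_norm_cstar_identity: "mat_norm (mat_star A * A) = (mat_norm A)\<^sup>2"
proof (rule antisym)
  have c: "A \<in> carrier_mat (dim_row A) (dim_col A)" by (rule carrier_matI) simp_all
  show "mat_norm (mat_star A * A) \<le> (mat_norm A)\<^sup>2"
    using mat_norm_mult[OF mat_star_carrier[OF c] c] by (simp only: mat_norm_star power2_eq_square)
  have "mat_norm A \<le> sqrt (mat_norm (mat_star A * A))"
  proof (rule mat_norm_leI)
    fix x :: "'a vec" assume x: "dim_vec x = dim_col A"
    have "hinner (A *\<^sub>v x) (A *\<^sub>v x) = hinner x (mat_star A *\<^sub>v (A *\<^sub>v x))"
      using x by (intro hinner_mult_mat) auto
    also have "mat_star A *\<^sub>v (A *\<^sub>v x) = mat_star A * A *\<^sub>v x"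
      by (rule assoc_mult_mat_vec[OF mat_star_carrier[OF c] c carrier_vecI[OF x], symmetric])
    finally have e: "hinner (A *\<^sub>v x) (A *\<^sub>v x) = hinner x (mat_star A * A *\<^sub>v x)" .
    have "(vec_norm (A *\<^sub>v x))\<^sup>2 \<le> vec_norm x * vec_norm (mat_star A * A *\<^sub>v x)"
      unfolding vec_norm_hinner e using x by (intro hinner_Cauchy_Schwarz) simp
    also have "\<dots> \<le> vec_norm x * (mat_norm (mat_star A * A) * vec_norm x)"
      using x by (intro mult_left_mono vec_norm_mult_mat_le) auto
    also have "\<dots> = (sqrt (mat_norm (mat_star A * A)))\<^sup>2 * (vec_norm x)\<^sup>2"
      by (simp add: power2_eq_square)
    finally have "(vec_norm (A *\<^sub>v x))\<^sup>2 \<le> (sqrt (mat_norm (mat_star A * A)) * vec_norm x)\<^sup>2"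
      unfolding power_mult_distrib .
    then show "vec_norm (A *\<^sub>v x) \<le> sqrt (mat_norm (mat_star A * A)) * vec_norm x"
      by (rule power2_le_imp_le) simp
  qed simp
  then have "(mat_norm A)\<^sup>2 \<le> (sqrt (mat_norm (mat_star A * A)))\<^sup>2" by (rule power_mono) simp
  then show "(mat_norm A)\<^sup>2 \<le> mat_norm (mat_star A * A)" by simp
qed

section \<open>The C*-algebra of bounded sequences of square matrices\<close>

text \<open>The matrix algebras of all sizes are packed into the single type of bounded families
  \<open>(T\<^sub>n)\<close> with \<open>T\<^sub>n\<close> an \<open>n \<times> n\<close> matrix; this makes the results on the type class
  \<open>unital_cstar_algebra\<close> available for each matrix algebra.\<close>

typedef (overloaded) 'a mat_seq =
  "{T :: nat \<Rightarrow> 'a::unital_cstar_algebra mat.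
     (\<forall>n. T n \<in> carrier_mat n n) \<and> bdd_above (range (\<lambda>n. mat_norm (T n)))}"
  morphisms coord Abs_mat_seq
  by (rule exI[of _ "\<lambda>n. 0\<^sub>m n n"]) simp

setup_lifting type_definition_mat_seq

lemma coord_carrier [simp]: "coord T n \<in> carrier_mat n n"
  using coord[of T] by auto

lemma dim_coord [simp]: "dim_row (coord T n) = n" "dim_col (coord T n) = n"
  using coord_carrier[of T n] by (auto simp del: coord_carrier)

lemma bdd_above_coord: "bdd_above (range (\<lambda>n. mat_norm (coord T n)))"
  using coord[of T] by auto

lemma mat_seq_eqI: "(\<And>n. coord S n = coord T n) \<Longrightarrow> S = T"
  by (simp add: coord_inject[symmetric] fun_eq_iff)

lemma mat_seq_eq_iff: "S = T \<longleftrightarrow> (\<forall>n. coord S n = coord T n)"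
  by (auto intro: mat_seq_eqI)

lemma bounded_mat_familyI:
  assumes "\<And>n. T n \<in> carrier_mat n n" "\<And>n. mat_norm (T n) \<le> K"
  shows "(\<forall>n. T n \<in> carrier_mat n n) \<and> bdd_above (range (\<lambda>n. mat_norm (T n)))"
  using assms by (intro conjI allI bdd_aboveI2)

lemma coord_Abs:
  assumes "\<And>n. T n \<in> carrier_mat n n" "\<And>n. mat_norm (T n) \<le> K"
  shows "coord (Abs_mat_seq T) = T"
  by (rule Abs_mat_seq_inverse) (use bounded_mat_familyI[of T K, OF assms] in blast)

text \<open>Precedes the class instances because negation and real scaling are defined through
  it.\<close>

lift_definition mat_seq_scaleC :: "complex \<Rightarrow> 'a::unital_cstar_algebra mat_seq \<Rightarrow> 'a mat_seq"
  is "\<lambda>c T n. scaleC_mat c (T n)"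
proof -
  fix c and T :: "nat \<Rightarrow> 'a mat"
  assume T: "(\<forall>n. T n \<in> carrier_mat n n) \<and> bdd_above (range (\<lambda>n. mat_norm (T n)))"
  then obtain K where "\<forall>n. mat_norm (T n) \<le> K" by (auto simp: bdd_above_def)
  then have "mat_norm (scaleC_mat c (T n)) \<le> cmod c * K" for n
    by (simp add: mat_norm_scaleC mult_left_mono)
  then show "(\<forall>n. scaleC_mat c (T n) \<in> carrier_mat n n) \<and>
      bdd_above (range (\<lambda>n. mat_norm (scaleC_mat c (T n))))"
    using T by (intro bounded_mat_familyI) auto
qed

instantiation mat_seq :: (unital_cstar_algebra) real_normed_algebra_1
begin

lift_definition zero_mat_seq :: "'a mat_seq" is "\<lambda>n. 0\<^sub>m n n" by simp

lift_definition one_mat_seq :: "'a mat_seq" is "\<lambda>n. 1\<^sub>m n"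
proof (intro conjI allI bdd_aboveI2)
  fix n show "mat_norm (1\<^sub>m n :: 'a mat) \<le> 1"
  \<comment> \<open>The identity of size 0 has norm 0, not 1.\<close>
  proof (cases "n = 0")
    case True
    then show ?thesis using mat_norm_le_sum[of "1\<^sub>m n :: 'a mat"] by simp
  qed (simp add: mat_norm_1)
qed simp

lift_definition plus_mat_seq :: "'a mat_seq \<Rightarrow> 'a mat_seq \<Rightarrow> 'a mat_seq" is "\<lambda>S T n. S n + T n"
proof -
  fix S T :: "nat \<Rightarrow> 'a mat"
  assume S: "(\<forall>n. S n \<in> carrier_mat n n) \<and> bdd_above (range (\<lambda>n. mat_norm (S n)))"
    and T: "(\<forall>n. T n \<in> carrier_mat n n) \<and> bdd_above (range (\<lambda>n. mat_norm (T n)))"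
  obtain K L where "\<forall>n. mat_norm (S n) \<le> K" "\<forall>n. mat_norm (T n) \<le> L"
    using S T by (auto simp: bdd_above_def)
  then have "mat_norm (S n + T n) \<le> K + L" for n
    using S T mat_norm_add[of "S n" n n "T n"] by (meson add_mono order_trans)
  then show "(\<forall>n. S n + T n \<in> carrier_mat n n) \<and> bdd_above (range (\<lambda>n. mat_norm (S n + T n)))"
    using S T by (intro bounded_mat_familyI) auto
qed

lift_definition times_mat_seq :: "'a mat_seq \<Rightarrow> 'a mat_seq \<Rightarrow> 'a mat_seq" is "\<lambda>S T n. S n * T n"
proof -
  fix S T :: "nat \<Rightarrow> 'a mat"
  assume S: "(\<forall>n. S n \<in> carrier_mat n n) \<and> bdd_above (range (\<lambda>n. mat_norm (S n)))"
    and T: "(\<forall>n. T n \<in> carrier_mat n n) \<and> bdd_above (range (\<lambda>n. mat_norm (T n)))"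
  obtain K L where KL: "\<forall>n. mat_norm (S n) \<le> K" "\<forall>n. mat_norm (T n) \<le> L"
    using S T by (auto simp: bdd_above_def)
  have "mat_norm (S n * T n) \<le> K * L" for n
  proof -
    have "mat_norm (S n * T n) \<le> mat_norm (S n) * mat_norm (T n)"
      using S T by (intro mat_norm_mult[of _ n n _ n]) auto
    also have "\<dots> \<le> K * L"
      using KL order_trans[OF mat_norm_ge_0 KL(1)[rule_format, of n]] by (intro mult_mono) auto
    finally show ?thesis .
  qed
  then show "(\<forall>n. S n * T n \<in> carrier_mat n n) \<and> bdd_above (range (\<lambda>n. mat_norm (S n * T n)))"
    using S T by (intro bounded_mat_familyI) (auto intro: mult_carrier_mat)
qed

definition "uminus_mat_seq (T :: 'a mat_seq) = mat_seq_scaleC (- 1) T"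
definition "minus_mat_seq (S :: 'a mat_seq) T = S + (- T)"
definition "scaleR_mat_seq r (T :: 'a mat_seq) = mat_seq_scaleC (complex_of_real r) T"
definition "norm_mat_seq (T :: 'a mat_seq) = (SUP n. mat_norm (coord T n))"
definition "dist_mat_seq (S :: 'a mat_seq) T = norm (S - T)"
definition "sgn_mat_seq (T :: 'a mat_seq) = scaleR (inverse (norm T)) T"
definition [code del]:
  "(uniformity :: ('a mat_seq \<times> 'a mat_seq) filter) = (INF e\<in>{0 <..}. principal {(x, y). dist x y < e})"
definition [code del]:
  "open (U :: 'a mat_seq set) = (\<forall>x\<in>U. eventually (\<lambda>(x', y). x' = x \<longrightarrow> y \<in> U) uniformity)"

lemma mat_norm_coord_le: "mat_norm (coord T n) \<le> norm T" for T :: "'a mat_seq"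
  unfolding norm_mat_seq_def by (intro cSUP_upper bdd_above_coord) simp

lemma norm_mat_seq_leI: "(\<And>n. mat_norm (coord T n) \<le> K) \<Longrightarrow> norm T \<le> K" for T :: "'a mat_seq"
  unfolding norm_mat_seq_def by (intro cSUP_least) auto

lemmas coord_simps = zero_mat_seq.rep_eq one_mat_seq.rep_eq plus_mat_seq.rep_eq
  times_mat_seq.rep_eq mat_seq_scaleC.rep_eq

lemma coord_uminus: "coord (- T) n = - coord T n" for T :: "'a mat_seq"
  unfolding uminus_mat_seq_def coord_simps by (intro eq_matI) auto

lemma coord_minus: "coord (S - T) n = coord S n - coord T n" for S T :: "'a mat_seq"
  unfolding minus_mat_seq_def coord_simps coord_uminus by (intro eq_matI) auto

lemma coord_scaleR: "coord (r *\<^sub>R T) n = map_mat (scaleR r) (coord T n)" for T :: "'a mat_seq"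
  unfolding scaleR_mat_seq_def coord_simps by (intro eq_matI) (auto simp: scaleR_scaleC)

lemma scaleC_mat_mult:
  "dim_col A = dim_row B \<Longrightarrow> scaleC_mat c A * B = scaleC_mat c (A * B)" for A B :: "'a mat"
  by (rule eq_matI) (simp_all add: mult_mat_index mult_scaleC_left scaleC_sum_right
      del: index_mult_mat(1))

lemma mult_scaleC_mat:
  "dim_col A = dim_row B \<Longrightarrow> A * scaleC_mat c B = scaleC_mat c (A * B)" for A B :: "'a mat"
  by (rule eq_matI) (simp_all add: mult_mat_index mult_scaleC_right scaleC_sum_right
      del: index_mult_mat(1))

lemma norm_mat_seq_ge_0: "0 \<le> norm a" for a :: "'a mat_seq"
  using mat_norm_coord_le[of a 0] mat_norm_ge_0 order_trans by blast

lemma norm_mat_seq_scaleC: "norm (mat_seq_scaleC z a) = cmod z * norm a" for a :: "'a mat_seq"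
proof -
  have le: "norm (mat_seq_scaleC z a) \<le> cmod z * norm a" for z and a :: "'a mat_seq"
    by (rule norm_mat_seq_leI) (simp add: coord_simps mat_norm_scaleC mult_left_mono mat_norm_coord_le)
  show "norm (mat_seq_scaleC z a) = cmod z * norm a"
  proof (cases "z = 0")
    case True
    then show ?thesis using le[of z a] norm_mat_seq_ge_0[of "mat_seq_scaleC z a"] by simp
  next
    case False
    have "mat_seq_scaleC (1 / z) (mat_seq_scaleC z a) = a"
      by (rule mat_seq_eqI, rule eq_matI) (use False in \<open>simp_all add: coord_simps scaleC_scaleC\<close>)
    then have "norm a \<le> cmod (1 / z) * norm (mat_seq_scaleC z a)" using le by metis
    then have "cmod z * norm a \<le> norm (mat_seq_scaleC z a)" using False by (simp add: norm_divide field_simps)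
    then show ?thesis using le[of z a] by simp
  qed
qed

instance
proof
  fix a b c :: "'a mat_seq" and r s :: real
  show "a + b + c = a + (b + c)" "a + b = b + a" "0 + a = a" "- a + a = 0" "a - b = a + - b"
    by (rule mat_seq_eqI, rule eq_matI, simp_all add: coord_simps coord_uminus coord_minus)+
  show "a * b * c = a * (b * c)"
    unfolding mat_seq_eq_iff coord_simps using assoc_mult_mat[OF coord_carrier coord_carrier coord_carrier] by blast
  show "(a + b) * c = a * c + b * c"
    unfolding mat_seq_eq_iff coord_simps using add_mult_distrib_mat[OF coord_carrier coord_carrier coord_carrier] by blast
  show "a * (b + c) = a * b + a * c"
    unfolding mat_seq_eq_iff coord_simps using mult_add_distrib_mat[OF coord_carrier coord_carrier coord_carrier] by blast
  show "1 * a = a" "a * 1 = a"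
    by (rule mat_seq_eqI, simp add: coord_simps left_mult_one_mat' right_mult_one_mat')+
  \<comment> \<open>Coordinate 1 is the first that separates 0 from 1; matrices of size 0 are all
    equal.\<close>
  show "(0 :: 'a mat_seq) \<noteq> 1"
  proof
    assume "(0 :: 'a mat_seq) = 1"
    then have "coord (0 :: 'a mat_seq) 1 $$ (0, 0) = coord 1 1 $$ (0, 0)" by simp
    then show False by (simp add: coord_simps)
  qed
  show "r *\<^sub>R (a + b) = r *\<^sub>R a + r *\<^sub>R b" "(r + s) *\<^sub>R a = r *\<^sub>R a + s *\<^sub>R a"
    "r *\<^sub>R s *\<^sub>R a = (r * s) *\<^sub>R a" "1 *\<^sub>R a = a"
    by (rule mat_seq_eqI, rule eq_matI,
        simp_all add: coord_simps coord_scaleR scaleR_add_right scaleR_add_left)+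
  show "r *\<^sub>R a * b = r *\<^sub>R (a * b)" "a * r *\<^sub>R b = r *\<^sub>R (a * b)"
    unfolding scaleR_mat_seq_def
    by (rule mat_seq_eqI, simp add: coord_simps scaleC_mat_mult mult_scaleC_mat)+
  show "dist a b = norm (a - b)" "sgn a = inverse (norm a) *\<^sub>R a"
    by (simp_all add: dist_mat_seq_def sgn_mat_seq_def)
  show "(uniformity :: ('a mat_seq \<times> 'a mat_seq) filter)
      = (INF e\<in>{0 <..}. principal {(x, y). dist x y < e})"
    by (simp add: uniformity_mat_seq_def)
  show "open U = (\<forall>x\<in>U. eventually (\<lambda>(x', y). x' = x \<longrightarrow> y \<in> U) uniformity)" for U :: "'a mat_seq set"
    by (simp add: open_mat_seq_def)
  show "norm a = 0 \<longleftrightarrow> a = 0"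
  proof
    assume "norm a = 0"
    then have "mat_norm (coord a n) = 0" for n
      using mat_norm_coord_le[of a n] mat_norm_ge_0[of "coord a n"] by linarith
    then show "a = 0" by (intro mat_seq_eqI) (metis mat_norm_eq_0 dim_coord zero_mat_seq.rep_eq)
  next
    assume "a = 0"
    then have "norm a \<le> 0" by (intro norm_mat_seq_leI) (simp add: coord_simps)
    then show "norm a = 0" using norm_mat_seq_ge_0[of a] by simp
  qed
  show "norm (a + b) \<le> norm a + norm b"
  proof (rule norm_mat_seq_leI)
    fix n
    have "mat_norm (coord (a + b) n) \<le> mat_norm (coord a n) + mat_norm (coord b n)"
      unfolding coord_simps by (rule mat_norm_add[OF coord_carrier coord_carrier])
    then show "mat_norm (coord (a + b) n) \<le> norm a + norm b"
      using mat_norm_coord_le[of a n] mat_norm_coord_le[of b n] by linarith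
  qed
  show "norm (r *\<^sub>R a) = \<bar>r\<bar> * norm a" by (simp add: scaleR_mat_seq_def norm_mat_seq_scaleC)
  show "norm (a * b) \<le> norm a * norm b"
  proof (rule norm_mat_seq_leI)
    fix n
    have "mat_norm (coord (a * b) n) \<le> mat_norm (coord a n) * mat_norm (coord b n)"
      unfolding coord_simps by (rule mat_norm_mult[OF coord_carrier coord_carrier])
    also have "\<dots> \<le> norm a * norm b" by (intro mult_mono mat_norm_coord_le norm_mat_seq_ge_0) simp
    finally show "mat_norm (coord (a * b) n) \<le> norm a * norm b" .
  qed
  show "norm (1 :: 'a mat_seq) = 1"
  proof (rule antisym)
    show "norm (1 :: 'a mat_seq) \<le> 1"
    proof (rule norm_mat_seq_leI)
      fix n show "mat_norm (coord (1 :: 'a mat_seq) n) \<le> 1"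
      proof (cases "n = 0")
        case True
        then show ?thesis using mat_norm_le_sum[of "coord (1 :: 'a mat_seq) n"] by simp
      qed (simp add: coord_simps mat_norm_1)
    qed
    show "1 \<le> norm (1 :: 'a mat_seq)"
      using mat_norm_coord_le[of "1 :: 'a mat_seq" 1] by (simp add: coord_simps mat_norm_1)
  qed
qed

end

text \<open>Entries of a Cauchy sequence are Cauchy uniformly in size and position, so limits are
  taken entrywise and the norm estimates are then passed to the limit.\<close>

instance mat_seq :: (unital_cstar_algebra) banach
proof
  fix X :: "nat \<Rightarrow> 'a mat_seq" assume X: "Cauchy X"
  have C: "\<exists>M. \<forall>k\<ge>M. \<forall>l\<ge>M. norm (X k - X l) < e" if "0 < e" for e
    using X that unfolding Cauchy_def dist_norm by blast
  have entry: "norm (coord (X k) n $$ (i, j) - coord (X l) n $$ (i, j)) \<le> norm (X k - X l)"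
    if "i < n" "j < n" for k l n i j
  proof -
    have "norm (coord (X k - X l) n $$ (i, j)) \<le> mat_norm (coord (X k - X l) n)"
      using that by (intro norm_entry_le_mat_norm) auto
    then show ?thesis using that mat_norm_coord_le[of "X k - X l" n] by (simp add: coord_minus)
  qed
  define L where "L n = mat n n (\<lambda>(i, j). lim (\<lambda>k. coord (X k) n $$ (i, j)))" for n
  have L: "(\<lambda>k. coord (X k) n $$ (i, j)) \<longlonglongrightarrow> L n $$ (i, j)" if "i < n" "j < n" for n i j
  proof -
    have "Cauchy (\<lambda>k. coord (X k) n $$ (i, j))"
      unfolding Cauchy_def dist_norm using C entry[OF that] by (meson le_less_trans)
    then show ?thesis using that by (simp add: L_def Cauchy_convergent convergent_LIMSEQ_iff[symmetric])
  qed
  \<comment> \<open>A bound on the tail survives the entrywise limit because convergence of finitely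
    many entries is norm convergence at each fixed size.\<close>
  have lim: "mat_norm (coord (X k) n - L n) \<le> e" if "\<forall>l\<ge>k. norm (X k - X l) \<le> e" for k n e
  proof -
    have "(\<lambda>l. mat_norm (coord (X l) n - L n)) \<longlonglongrightarrow> 0"
    proof (rule Lim_null_comparison)
      show "\<forall>\<^sub>F l in sequentially. norm (mat_norm (coord (X l) n - L n))
          \<le> (\<Sum>i<n. \<Sum>j<n. norm (coord (X l) n $$ (i, j) - L n $$ (i, j)))"
        using mat_norm_le_sum[of "coord (X l) n - L n" for l] by (simp add: L_def)
      show "(\<lambda>l. \<Sum>i<n. \<Sum>j<n. norm (coord (X l) n $$ (i, j) - L n $$ (i, j))) \<longlonglongrightarrow> 0"
        using L by (intro tendsto_null_sum tendsto_norm_zero) (auto simp: LIM_zero_iff)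
    qed
    then have l2: "(\<lambda>l. e + mat_norm (coord (X l) n - L n)) \<longlonglongrightarrow> e + 0" by (intro tendsto_intros)
    have "mat_norm (coord (X k) n - L n) \<le> e + mat_norm (coord (X l) n - L n)" if "k \<le> l" for l
    proof -
      have "mat_norm (coord (X k) n - coord (X l) n) \<le> e"
        using mat_norm_coord_le[of "X k - X l" n] \<open>\<forall>l\<ge>k. norm (X k - X l) \<le> e\<close> \<open>k \<le> l\<close>
        unfolding coord_minus by force
      then show ?thesis
        using mat_norm_triangle3[of "coord (X k) n" n n "coord (X l) n" "L n"] by (simp add: L_def)
    qed
    then show ?thesis using LIMSEQ_le_const[OF l2] by (metis add_0_right)
  qed
  obtain M where M: "\<forall>k\<ge>M. \<forall>l\<ge>M. norm (X k - X l) < 1" using C[of 1] by auto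
  \<comment> \<open>The entrywise limits must be bounded over all sizes to form an element of the
    type.\<close>
  have bL: "mat_norm (L n) \<le> norm (X M) + 1" for n
  proof -
    have "mat_norm (coord (X M) n - L n) \<le> 1" using M by (intro lim) (auto intro: less_imp_le)
    moreover have "mat_norm (L n) \<le> mat_norm (coord (X M) n) + mat_norm (L n - coord (X M) n)"
    proof -
      have c: "L n \<in> carrier_mat n n" by (simp add: L_def)
      have "L n = coord (X M) n + (L n - coord (X M) n)" using c by (intro eq_matI) auto
      moreover have "mat_norm (coord (X M) n + (L n - coord (X M) n))
          \<le> mat_norm (coord (X M) n) + mat_norm (L n - coord (X M) n)"
        using c by (intro mat_norm_add[of _ n n]) auto
      ultimately show ?thesis by simp
    qed
    moreover have "mat_norm (L n - coord (X M) n) = mat_norm (coord (X M) n - L n)"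
      by (rule mat_norm_minus_commute[of _ n n]) (simp_all add: L_def)
    ultimately show ?thesis using mat_norm_coord_le[of "X M" n] by linarith
  qed
  have cL: "coord (Abs_mat_seq L) = L" using bL by (intro coord_Abs) (simp_all add: L_def)
  have "X \<longlonglongrightarrow> Abs_mat_seq L"
    unfolding LIMSEQ_def dist_norm
  proof (intro allI impI)
    fix e :: real assume e: "0 < e"
    then obtain N where N: "\<forall>k\<ge>N. \<forall>l\<ge>N. norm (X k - X l) < e / 2" using C[of "e / 2"] by auto
    have "norm (X k - Abs_mat_seq L) < e" if "N \<le> k" for k
    proof -
      have "norm (X k - Abs_mat_seq L) \<le> e / 2"
      proof (rule norm_mat_seq_leI)
        fix n show "mat_norm (coord (X k - Abs_mat_seq L) n) \<le> e / 2"
          unfolding coord_minus cL using N that by (intro lim) (auto intro: less_imp_le)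
      qed
      then show ?thesis using e by simp
    qed
    then show "\<exists>N. \<forall>k\<ge>N. norm (X k - Abs_mat_seq L) < e" by blast
  qed
  then show "convergent X" by (auto simp: convergent_def)
qed

instantiation mat_seq :: (unital_cstar_algebra) unital_cstar_algebra
begin

definition "scaleC_mat_seq = (mat_seq_scaleC :: complex \<Rightarrow> 'a mat_seq \<Rightarrow> 'a mat_seq)"

lift_definition star_mat_seq :: "'a mat_seq \<Rightarrow> 'a mat_seq" is "\<lambda>T n. mat_star (T n)" by simp

lemma coord_scaleC: "coord (scaleC c T) n = scaleC_mat c (coord T n)" for T :: "'a mat_seq"
  by (simp add: scaleC_mat_seq_def mat_seq_scaleC.rep_eq)

instance
proof
  fix a b c :: "'a mat_seq" and r s :: real and z w :: complex
  show "scaleC z (a + b) = scaleC z a + scaleC z b" "scaleC (z + w) a = scaleC z a + scaleC w a"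
    "scaleC z (scaleC w a) = scaleC (z * w) a"
    by (rule mat_seq_eqI, rule eq_matI,
        simp_all add: coord_simps coord_scaleC scaleC_add_right scaleC_add_left scaleC_scaleC)+
  show "scaleR r a = scaleC (complex_of_real r) a" by (simp add: scaleR_mat_seq_def scaleC_mat_seq_def)
  show "scaleC z a * b = scaleC z (a * b)" "a * scaleC z b = scaleC z (a * b)"
    by (rule mat_seq_eqI, simp add: coord_simps coord_scaleC scaleC_mat_mult mult_scaleC_mat)+
  show "norm (scaleC z a) = cmod z * norm a"
    by (simp add: scaleC_mat_seq_def norm_mat_seq_scaleC)
  show "star (star a) = a" by (rule mat_seq_eqI) (simp add: coord_simps coord_scaleC star_mat_seq.rep_eq)
  show "star (a + b) = star a + star b" "star (scaleC z a) = scaleC (cnj z) (star a)"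
    by (rule mat_seq_eqI, rule eq_matI, simp_all add: coord_simps coord_scaleC star_mat_seq.rep_eq star_add star_scaleC)+
  show "star (a * b) = star b * star a"
    by (rule mat_seq_eqI) (simp add: coord_simps coord_scaleC star_mat_seq.rep_eq mat_star_mult)
  have cs: "mat_norm (coord (star a * a) n) = (mat_norm (coord a n))\<^sup>2" for n
    by (simp add: coord_simps star_mat_seq.rep_eq mat_norm_cstar_identity)
  show "norm (star a * a) = (norm a)\<^sup>2"
  proof (rule antisym)
    show "norm (star a * a) \<le> (norm a)\<^sup>2"
      by (rule norm_mat_seq_leI) (simp add: cs power_mono mat_norm_coord_le)
    have "norm a \<le> sqrt (norm (star a * a))"
    proof (rule norm_mat_seq_leI)
      fix n
      have "(mat_norm (coord a n))\<^sup>2 \<le> norm (star a * a)" using mat_norm_coord_le cs by metis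
      then show "mat_norm (coord a n) \<le> sqrt (norm (star a * a))" by (rule real_le_rsqrt)
    qed
    then have "(norm a)\<^sup>2 \<le> (sqrt (norm (star a * a)))\<^sup>2" by (intro power_mono norm_ge_zero)
    then show "(norm a)\<^sup>2 \<le> norm (star a * a)" by simp
  qed
qed

end

section \<open>Functional calculus for matrices\<close>

lemma coord_sum_index:
  "i < n \<Longrightarrow> j < n \<Longrightarrow> coord (\<Sum>k\<in>I. f k) n $$ (i, j) = (\<Sum>k\<in>I. coord (f k) n $$ (i, j))"
  by (induction I rule: infinite_finite_induct) (simp_all add: coord_simps)

lemma coord_power: "coord (a ^ k) n = coord a n ^\<^sub>m k"
  by (induction k) (simp_all add: coord_simps power_Suc2 del: power_Suc)

lemma coord_poly_eval: "coord (poly_eval p a) n = poly_mat p (coord a n)"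
  by (rule eq_matI) (simp_all add: poly_eval_def poly_mat_def coord_sum_index coord_scaleR coord_power)

section \<open>Spectra of matrices and of their lifts\<close>

lemma invertible_matI:
  assumes "A \<in> carrier_mat n n" "B \<in> carrier_mat n n" "A * B = 1\<^sub>m n" "B * A = 1\<^sub>m n"
  shows "invertible_mat A"
  using assms by (auto simp: invertible_mat_def inverts_mat_def)

lemma invertible_matE:
  assumes "invertible_mat A" "A \<in> carrier_mat n n"
  obtains B where "B \<in> carrier_mat n n" "A * B = 1\<^sub>m n" "B * A = 1\<^sub>m n"
proof -
  obtain B where B: "A * B = 1\<^sub>m (dim_row A)" "B * A = 1\<^sub>m (dim_row B)"
    using assms by (auto simp: invertible_mat_def inverts_mat_def)
  \<comment> \<open>The inverse comes without dimensions; they are read off the two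
    products.\<close>
  have "dim_col (A * B) = n" "dim_col (B * A) = dim_row B" using B assms by simp_all
  then have "B \<in> carrier_mat n n" using assms by auto
  then show thesis using that B assms by auto
qed

lemma invertible_coord:
  assumes "invertible_elt x" shows "invertible_mat (coord x n)"
proof -
  obtain y where y: "x * y = 1" "y * x = 1" using assms by (auto simp: invertible_elt_def inverse_pair_def)
  have "coord x n * coord y n = 1\<^sub>m n" "coord y n * coord x n = 1\<^sub>m n"
    using arg_cong[OF y(1), of "\<lambda>z. coord z n"] arg_cong[OF y(2), of "\<lambda>z. coord z n"]
    by (simp_all add: coord_simps)
  then show ?thesis by (intro invertible_matI[of _ n]) simp_all
qed

lemma scaleC_smult_one_mat:
  fixes T :: "'a::unital_cstar_algebra mat"
  shows "scaleC z 1 \<cdot>\<^sub>m 1\<^sub>m n - T = coord (scaleC z 1) n - T"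
proof -
  have "scaleC z 1 \<cdot>\<^sub>m 1\<^sub>m n = (coord (scaleC z 1) n :: 'a mat)"
    by (rule eq_matI) (auto simp: coord_scaleC coord_simps)
  then show ?thesis by simp
qed

lemma mat_spectrum_coord: "mat_spectrum (coord x n) \<subseteq> spectrum x"
proof
  fix z assume "z \<in> mat_spectrum (coord x n)"
  then have "\<not> invertible_mat (coord (scaleC z 1 - x) n)"
    by (simp add: mat_spectrum_def scaleC_smult_one_mat coord_minus)
  then show "z \<in> spectrum x" using invertible_coord by (auto simp: spectrum_def)
qed

text \<open>The filling scalar is a parameter: 0 preserves the norm bound, while a point of the
  spectrum of \<open>T\<close> preserves the spectrum.\<close>

definition fill_mat_seq :: "complex \<Rightarrow> nat \<Rightarrow> 'a::unital_cstar_algebra mat \<Rightarrow> 'a mat_seq" where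
  "fill_mat_seq c n T = Abs_mat_seq (\<lambda>m. if m = n then T else scaleC_mat c (1\<^sub>m m))"

lemma coord_fill:
  assumes "T \<in> carrier_mat n n"
  shows "coord (fill_mat_seq c n T) = (\<lambda>m. if m = n then T else scaleC_mat c (1\<^sub>m m))"
  unfolding fill_mat_seq_def
proof (rule coord_Abs)
  fix m
  have "mat_norm (1\<^sub>m m :: 'a mat) \<le> 1"
    using mat_norm_coord_le[of "1 :: 'a mat_seq" m] by (simp add: coord_simps)
  then have "mat_norm (scaleC_mat c (1\<^sub>m m :: 'a mat)) \<le> cmod c"
    by (simp add: mat_norm_scaleC mult_left_le)
  then show "mat_norm (if m = n then T else scaleC_mat c (1\<^sub>m m)) \<le> max (mat_norm T) (cmod c)" by auto
qed (use assms in auto)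

lemma norm_fill_0:
  assumes "T \<in> carrier_mat n n" shows "norm (fill_mat_seq 0 n T) \<le> mat_norm T"
proof (rule norm_mat_seq_leI)
  fix m
  have "scaleC_mat 0 (1\<^sub>m m :: 'a mat) = 0\<^sub>m m m" by (intro eq_matI) auto
  then show "mat_norm (coord (fill_mat_seq 0 n T) m) \<le> mat_norm T" by (simp add: coord_fill[OF assms])
qed

text \<open>Away from \<open>c\<close> and the spectrum of \<open>T\<close> the inverse is itself a
  filled sequence, with filling scalar \<open>1 / (z - c)\<close>.\<close>

lemma spectrum_fill:
  assumes T: "T \<in> carrier_mat n n"
  shows "spectrum (fill_mat_seq c n T) \<subseteq> insert c (mat_spectrum T)"
proof
  fix z assume z: "z \<in> spectrum (fill_mat_seq c n T)"
  show "z \<in> insert c (mat_spectrum T)"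
  proof (rule ccontr)
    assume h: "z \<notin> insert c (mat_spectrum T)"
    define D where "D = coord (scaleC z 1) n - T"
    have D: "D \<in> carrier_mat n n" unfolding D_def by (rule minus_carrier_mat[OF T])
    have "invertible_mat D"
      using h T by (simp add: mat_spectrum_def scaleC_smult_one_mat D_def)
    then obtain B where B: "B \<in> carrier_mat n n" "D * B = 1\<^sub>m n" "B * D = 1\<^sub>m n"
      using D by (rule invertible_matE)
    have cd: "coord (scaleC z 1 - fill_mat_seq c n T) m
        = (if m = n then D else scaleC_mat (z - c) (1\<^sub>m m))" for m
      by (simp add: coord_minus coord_fill[OF T] D_def)
        (intro impI eq_matI, auto simp: coord_scaleC coord_simps scaleC_diff_left)
    have sm: "scaleC_mat u (1\<^sub>m m) * scaleC_mat v (1\<^sub>m m) = (scaleC_mat (u * v) (1\<^sub>m m) :: 'a mat)" for u v m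
      by (simp add: scaleC_mat_mult mult_scaleC_mat) (intro eq_matI, auto simp: scaleC_scaleC mult.commute)
    have s1: "scaleC_mat 1 (1\<^sub>m m) = (1\<^sub>m m :: 'a mat)" for m by (intro eq_matI) auto
    have "inverse_pair (scaleC z 1 - fill_mat_seq c n T) (fill_mat_seq (1 / (z - c)) n B)"
      unfolding inverse_pair_def mat_seq_eq_iff times_mat_seq.rep_eq cd coord_fill[OF B(1)]
      using h B by (simp add: sm s1 one_mat_seq.rep_eq)
    then show False using z by (auto simp: spectrum_def invertible_elt_def)
  qed
qed

lemma star_fill:
  assumes "T \<in> carrier_mat n n" "mat_star T = T"
  shows "star (fill_mat_seq (of_real c) n T) = fill_mat_seq (of_real c) n T"
proof -
  have "mat_star (scaleC_mat (of_real c) (1\<^sub>m m)) = (scaleC_mat (of_real c) (1\<^sub>m m) :: 'a mat)" for m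
    by (rule eq_matI) (auto simp: star_scaleC)
  then show ?thesis
    by (simp add: mat_seq_eq_iff star_mat_seq.rep_eq coord_fill[OF assms(1)] assms(2))
qed

text \<open>Filling the other coordinates with a point of the spectrum leaves the spectrum unchanged.\<close>

lemma selfadjoint_mat_lift:
  assumes T: "T \<in> carrier_mat n n" "mat_star T = T" and n: "1 \<le> n"
  obtains L where "star L = L" "coord L n = T" "spectrum L = mat_spectrum T"
proof -
  \<comment> \<open>If there were none, the lift filled with 0 could have only 0 in its real
    spectrum; it would vanish, and \<open>T = 0\<close> has 0 in its spectrum.\<close>
  have "\<exists>t::real. of_real t \<in> mat_spectrum T"
  proof (rule ccontr)
    assume none: "\<not> (\<exists>t::real. of_real t \<in> mat_spectrum T)"
    let ?L = "fill_mat_seq (of_real 0) n T"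
    have "norm ?L \<le> 0"
    proof (rule norm_le_real_spectrum)
      fix t assume "t \<in> real_spectrum ?L"
      then have "of_real t = (of_real 0 :: complex)"
        using none spectrum_fill[OF T(1), of "of_real 0"] unfolding real_spectrum_def by blast
      then show "\<bar>t\<bar> \<le> 0" by simp
    qed (use star_fill[OF T, of 0] in auto)
    then have "coord ?L n = coord 0 n" by simp
    then have T0: "T = 0\<^sub>m n n" by (simp add: coord_fill[OF T(1)] coord_simps)
    \<comment> \<open>This uses \<open>n \<ge> 1\<close>: at size 0 the zero matrix is the
      identity.\<close>
    have "\<not> invertible_mat (0\<^sub>m n n :: 'a mat)"
    proof
      assume "invertible_mat (0\<^sub>m n n :: 'a mat)"
      then obtain B :: "'a mat" where B: "B \<in> carrier_mat n n" "0\<^sub>m n n * B = 1\<^sub>m n"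
        using invertible_matE[of "0\<^sub>m n n"] zero_carrier_mat by metis
      then have "(0\<^sub>m n n :: 'a mat) $$ (0, 0) = 1\<^sub>m n $$ (0, 0)" by simp
      then show False using n by simp
    qed
    moreover have "scaleC (of_real 0) 1 \<cdot>\<^sub>m 1\<^sub>m n - 0\<^sub>m n n = (0\<^sub>m n n :: 'a mat)"
      by (intro eq_matI) auto
    ultimately have "of_real 0 \<in> mat_spectrum T" unfolding mat_spectrum_def T0 by simp
    then show False using none by blast
  qed
  then obtain t :: real where t: "of_real t \<in> mat_spectrum T" by blast
  let ?L = "fill_mat_seq (of_real t) n T"
  have "spectrum ?L = mat_spectrum T"
    using spectrum_fill[OF T(1), of "of_real t"] t mat_spectrum_coord[of ?L n]
    by (auto simp: coord_fill[OF T(1)])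
  then show thesis using that[of ?L] star_fill[OF T] by (simp add: coord_fill[OF T(1)])
qed

text \<open>Equal spectra mean equal sets of approximating polynomials, and passing to a coordinate
  does not increase norms. Computations in \<open>cfc\<close> thereby become statements about
  matrices.\<close>

lemma mat_cfc_lift:
  assumes L: "star L = L" "coord L n = T" "spectrum L = mat_spectrum T" and f: "continuous_on UNIV f"
  shows "mat_cfc f T = coord (cfc f L) n"
proof -
  have S: "{t. complex_of_real t \<in> mat_spectrum T} = real_spectrum L"
    by (simp add: real_spectrum_def L)
  have T: "dim_row T = n" using L(2) by auto
  have conv: "mat_converges (\<lambda>k. poly_mat (p k) T) (coord (cfc f L) n)"
    if "uniform_limit (real_spectrum L) (\<lambda>k. poly (p k)) f sequentially" for p
    unfolding mat_converges_def
  proof (rule Lim_null_comparison)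
    show "\<forall>\<^sub>F k in sequentially. norm (mat_norm (poly_mat (p k) T - coord (cfc f L) n))
        \<le> norm (poly_eval (p k) L - cfc f L)"
      using mat_norm_coord_le[of "poly_eval (p k) L - cfc f L" n for k]
      by (simp add: coord_minus coord_poly_eval L(2))
    show "(\<lambda>k. norm (poly_eval (p k) L - cfc f L)) \<longlonglongrightarrow> 0"
      by (intro tendsto_norm_zero LIM_zero tendsto_cfc L f that)
  qed
  show ?thesis
    unfolding mat_cfc_def S T
  proof (rule the_equality)
    obtain p where "uniform_limit (real_spectrum L) (\<lambda>k. poly (p k)) f sequentially"
      using cfc_approximation[OF L(1) f] by blast
    then show "coord (cfc f L) n \<in> carrier_mat n n \<and>
      (\<exists>p. uniform_limit (real_spectrum L) (\<lambda>k. poly (p k)) f sequentially \<and>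
        mat_converges (\<lambda>k. poly_mat (p k) T) (coord (cfc f L) n))" using conv by auto
    fix B assume "B \<in> carrier_mat n n \<and>
      (\<exists>p. uniform_limit (real_spectrum L) (\<lambda>k. poly (p k)) f sequentially \<and>
        mat_converges (\<lambda>k. poly_mat (p k) T) B)"
    then obtain q where B: "B \<in> carrier_mat n n"
      and q: "uniform_limit (real_spectrum L) (\<lambda>k. poly (q k)) f sequentially"
        "mat_converges (\<lambda>k. poly_mat (q k) T) B" by blast
    let ?C = "coord (cfc f L) n"
    have c: "poly_mat (q k) T \<in> carrier_mat n n" for k by (simp add: poly_mat_def T)
    have le: "mat_norm (B - ?C) \<le> mat_norm (poly_mat (q k) T - B) + mat_norm (poly_mat (q k) T - ?C)" for k
      using mat_norm_triangle3[OF B c[of k] coord_carrier] mat_norm_minus_commute[OF B c[of k]] by simp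
    have "(\<lambda>k. mat_norm (poly_mat (q k) T - B) + mat_norm (poly_mat (q k) T - ?C)) \<longlonglongrightarrow> 0 + 0"
      using q(2) conv[OF q(1)] unfolding mat_converges_def by (intro tendsto_add)
    then have "mat_norm (B - ?C) \<le> 0 + 0" using le by (intro LIMSEQ_le_const) auto
    then have "mat_norm (B - ?C) = 0" using mat_norm_ge_0[of "B - ?C"] by (simp del: mat_norm_ge_0)
    from mat_norm_eq_0[OF this] have z: "B - ?C = 0\<^sub>m n n" by simp
    show "B = ?C"
    proof (rule eq_matI)
      fix i j assume ij: "i < dim_row ?C" "j < dim_col ?C"
      then have "(B - ?C) $$ (i, j) = 0" by (simp add: z)
      then show "B $$ (i, j) = ?C $$ (i, j)" using ij by simp
    qed (use B in auto)
  qed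
qed

lemma mat_eq_0_if_mult_vec:
  assumes "\<And>x. dim_vec x = dim_col A \<Longrightarrow> vec_norm (A *\<^sub>v x) = 0"
  shows "A = 0\<^sub>m (dim_row A) (dim_col A)"
proof -
  have "mat_norm A \<le> 0" by (rule mat_norm_leI) (simp_all add: assms)
  then have "mat_norm A = 0" using mat_norm_ge_0[of A] by (simp del: mat_norm_ge_0)
  then show ?thesis by (rule mat_norm_eq_0)
qed

text \<open>Two positive elements with sum 0 both vanish.\<close>

lemma vec_norm_eq_0_if_opposite:
  assumes "hinner x x = - hinner y y" shows "vec_norm x = 0"
proof -
  have "norm (hinner x x) \<le> norm (hinner x x + hinner y y)"
    by (intro positive_norm_mono positive_hinner)
  then show ?thesis using assms by (simp add: vec_norm_def hinner_def)
qed

lemma mat_star_coord: "star L = L \<Longrightarrow> mat_star (coord L n) = coord L n"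
  by (metis star_mat_seq.rep_eq)

lemma hinner_mult_self:
  assumes A: "A \<in> carrier_mat n m" and x: "dim_vec x = m"
  shows "hinner (A *\<^sub>v x) (A *\<^sub>v x) = hinner x (mat_star A * A *\<^sub>v x)"
proof -
  have "hinner (A *\<^sub>v x) (A *\<^sub>v x) = hinner x (mat_star A *\<^sub>v (A *\<^sub>v x))"
    using assms by (intro hinner_mult_mat) auto
  then show ?thesis
    using assoc_mult_mat_vec[OF mat_star_carrier[OF A] A carrier_vecI[OF x]] by simp
qed

text \<open>As for \<open>positive_star_mult\<close>: if \<open>n\<close> is the negative part of \<open>T = A\<^sup>* A\<close>, then
  \<open>(A n)\<^sup>* (A n) = - n\<^sup>3\<close>, which forces \<open>n = 0\<close> since \<open>A n\<close> acts on a Hilbert module.\<close>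

lemma mat_spectrum_star_mult_nonneg:
  fixes A :: "'a::unital_cstar_algebra mat"
  assumes A: "A \<in> carrier_mat k n" and n: "1 \<le> n" and t: "complex_of_real t \<in> mat_spectrum (mat_star A * A)"
  shows "0 \<le> t"
proof -
  define T where "T = mat_star A * A"
  have T: "T \<in> carrier_mat n n" unfolding T_def using A by (intro mult_carrier_mat[of _ _ k]) auto
  have sT: "mat_star T = T" unfolding T_def using A by (subst mat_star_mult) auto
  \<comment> \<open>Only \<open>T\<close> is lifted; the rectangular \<open>A\<close> has no place
    in the sequence algebra.\<close>
  obtain L where L: "star L = L" "coord L n = T" using selfadjoint_mat_lift[OF T sT n] by blast
  define m :: "real \<Rightarrow> real" where "m t = max (- t) 0" for t
  have cm: "continuous_on UNIV m" unfolding m_def by (intro continuous_intros)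
  define N where "N = cfc m L"
  have sN: "star N = N" unfolding N_def by (intro star_cfc L cm)
  \<comment> \<open>The power of the negative part with exponent 3/2; its square is the cube of
    \<open>N\<close>.\<close>
  define W where "W = cfc (\<lambda>t. m t * sqrt (m t)) L"
  have cs: "continuous_on UNIV (\<lambda>t. m t * sqrt (m t))" by (intro continuous_intros cm)
  have sW: "star W = W" unfolding W_def by (intro star_cfc L cs)
  have ptw: "(m t * sqrt (m t)) * (m t * sqrt (m t)) = - 1 * (m t * t * m t)" for t
  proof -
    have "m t * t = - (m t * m t)" "sqrt (m t) * sqrt (m t) = m t" by (simp_all add: m_def max_def)
    then show ?thesis by simp
  qed
  have "W * W = cfc (\<lambda>t. (m t * sqrt (m t)) * (m t * sqrt (m t))) L"
    unfolding W_def by (intro cfc_mult[symmetric] L cs)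
  also have "\<dots> = cfc (\<lambda>t. - 1 * (m t * t * m t)) L" unfolding ptw ..
  also have "\<dots> = cfc (\<lambda>_. - 1) L * cfc (\<lambda>t. m t * t * m t) L"
    by (intro cfc_mult L continuous_intros cm)
  also have "cfc (\<lambda>t. m t * t * m t) L = N * L * N"
    by (simp only: N_def cfc_mult[OF L(1) cm continuous_on_id] cfc_ident[OF L(1)]
        cfc_mult[OF L(1) continuous_on_mult[OF cm continuous_on_id] cm])
  finally have WW: "W * W = - (N * L * N)" by (simp add: cfc_const L)
  let ?b = "A * coord N n"
  have b: "?b \<in> carrier_mat k n" using A by (intro mult_carrier_mat[of _ _ n]) auto
  have "mat_star ?b * ?b = mat_star (coord N n) * mat_star A * (A * coord N n)"
    using A by (subst mat_star_mult) auto
  also have "\<dots> = mat_star (coord N n) * (mat_star A * (A * coord N n))"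
    using A by (intro assoc_mult_mat[of _ n n _ k _ n]) auto
  also have "mat_star A * (A * coord N n) = T * coord N n"
    unfolding T_def using A by (intro assoc_mult_mat[symmetric, of _ n k _ n _ n]) auto
  also have "mat_star (coord N n) * (T * coord N n) = coord (N * (L * N)) n"
    by (simp add: times_mat_seq.rep_eq L mat_star_coord[OF sN])
  finally have bb: "mat_star ?b * ?b = coord (N * L * N) n" by (simp only: mult.assoc)
  \<comment> \<open>The inner product of \<open>W x\<close> with itself is minus that of
    \<open>A N x\<close> with itself, all taken at coordinate \<open>n\<close>.\<close>
  have wx: "vec_norm (coord W n *\<^sub>v x) = 0" if x: "dim_vec x = n" for x
  proof (rule vec_norm_eq_0_if_opposite)
    have "hinner (coord W n *\<^sub>v x) (coord W n *\<^sub>v x) = hinner x (coord (W * W) n *\<^sub>v x)"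
      using hinner_mult_self[OF coord_carrier x, of W] mat_star_coord[OF sW]
      by (simp add: times_mat_seq.rep_eq)
    also have "coord (W * W) n *\<^sub>v x = - (mat_star ?b * ?b *\<^sub>v x)"
      unfolding WW coord_uminus bb using x by (intro eq_vecI) (auto simp: mult_mat_vec_index sum_negf simp del: index_mult_mat_vec)
    also have "hinner x (- (mat_star ?b * ?b *\<^sub>v x)) = - hinner x (mat_star ?b * ?b *\<^sub>v x)"
      using x A by (simp add: hinner_def sum_negf)
    also have "hinner x (mat_star ?b * ?b *\<^sub>v x) = hinner (?b *\<^sub>v x) (?b *\<^sub>v x)"
      using hinner_mult_self[OF b x] by simp
    finally show "hinner (coord W n *\<^sub>v x) (coord W n *\<^sub>v x) = - hinner (?b *\<^sub>v x) (?b *\<^sub>v x)" .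
  qed
  then have W0: "coord W n = 0\<^sub>m n n" using mat_eq_0_if_mult_vec[of "coord W n"] by simp
  have "N * N * N = cfc (\<lambda>t. m t * m t * m t) L"
    by (simp only: N_def cfc_mult[OF L(1) cm cm] cfc_mult[OF L(1) continuous_on_mult[OF cm cm] cm])
  also have "\<dots> = cfc (\<lambda>t. (m t * sqrt (m t)) * (m t * sqrt (m t))) L"
  proof (rule cfc_cong)
    fix t
    have "sqrt (m t) * sqrt (m t) = m t" by (simp add: m_def max_def)
    then show "m t * m t * m t = (m t * sqrt (m t)) * (m t * sqrt (m t))" by simp
  qed
  also have "\<dots> = W * W" unfolding W_def by (intro cfc_mult L cs)
  finally have N3: "N * N * N = W * W" .
  \<comment> \<open>The fourth power of \<open>N\<close> vanishes at coordinate \<open>n\<close>;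
    the C*-identity, used twice, brings this down to \<open>N\<close>.\<close>
  have "mat_star (coord N n * coord N n) * (coord N n * coord N n) = coord (N * (N * N * N)) n"
  proof -
    have "N * (N * N * N) = (N * N) * (N * N)" by (simp only: mult.assoc)
    moreover have "mat_star (coord N n * coord N n) = coord N n * coord N n"
      by (simp add: mat_star_mult mat_star_coord[OF sN])
    ultimately show ?thesis by (simp only: times_mat_seq.rep_eq)
  qed
  also have "\<dots> = 0\<^sub>m n n" unfolding N3 times_mat_seq.rep_eq W0 by simp
  finally have "(mat_norm (coord N n * coord N n))\<^sup>2 = 0"
    by (simp add: mat_norm_cstar_identity[symmetric])
  then have "mat_norm (mat_star (coord N n) * coord N n) = 0" by (simp add: mat_star_coord[OF sN])
  then have "mat_norm (coord N n) = 0" by (simp add: mat_norm_cstar_identity)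
  from mat_norm_eq_0[OF this] have N0: "coord N n = 0\<^sub>m n n" by simp
  \<comment> \<open>The root of the positive part. As \<open>N\<close> vanishes at coordinate
    \<open>n\<close>, \<open>T\<close> is that coordinate of the square \<open>Q * Q\<close>, whose
    spectrum is nonnegative.\<close>
  define Q where "Q = cfc (\<lambda>t. sqrt (max t 0)) L"
  have cq: "continuous_on UNIV (\<lambda>t::real. sqrt (max t 0))" by (intro continuous_intros)
  have sQ: "star Q = Q" unfolding Q_def by (intro star_cfc L cq)
  have "Q * Q = cfc (\<lambda>t. sqrt (max t 0) * sqrt (max t 0)) L"
    unfolding Q_def by (intro cfc_mult[symmetric] L cq)
  also have "\<dots> = cfc (\<lambda>t. t + m t) L" by (intro cfc_cong) (auto simp: m_def max_def)
  also have "\<dots> = L + N"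
    unfolding N_def by (subst cfc_add) (auto simp: L cm cfc_ident intro: continuous_intros)
  finally have "coord (Q * Q) n = T" using N0 T by (simp add: coord_simps L)
  then have "complex_of_real t \<in> spectrum (Q * Q)"
    using mat_spectrum_coord[of "Q * Q" n] t unfolding T_def by auto
  then show "0 \<le> t" using positive_square[OF sQ] by (simp add: positive_elt_def real_spectrum_def)
qed

section \<open>The absolute value and its cut-downs\<close>

text \<open>Provides everything the cut-down computations need: equal spectra so that
  \<open>mat_cfc_lift\<close> applies to functions of the absolute value, positivity of the lift,
  and the link back to \<open>A\<close>.\<close>

lemma mat_abs_lift:
  assumes A: "A \<in> carrier_mat k n" and n: "1 \<le> n"
  obtains S where "positive_elt S" "coord S n = mat_abs A" "spectrum S = mat_spectrum (mat_abs A)"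
    "coord (S * S) n = mat_star A * A"
proof -
  define T where "T = mat_star A * A"
  have T: "T \<in> carrier_mat n n" unfolding T_def using A by (intro mult_carrier_mat[of _ _ k]) auto
  have sT: "mat_star T = T" unfolding T_def using A by (subst mat_star_mult) auto
  obtain L where L: "star L = L" "coord L n = T" "spectrum L = mat_spectrum T"
    using selfadjoint_mat_lift[OF T sT n] by blast
  have L0: "0 \<le> t" if "t \<in> real_spectrum L" for t
    using that mat_spectrum_star_mult_nonneg[OF A n, of t] by (simp add: real_spectrum_def L T_def)
  \<comment> \<open>The fourth root of \<open>L\<close> exhibits the absolute value as a coordinate
    of a square.\<close>
  define R where "R = cfc (\<lambda>t. sqrt (sqrt t)) L"
  have cr: "continuous_on UNIV (\<lambda>t::real. sqrt (sqrt t))" by (intro continuous_intros)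
  have sR: "star R = R" unfolding R_def by (intro star_cfc L cr)
  have ab: "mat_abs A = coord (cfc sqrt L) n"
    unfolding mat_abs_def T_def[symmetric] by (rule mat_cfc_lift[OF L continuous_on_UNIV_sqrt])
  have "R * R = cfc (\<lambda>t. sqrt (sqrt t) * sqrt (sqrt t)) L"
    unfolding R_def by (intro cfc_mult[symmetric] L cr)
  also have "\<dots> = cfc sqrt L" using L0 by (intro cfc_cong) auto
  finally have RR: "R * R = cfc sqrt L" .
  have "cfc sqrt L * cfc sqrt L = cfc (\<lambda>t. sqrt t * sqrt t) L"
    by (intro cfc_mult[symmetric] L continuous_on_UNIV_sqrt)
  also have "\<dots> = cfc (\<lambda>t. t) L" using L0 by (intro cfc_cong) auto
  finally have ss: "cfc sqrt L * cfc sqrt L = L" by (simp add: cfc_ident L)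
  have "mat_abs A \<in> carrier_mat n n" "mat_star (mat_abs A) = mat_abs A"
    unfolding ab by (simp_all add: mat_star_coord star_cfc L continuous_on_UNIV_sqrt)
  \<comment> \<open>A fresh lift, because \<open>mat_spectrum_coord\<close> gives only an inclusion
    for \<open>cfc sqrt L\<close>, whereas \<open>mat_cfc_lift\<close> asks for equality.\<close>
  then obtain S where S: "star S = S" "coord S n = mat_abs A" "spectrum S = mat_spectrum (mat_abs A)"
    using selfadjoint_mat_lift n by blast
  have "spectrum S \<subseteq> spectrum (R * R)" unfolding S(3) ab RR by (rule mat_spectrum_coord)
  then have "positive_elt S"
    using positive_square[OF sR] S(1) by (auto simp: positive_elt_def real_spectrum_def)
  moreover have "coord (S * S) n = mat_star A * A"
    using ss L(2) by (simp add: times_mat_seq.rep_eq S(2) ab T_def) (metis times_mat_seq.rep_eq)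
  ultimately show thesis using that S by blast
qed

lemma continuous_on_cut: "continuous_on UNIV (\<lambda>t::real. max (t - \<epsilon>) 0)"
  by (intro continuous_intros)

lemma mat_cut_down_carrier:
  assumes "A \<in> carrier_mat k n" "1 \<le> n"
  shows "mat_cut_down \<epsilon> (mat_abs A) \<in> carrier_mat n n"
proof -
  obtain S where S: "positive_elt S" "coord S n = mat_abs A" "spectrum S = mat_spectrum (mat_abs A)"
    using mat_abs_lift[OF assms] by metis
  show ?thesis
    unfolding mat_cut_down_def mat_cfc_lift[OF positive_star[OF S(1)] S(2,3) continuous_on_cut] by simp
qed

text \<open>\<open>X = g(\<bar>A\<bar>) A\<^sup>*\<close> with \<open>g(t) = 1 / t\<^sup>2\<close> for \<open>t \<ge> \<epsilon>\<close>.\<close>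

lemma mat_cut_down_factor:
  assumes A: "A \<in> carrier_mat k n" and n: "1 \<le> n" and e: "0 < \<epsilon>"
  obtains X where "X \<in> carrier_mat n k"
    "mat_cut_down \<epsilon> (mat_abs A) = X * A * mat_cut_down \<epsilon> (mat_abs A)"
proof -
  obtain S where S: "positive_elt S" "coord S n = mat_abs A" "spectrum S = mat_spectrum (mat_abs A)"
    "coord (S * S) n = mat_star A * A" using mat_abs_lift[OF A n] .
  have sS: "star S = S" using S(1) by (rule positive_star)
  define C where "C = cfc (\<lambda>t. max (t - \<epsilon>) 0) S"
  have c: "mat_cut_down \<epsilon> (mat_abs A) = coord C n"
    unfolding mat_cut_down_def C_def by (rule mat_cfc_lift[OF sS S(2,3) continuous_on_cut])
  \<comment> \<open>The truncation at \<open>\<epsilon>\<close> keeps \<open>g\<close> continuous;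
    it changes values only where the cut-down is 0.\<close>
  define g where "g t = 1 / (max t \<epsilon> * max t \<epsilon>)" for t
  have cg: "continuous_on UNIV g" unfolding g_def using e by (intro continuous_intros) auto
  define G where "G = cfc g S"
  have "G * (S * S) * C = cfc (\<lambda>t. g t * (t * t) * max (t - \<epsilon>) 0) S"
    by (simp only: G_def C_def cfc_mult[OF sS continuous_on_id continuous_on_id] cfc_ident[OF sS]
        cfc_mult[OF sS cg continuous_on_mult[OF continuous_on_id continuous_on_id]]
        cfc_mult[OF sS continuous_on_mult[OF cg continuous_on_mult[OF continuous_on_id continuous_on_id]]
          continuous_on_cut])
  also have "\<dots> = C"
    unfolding C_def using e by (intro cfc_cong) (auto simp: g_def max_def)
  finally have GC: "G * (S * S) * C = C" .
  have m: "mat_star A \<in> carrier_mat n k" using A by simp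
  have "coord C n = coord G n * (mat_star A * A) * coord C n"
    using arg_cong[OF GC, of "\<lambda>z. coord z n"] S(4) by (simp add: times_mat_seq.rep_eq)
  also have "coord G n * (mat_star A * A) = coord G n * mat_star A * A"
    using assoc_mult_mat[OF coord_carrier m A] by simp
  finally have "coord C n = coord G n * mat_star A * A * coord C n" .
  moreover have "coord G n * mat_star A \<in> carrier_mat n k" using m by (rule mult_carrier_mat[OF coord_carrier])
  ultimately show thesis using that c by metis
qed

text \<open>\<open>K = l(\<bar>A\<bar>)\<close> with \<open>l(t) = 1 / t\<close> for \<open>t \<ge> \<epsilon>\<close>.\<close>

lemma mat_cut_down_approx:
  assumes A: "A \<in> carrier_mat k n" and n: "1 \<le> n" and e: "0 < \<epsilon>"
  obtains K where "K \<in> carrier_mat n n"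
    "mat_norm (A - A * mat_cut_down \<epsilon> (mat_abs A) * K) \<le> \<epsilon>"
proof -
  obtain S where S: "positive_elt S" "coord S n = mat_abs A" "spectrum S = mat_spectrum (mat_abs A)"
    "coord (S * S) n = mat_star A * A" using mat_abs_lift[OF A n] .
  have sS: "star S = S" using S(1) by (rule positive_star)
  define f where "f t = max (t - \<epsilon>) 0" for t
  have cf: "continuous_on UNIV f" unfolding f_def by (rule continuous_on_cut)
  have c: "mat_cut_down \<epsilon> (mat_abs A) = coord (cfc f S) n"
    unfolding mat_cut_down_def f_def by (rule mat_cfc_lift[OF sS S(2,3) continuous_on_cut])
  define l where "l t = 1 / max t \<epsilon>" for t
  have cl: "continuous_on UNIV l" unfolding l_def using e by (intro continuous_intros) auto
  define K where "K = coord (cfc l S) n"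
  \<comment> \<open>For \<open>t \<ge> 0\<close>, \<open>t * r t\<close> is the minimum of
    \<open>t\<close> and \<open>\<epsilon>\<close>: this is where the bound
    \<open>\<epsilon>\<close> comes from.\<close>
  define r where "r t = 1 + (- 1) * (f t * l t)" for t
  have cr: "continuous_on UNIV r" unfolding r_def by (intro continuous_intros cf cl)
  define D where "D = cfc r S"
  have sD: "star D = D" unfolding D_def by (intro star_cfc sS cr)
  have cfl: "continuous_on UNIV (\<lambda>t. f t * l t)" by (intro continuous_intros cf cl)
  have D: "D = 1 - cfc f S * cfc l S"
  proof -
    have "D = cfc (\<lambda>_. 1) S + cfc (\<lambda>t. (- 1) * (f t * l t)) S"
      unfolding D_def r_def by (intro cfc_add sS continuous_intros cf cl)
    also have "cfc (\<lambda>t. (- 1) * (f t * l t)) S = cfc (\<lambda>_. - 1) S * cfc (\<lambda>t. f t * l t) S"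
      by (intro cfc_mult sS cfl continuous_intros)
    also have "cfc (\<lambda>t. f t * l t) S = cfc f S * cfc l S" by (intro cfc_mult sS cf cl)
    finally show ?thesis by (simp add: cfc_const sS)
  qed
  have fc: "coord (cfc f S) n \<in> carrier_mat n n" and K: "K \<in> carrier_mat n n" by (simp_all add: K_def)
  have AD: "A - A * coord (cfc f S) n * K = A * coord D n"
  proof -
    have "A * coord D n = A * (1\<^sub>m n - coord (cfc f S) n * K)"
      by (simp add: D coord_minus coord_simps K_def)
    also have "\<dots> = A * 1\<^sub>m n - A * (coord (cfc f S) n * K)"
      using A fc K by (intro mult_minus_distrib_mat[of _ k n _ n]) auto
    also have "A * (coord (cfc f S) n * K) = A * coord (cfc f S) n * K"
      using assoc_mult_mat[OF A fc K] by simp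
    finally show ?thesis using A by simp
  qed
  \<comment> \<open>The product depends on \<open>A\<close> only through
    \<open>mat_star A * A\<close>, so \<open>A\<close> may be replaced by \<open>S\<close> and the
    norm estimated by functional calculus.\<close>
  have "mat_star (A * coord D n) * (A * coord D n) = coord D n * mat_star A * (A * coord D n)"
    using A by (subst mat_star_mult) (auto simp: mat_star_coord[OF sD])
  also have "\<dots> = coord D n * (mat_star A * (A * coord D n))"
    using A by (intro assoc_mult_mat[of _ n n _ k _ n]) auto
  also have "mat_star A * (A * coord D n) = coord (S * S) n * coord D n"
    unfolding S(4) using A by (intro assoc_mult_mat[symmetric, of _ n k _ n _ n]) auto
  finally have "mat_star (A * coord D n) * (A * coord D n) = coord (D * (S * S * D)) n"
    by (simp add: times_mat_seq.rep_eq)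
  then have "(mat_norm (A * coord D n))\<^sup>2 = mat_norm (coord (D * (S * S * D)) n)"
    by (simp add: mat_norm_cstar_identity[symmetric])
  also have "\<dots> \<le> norm (D * (S * S * D))" by (rule mat_norm_coord_le)
  also have "D * (S * S * D) = star (S * D) * (S * D)" by (simp add: star_mult sD sS mult.assoc)
  also have "norm \<dots> = (norm (S * D))\<^sup>2" by (rule cstar_identity)
  also have "\<dots> \<le> \<epsilon>\<^sup>2"
  proof (rule power_mono)
    have "S * D = cfc (\<lambda>t. t * r t) S"
      unfolding D_def by (simp only: cfc_mult[OF sS continuous_on_id cr] cfc_ident[OF sS])
    also have "norm \<dots> \<le> \<epsilon>"
    proof (rule norm_cfc_le[OF sS])
      fix t assume "t \<in> real_spectrum S"
      then have "0 \<le> t" using S(1) by (simp add: positive_elt_def)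
      then show "\<bar>t * r t\<bar> \<le> \<epsilon>"
        using e by (cases "t \<le> \<epsilon>") (auto simp: r_def f_def l_def max_def field_simps)
    qed (use e in \<open>auto intro!: continuous_intros cr\<close>)
    finally show "norm (S * D) \<le> \<epsilon>" .
  qed simp
  finally have "mat_norm (A * coord D n) \<le> \<epsilon>" by (rule power2_le_imp_le) (use e in simp)
  then show thesis using that[OF K] by (simp add: AD c)
qed

section \<open>Block diagonal matrices\<close>

lemma block_diag_carrier [simp]:
  "A \<in> carrier_mat a b \<Longrightarrow> B \<in> carrier_mat c d \<Longrightarrow> block_diag A B \<in> carrier_mat (a + c) (b + d)"
  by (auto simp: block_diag_def)

lemma block_diag_mult:
  fixes A B C D :: "'a::semiring_1 mat"
  assumes "A \<in> carrier_mat a b" "B \<in> carrier_mat b c" "C \<in> carrier_mat a' b'" "D \<in> carrier_mat b' c'"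
  shows "block_diag A C * block_diag B D = block_diag (A * B) (C * D)"
proof -
  have "block_diag A C * block_diag B D = four_block_mat
      (A * B + 0\<^sub>m a b' * 0\<^sub>m b' c) (A * 0\<^sub>m b c' + 0\<^sub>m a b' * D)
      (0\<^sub>m a' b * B + C * 0\<^sub>m b' c) (0\<^sub>m a' b * 0\<^sub>m b c' + C * D)"
    using assms unfolding block_diag_def by (subst mult_four_block_mat[of _ a b _ b' _ a' _ _ c _ c']) auto
  then show ?thesis using assms by (simp add: block_diag_def)
qed

lemma block_diag_minus:
  assumes "A \<in> carrier_mat a b" "B \<in> carrier_mat a b" "C \<in> carrier_mat c d" "D \<in> carrier_mat c d"
  shows "block_diag A C - block_diag B D = block_diag (A - B) (C - D :: 'a::ring_1 mat)"
  using assms by (intro eq_matI) (auto simp: block_diag_def)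

lemma vec_norm_append: "vec_norm (u @\<^sub>v v) \<le> vec_norm u + vec_norm v"
proof -
  have "u @\<^sub>v v = (u @\<^sub>v 0\<^sub>v (dim_vec v)) + (0\<^sub>v (dim_vec u) @\<^sub>v v)"
    by (intro eq_vecI) auto
  also have "vec_norm \<dots> \<le> vec_norm (u @\<^sub>v 0\<^sub>v (dim_vec v)) + vec_norm (0\<^sub>v (dim_vec u) @\<^sub>v v)"
    by (rule vec_norm_triangle) simp
  also have "vec_norm (u @\<^sub>v 0\<^sub>v (dim_vec v)) = vec_norm u"
    unfolding vec_norm_def
    by (intro arg_cong[of _ _ "\<lambda>z. sqrt (norm z)"], rule sum.mono_neutral_cong_right) auto
  also have "vec_norm (0\<^sub>v (dim_vec u) @\<^sub>v v) = vec_norm v"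
  proof -
    have "(\<Sum>i<dim_vec v. star (v $ i) * v $ i)
        = (\<Sum>i\<in>{dim_vec u..<dim_vec u + dim_vec v}.
            star ((0\<^sub>v (dim_vec u) @\<^sub>v v) $ i) * (0\<^sub>v (dim_vec u) @\<^sub>v v) $ i)"
      by (rule sum.reindex_bij_witness[of _ "\<lambda>i. i - dim_vec u" "\<lambda>i. i + dim_vec u"]) auto
    also have "\<dots> = (\<Sum>i<dim_vec u + dim_vec v.
            star ((0\<^sub>v (dim_vec u) @\<^sub>v v) $ i) * (0\<^sub>v (dim_vec u) @\<^sub>v v) $ i)"
      by (rule sum.mono_neutral_left) auto
    finally show ?thesis by (simp add: vec_norm_def)
  qed
  finally show ?thesis by simp
qed

lemma vec_norm_append_ge: "vec_norm u \<le> vec_norm (u @\<^sub>v v)" "vec_norm v \<le> vec_norm (u @\<^sub>v v)"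
proof -
  define g where "g i = star ((u @\<^sub>v v) $ i) * (u @\<^sub>v v) $ i" for i
  have "hinner (u @\<^sub>v v) (u @\<^sub>v v) = sum g {..<dim_vec u + dim_vec v}"
    by (simp add: hinner_def g_def)
  also have "{..<dim_vec u + dim_vec v} = {..<dim_vec u} \<union> {dim_vec u..<dim_vec u + dim_vec v}" by auto
  also have "sum g \<dots> = sum g {..<dim_vec u} + sum g {dim_vec u..<dim_vec u + dim_vec v}"
    by (rule sum.union_disjoint) auto
  also have "sum g {..<dim_vec u} = hinner u u"
    by (simp add: hinner_def g_def)
  also have "sum g {dim_vec u..<dim_vec u + dim_vec v} = hinner v v"
    unfolding hinner_def g_def
    by (rule sum.reindex_bij_witness[of _ "\<lambda>i. i + dim_vec u" "\<lambda>i. i - dim_vec u"]) auto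
  finally have e: "hinner (u @\<^sub>v v) (u @\<^sub>v v) = hinner u u + hinner v v" .
  have "(vec_norm u)\<^sup>2 \<le> (vec_norm (u @\<^sub>v v))\<^sup>2"
    unfolding vec_norm_hinner e by (intro positive_norm_mono positive_hinner)
  then show "vec_norm u \<le> vec_norm (u @\<^sub>v v)" by (rule power2_le_imp_le) simp
  have "(vec_norm v)\<^sup>2 \<le> (vec_norm (u @\<^sub>v v))\<^sup>2"
    unfolding vec_norm_hinner e add.commute[of "hinner u u"]
    by (intro positive_norm_mono positive_hinner)
  then show "vec_norm v \<le> vec_norm (u @\<^sub>v v)" by (rule power2_le_imp_le) simp
qed

text \<open>A crude form of the maximum of the two norms, enough where both summands can be made
  small.\<close>

lemma mat_norm_block_diag: "mat_norm (block_diag A B) \<le> mat_norm A + mat_norm B"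
proof (rule mat_norm_leI)
  fix x :: "'a vec" assume "dim_vec x = dim_col (block_diag A B)"
  then have x: "x \<in> carrier_vec (dim_col A + dim_col B)" by (intro carrier_vecI) (simp add: block_diag_def)
  define u v where "u = vec_first x (dim_col A)" and "v = vec_last x (dim_col B)"
  have xuv: "x = u @\<^sub>v v" unfolding u_def v_def using vec_first_last_append[OF x] by simp
  have u: "u \<in> carrier_vec (dim_col A)" and v: "v \<in> carrier_vec (dim_col B)"
    by (simp_all add: u_def v_def)
  have cA: "A \<in> carrier_mat (dim_row A) (dim_col A)" and cB: "B \<in> carrier_mat (dim_row B) (dim_col B)"
    by (rule carrier_matI; simp)+
  have "block_diag A B *\<^sub>v x = (A *\<^sub>v u + 0\<^sub>m (dim_row A) (dim_col B) *\<^sub>v v)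
      @\<^sub>v (0\<^sub>m (dim_row B) (dim_col A) *\<^sub>v u + B *\<^sub>v v)"
    unfolding xuv block_diag_def
    by (rule four_block_mat_mult_vec[OF cA zero_carrier_mat zero_carrier_mat cB u v])
  also have "\<dots> = (A *\<^sub>v u) @\<^sub>v (B *\<^sub>v v)"
    using u v by (intro eq_vecI) auto
  finally have "vec_norm (block_diag A B *\<^sub>v x) \<le> vec_norm (A *\<^sub>v u) + vec_norm (B *\<^sub>v v)"
    using vec_norm_append by metis
  also have "\<dots> \<le> mat_norm A * vec_norm u + mat_norm B * vec_norm v"
    using u v by (intro add_mono vec_norm_mult_mat_le) auto
  also have "\<dots> \<le> mat_norm A * vec_norm x + mat_norm B * vec_norm x"
    unfolding xuv by (intro add_mono mult_left_mono vec_norm_append_ge) auto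
  finally show "vec_norm (block_diag A B *\<^sub>v x) \<le> (mat_norm A + mat_norm B) * vec_norm x"
    by (simp add: distrib_right)
qed simp

section \<open>The regularized rank\<close>

text \<open>The Neumann series in the sequence algebra; filling with 0 keeps the norm of the lift
  below 1.\<close>

lemma one_minus_mat_left_inverse:
  assumes "E \<in> carrier_mat n n" "mat_norm E < 1"
  obtains W where "W \<in> carrier_mat n n" "W * (1\<^sub>m n - E) = 1\<^sub>m n"
proof -
  let ?e = "fill_mat_seq 0 n E"
  have "norm ?e < 1" using norm_fill_0[OF assms(1)] assms(2) by linarith
  then obtain y where "y * (1 - ?e) = 1" using inverse_pair_one_minus unfolding inverse_pair_def by blast
  then have "coord y n * coord (1 - ?e) n = coord 1 n" by (metis times_mat_seq.rep_eq)
  then show thesis using that[of "coord y n"] by (simp add: coord_minus coord_simps coord_fill[OF assms(1)])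
qed

lemma rect_matsI: "A \<in> carrier_mat n m \<Longrightarrow> 1 \<le> n \<Longrightarrow> 1 \<le> m \<Longrightarrow> A \<in> rect_mats"
  by (auto simp: rect_mats_def)

section \<open>A rank function and its lower semicontinuous hull\<close>

context
  fixes rk :: "'a::unital_cstar_algebra mat \<Rightarrow> real"
  assumes rk: "sylvester_rank_function rk"
begin

lemma rk_nonneg: "A \<in> rect_mats \<Longrightarrow> 0 \<le> rk A"
  using rk by (auto simp: sylvester_rank_function_def)

lemma rk_mult_le:
  assumes "A \<in> carrier_mat n m" "B \<in> carrier_mat m l" "1 \<le> n" "1 \<le> m" "1 \<le> l"
  shows "rk (A * B) \<le> rk A" "rk (A * B) \<le> rk B"
  using rk assms rect_matsI[of A n m] rect_matsI[of B m l]
  unfolding sylvester_rank_function_def by (metis carrier_matD min.bounded_iff)+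

lemma rk_block_diag: "A \<in> rect_mats \<Longrightarrow> B \<in> rect_mats \<Longrightarrow> rk (block_diag A B) = rk A + rk B"
  using rk by (auto simp: sylvester_rank_function_def)

lemma rk_le_near:
  assumes A: "A \<in> carrier_mat n m" and X: "X \<in> carrier_mat m n" and c: "c \<in> carrier_mat m l"
    and nm: "1 \<le> n" "1 \<le> m" "1 \<le> l" and eq: "c = X * A * c"
  obtains \<delta> where "0 < \<delta>"
    "\<And>Z. Z \<in> carrier_mat n m \<Longrightarrow> mat_norm (A - Z) < \<delta> \<Longrightarrow> rk c \<le> rk Z"
proof
  \<comment> \<open>The radius \<open>1 / (mat_norm X + 1)\<close> makes \<open>X * (A - Z)\<close>
    of norm below 1; the added 1 covers \<open>X = 0\<close>.\<close>
  have X1: "0 < mat_norm X + 1" by (rule add_nonneg_pos) auto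
  then show "0 < 1 / (mat_norm X + 1)" by simp
  fix Z assume Z: "Z \<in> carrier_mat n m" and d: "mat_norm (A - Z) < 1 / (mat_norm X + 1)"
  have AZ: "A - Z \<in> carrier_mat n m" using Z by (rule minus_carrier_mat)
  define E where "E = X * (A - Z)"
  have E: "E \<in> carrier_mat m m" unfolding E_def using X AZ by (rule mult_carrier_mat)
  have "mat_norm E \<le> mat_norm X * mat_norm (A - Z)" unfolding E_def using X AZ by (rule mat_norm_mult)
  also have "\<dots> \<le> (mat_norm X + 1) * mat_norm (A - Z)" by (intro mult_right_mono) auto
  also have "\<dots> < (mat_norm X + 1) * (1 / (mat_norm X + 1))" using d X1 by (rule mult_strict_left_mono)
  finally have "mat_norm E < 1" using X1 by simp
  with E obtain W where W: "W \<in> carrier_mat m m" "W * (1\<^sub>m m - E) = 1\<^sub>m m"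
    by (rule one_minus_mat_left_inverse)
  have XA: "X * A \<in> carrier_mat m m" and XZ: "X * Z \<in> carrier_mat m m"
    using X A Z by (auto intro: mult_carrier_mat)
  \<comment> \<open>Since \<open>X * A * c\<close> is \<open>c\<close>, only
    \<open>X * Z * c\<close> survives in \<open>(1\<^sub>m m - E) * c\<close>.\<close>
  have "E = X * A - X * Z" unfolding E_def using X A Z by (rule mult_minus_distrib_mat)
  then have "(1\<^sub>m m - E) * c = 1\<^sub>m m * c - (X * A * c - X * Z * c)"
    using minus_mult_distrib_mat[OF one_carrier_mat E c] minus_mult_distrib_mat[OF XA XZ c] by simp
  also have "\<dots> = X * Z * c"
    unfolding eq[symmetric] using c XZ by (intro eq_matI) auto
  finally have e: "(1\<^sub>m m - E) * c = X * Z * c" .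
  have "W * (X * Z * c) = W * (1\<^sub>m m - E) * c"
    unfolding e[symmetric] using W(1) minus_carrier_mat[OF E] c by (rule assoc_mult_mat[symmetric])
  then have "c = W * (X * Z * c)" using W c by simp
  then have "rk c \<le> rk (X * Z * c)"
    using rk_mult_le(2)[OF W(1) mult_carrier_mat[OF XZ c]] nm by simp
  also have "\<dots> \<le> rk (X * Z)" using rk_mult_le(1)[OF XZ c] nm by simp
  also have "\<dots> \<le> rk Z" using rk_mult_le(2)[OF X Z] nm by simp
  finally show "rk c \<le> rk Z" .
qed

lemma rk_cut_down_le:
  assumes A: "A \<in> carrier_mat n m" and nm: "1 \<le> n" "1 \<le> m" and e: "0 < \<epsilon>"
  shows "rk (mat_cut_down \<epsilon> (mat_abs A)) \<le> rk A"
proof -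
  obtain X where X: "X \<in> carrier_mat m n"
    "mat_cut_down \<epsilon> (mat_abs A) = X * A * mat_cut_down \<epsilon> (mat_abs A)"
    using mat_cut_down_factor[OF A nm(2) e] .
  obtain d where d: "0 < d" "\<And>Z. Z \<in> carrier_mat n m \<Longrightarrow> mat_norm (A - Z) < d \<Longrightarrow>
      rk (mat_cut_down \<epsilon> (mat_abs A)) \<le> rk Z"
    using rk_le_near[OF A X(1) mat_cut_down_carrier[OF A nm(2)] nm nm(2) X(2)] by blast
  \<comment> \<open>\<open>A\<close> itself is the nearby matrix.\<close>
  have "A - A = 0\<^sub>m n m" using A by (intro eq_matI) auto
  then show ?thesis using d A by simp
qed

lemma bdd_above_rk_cut_down:
  assumes "A \<in> carrier_mat n m" "1 \<le> n" "1 \<le> m"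
  shows "bdd_above ((\<lambda>\<epsilon>. rk (mat_cut_down \<epsilon> (mat_abs A))) ` {0<..})"
  using rk_cut_down_le[OF assms] by (intro bdd_aboveI2) auto

lemma rk_cut_down_le_regularized:
  assumes "A \<in> carrier_mat n m" "1 \<le> n" "1 \<le> m" "0 < \<epsilon>"
  shows "rk (mat_cut_down \<epsilon> (mat_abs A)) \<le> regularized_rank rk A"
  unfolding regularized_rank_def using assms by (intro cSUP_upper[OF _ bdd_above_rk_cut_down[OF assms(1-3)]]) auto

lemma regularized_rank_leI:
  assumes "\<And>\<epsilon>. 0 < \<epsilon> \<Longrightarrow> rk (mat_cut_down \<epsilon> (mat_abs A)) \<le> r"
  shows "regularized_rank rk A \<le> r"
  unfolding regularized_rank_def using assms by (intro cSUP_least) auto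

lemma regularized_rank_le:
  assumes "A \<in> carrier_mat n m" "1 \<le> n" "1 \<le> m" shows "regularized_rank rk A \<le> rk A"
  using rk_cut_down_le[OF assms] by (rule regularized_rank_leI)

text \<open>The upper half of the hull description: arbitrarily close to \<open>A\<close> there are
  matrices whose rank does not exceed the regularized rank.\<close>

lemma regularized_rank_near:
  assumes A: "A \<in> carrier_mat n m" and nm: "1 \<le> n" "1 \<le> m" and d: "0 < \<delta>"
  obtains Z where "Z \<in> carrier_mat n m" "mat_norm (A - Z) < \<delta>" "rk Z \<le> regularized_rank rk A"
proof -
  \<comment> \<open>Halving turns the nonstrict bound of \<open>mat_cut_down_approx\<close> into a
    strict one.\<close>
  have e: "0 < \<delta> / 2" using d by simp
  let ?c = "mat_cut_down (\<delta> / 2) (mat_abs A)"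
  obtain K where K: "K \<in> carrier_mat m m" "mat_norm (A - A * ?c * K) \<le> \<delta> / 2"
    using mat_cut_down_approx[OF A nm(2) e] .
  have c: "?c \<in> carrier_mat m m" by (rule mat_cut_down_carrier[OF A nm(2)])
  have Ac: "A * ?c \<in> carrier_mat n m" using A c by (rule mult_carrier_mat)
  have "rk (A * ?c * K) \<le> rk (A * ?c)" using rk_mult_le(1)[OF Ac K(1)] nm by simp
  also have "\<dots> \<le> rk ?c" using rk_mult_le(2)[OF A c] nm by simp
  also have "\<dots> \<le> regularized_rank rk A" using A nm e by (rule rk_cut_down_le_regularized)
  finally have "rk (A * ?c * K) \<le> regularized_rank rk A" .
  moreover have "A * ?c * K \<in> carrier_mat n m" using Ac K(1) by (rule mult_carrier_mat)
  ultimately show thesis using that K(2) d by force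
qed

text \<open>The lower half: a cut-down of rank above \<open>r\<close> bounds the rank of all
  matrices in a ball around \<open>A\<close>.\<close>

lemma less_regularized_rank:
  assumes A: "A \<in> carrier_mat n m" and nm: "1 \<le> n" "1 \<le> m" and r: "r < regularized_rank rk A"
  obtains \<delta> where "0 < \<delta>" "\<And>Z. Z \<in> carrier_mat n m \<Longrightarrow> mat_norm (A - Z) < \<delta> \<Longrightarrow> r < rk Z"
proof -
  obtain e where e: "0 < e" "r < rk (mat_cut_down e (mat_abs A))"
    using regularized_rank_leI[of A r] r by force
  obtain X where X: "X \<in> carrier_mat m n"
    "mat_cut_down e (mat_abs A) = X * A * mat_cut_down e (mat_abs A)"
    using mat_cut_down_factor[OF A nm(2) e(1)] .
  obtain d where "0 < d" "\<And>Z. Z \<in> carrier_mat n m \<Longrightarrow> mat_norm (A - Z) < d \<Longrightarrow>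
      rk (mat_cut_down e (mat_abs A)) \<le> rk Z"
    using rk_le_near[OF A X(1) mat_cut_down_carrier[OF A nm(2)] nm nm(2) X(2)] by blast
  then show thesis using that e(2) by force
qed

text \<open>Allows any \<open>c\<close> reproduced by \<open>X * A\<close>, not just a cut-down of
  \<open>A\<close>; block diagonals of cut-downs are of this kind. An approximant from
  \<open>regularized_rank_near\<close> inside the ball of \<open>rk_le_near\<close> links the two
  sides.\<close>

lemma rk_le_regularized_rank:
  assumes "A \<in> carrier_mat n m" "X \<in> carrier_mat m n" "c \<in> carrier_mat m l"
    "1 \<le> n" "1 \<le> m" "1 \<le> l" "c = X * A * c"
  shows "rk c \<le> regularized_rank rk A"
proof -
  obtain d where "0 < d" "\<And>Z. Z \<in> carrier_mat n m \<Longrightarrow> mat_norm (A - Z) < d \<Longrightarrow> rk c \<le> rk Z"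
    using rk_le_near[OF assms] by blast
  moreover from this(1) obtain Z where "Z \<in> carrier_mat n m" "mat_norm (A - Z) < d" "rk Z \<le> regularized_rank rk A"
    using regularized_rank_near[OF assms(1,4,5)] by blast
  ultimately show ?thesis by force
qed

section \<open>The defining properties of a lower semicontinuous dimension function\<close>

lemma regularized_rank_lower_semicontinuous: "mat_lower_semicontinuous (regularized_rank rk)"
  unfolding mat_lower_semicontinuous_def
proof (intro allI impI ballI)
  fix n m :: nat and X :: "nat \<Rightarrow> 'a mat" and A
  assume nm: "1 \<le> n" "1 \<le> m" and A: "A \<in> carrier_mat n m" and X: "\<forall>k. X k \<in> carrier_mat n m"
    and conv: "mat_converges X A"
  have ev: "\<forall>\<^sub>F k in sequentially. r < regularized_rank rk (X k)" if r: "r < regularized_rank rk A" for r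
  proof -
    obtain d where d: "0 < d" "\<And>Z. Z \<in> carrier_mat n m \<Longrightarrow> mat_norm (A - Z) < d \<Longrightarrow> r < rk Z"
      using less_regularized_rank[OF A nm r] by blast
    have "\<forall>\<^sub>F k in sequentially. mat_norm (X k - A) < d / 2"
      using conv d(1) unfolding mat_converges_def by (intro order_tendstoD(2)) auto
    then show ?thesis
    proof (rule eventually_mono)
      fix k assume k: "mat_norm (X k - A) < d / 2"
      have d2: "0 < d / 2" using d(1) by simp
      have Xk: "X k \<in> carrier_mat n m" using X by blast
      obtain Z where Z: "Z \<in> carrier_mat n m" "mat_norm (X k - Z) < d / 2"
        "rk Z \<le> regularized_rank rk (X k)"
        using regularized_rank_near[OF Xk nm d2] .
      \<comment> \<open>An approximant of \<open>X k\<close> is also close to \<open>A\<close>, so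
        its rank exceeds \<open>r\<close>, while it is at most the regularized rank of
        \<open>X k\<close>.\<close>
      have "mat_norm (A - Z) \<le> mat_norm (X k - A) + mat_norm (X k - Z)"
        using mat_norm_triangle3[OF A Xk Z(1)] mat_norm_minus_commute[OF A Xk] by simp
      then have "r < rk Z" using d(2)[OF Z(1)] k Z(2) by simp
      then show "r < regularized_rank rk (X k)" using Z(3) by simp
    qed
  qed
  show "ereal (regularized_rank rk A) \<le> liminf (\<lambda>k. ereal (regularized_rank rk (X k)))"
    unfolding le_Liminf_iff
  proof (intro allI impI)
    fix y assume "y < ereal (regularized_rank rk A)"
    then show "\<forall>\<^sub>F k in sequentially. y < ereal (regularized_rank rk (X k))"
      using ev by (cases y) auto
  qed
qed

text \<open>Replace \<open>B\<close> in \<open>C k * B * D k\<close> by a nearby \<open>Z\<close> of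
  small rank: the product stays close to \<open>A\<close>, yet its rank is at most that of
  \<open>Z\<close>.\<close>

lemma regularized_rank_cuntz_mono:
  assumes A: "A \<in> rect_mats" and B: "B \<in> rect_mats" and le: "cuntz_le A B"
  shows "regularized_rank rk A \<le> regularized_rank rk B"
proof (rule ccontr)
  assume "\<not> regularized_rank rk A \<le> regularized_rank rk B"
  then have lt: "regularized_rank rk B < regularized_rank rk A" by simp
  define n m p q where "n = dim_row A" and "m = dim_col A" and "p = dim_row B" and "q = dim_col B"
  have dims: "1 \<le> n" "1 \<le> m" "1 \<le> p" "1 \<le> q"
    using A B by (auto simp: rect_mats_def n_def m_def p_def q_def)
  have cA: "A \<in> carrier_mat n m" and cB: "B \<in> carrier_mat p q"
    by (auto simp: n_def m_def p_def q_def)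
  obtain d where d: "0 < d" "\<And>Z. Z \<in> carrier_mat n m \<Longrightarrow> mat_norm (A - Z) < d \<Longrightarrow>
      regularized_rank rk B < rk Z"
    using less_regularized_rank[OF cA dims(1,2) lt] by blast
  obtain C D where CD: "\<forall>k. C k \<in> carrier_mat n p" "\<forall>k. D k \<in> carrier_mat q m"
    "mat_converges (\<lambda>k. C k * B * D k) A"
    using le unfolding cuntz_le_def n_def m_def p_def q_def by blast
  have "\<forall>\<^sub>F k in sequentially. mat_norm (C k * B * D k - A) < d / 2"
    using CD(3) d(1) unfolding mat_converges_def by (intro order_tendstoD(2)) auto
  then obtain k where k: "mat_norm (C k * B * D k - A) < d / 2"
    by (auto simp: eventually_sequentially)
  have cC: "C k \<in> carrier_mat n p" and cD: "D k \<in> carrier_mat q m" using CD by auto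
  \<comment> \<open>Chosen so that a distance below \<open>d / (2 * M)\<close> between
    \<open>B\<close> and \<open>Z\<close> becomes less than \<open>d / 2\<close> after
    multiplication; the added 1 keeps \<open>M\<close> positive.\<close>
  define M where "M = mat_norm (C k) * mat_norm (D k) + 1"
  have M: "0 < M" unfolding M_def by (rule add_nonneg_pos) auto
  have "0 < d / (2 * M)" using d(1) M by simp
  then obtain Z where Z: "Z \<in> carrier_mat p q" "mat_norm (B - Z) < d / (2 * M)"
    "rk Z \<le> regularized_rank rk B"
    using regularized_rank_near[OF cB dims(3,4)] by blast
  have CB: "C k * B \<in> carrier_mat n q" and CZ: "C k * Z \<in> carrier_mat n q"
    using cC cB Z(1) by (auto intro: mult_carrier_mat)
  have CBD: "C k * B * D k \<in> carrier_mat n m" and CZD: "C k * Z * D k \<in> carrier_mat n m"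
    using CB CZ cD by (auto intro: mult_carrier_mat)
  have BZ: "B - Z \<in> carrier_mat p q" using Z(1) by (rule minus_carrier_mat)
  have "C k * B * D k - C k * Z * D k = (C k * B - C k * Z) * D k"
    using minus_mult_distrib_mat[OF CB CZ cD] by simp
  also have "C k * B - C k * Z = C k * (B - Z)"
    using mult_minus_distrib_mat[OF cC cB Z(1)] by simp
  finally have "mat_norm (C k * B * D k - C k * Z * D k) \<le> mat_norm (C k * (B - Z)) * mat_norm (D k)"
    using mat_norm_mult[OF mult_carrier_mat[OF cC BZ] cD] by simp
  also have "\<dots> \<le> (mat_norm (C k) * mat_norm (B - Z)) * mat_norm (D k)"
    by (intro mult_right_mono mat_norm_mult[OF cC BZ]) simp
  also have "\<dots> = mat_norm (C k) * mat_norm (D k) * mat_norm (B - Z)" by simp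
  also have "\<dots> \<le> M * mat_norm (B - Z)" by (intro mult_right_mono) (auto simp: M_def)
  also have "\<dots> < M * (d / (2 * M))" using Z(2) M by (rule mult_strict_left_mono)
  also have "\<dots> = d / 2" using M by simp
  finally have "mat_norm (C k * B * D k - C k * Z * D k) < d / 2" .
  moreover have "mat_norm (A - C k * Z * D k)
      \<le> mat_norm (C k * B * D k - A) + mat_norm (C k * B * D k - C k * Z * D k)"
    using mat_norm_triangle3[OF cA CBD CZD] mat_norm_minus_commute[OF cA CBD] by simp
  ultimately have "mat_norm (A - C k * Z * D k) < d" using k by simp
  then have "regularized_rank rk B < rk (C k * Z * D k)" by (rule d(2)[OF CZD])
  also have "\<dots> \<le> rk (C k * Z)" using rk_mult_le(1)[OF CZ cD] dims by simp
  also have "\<dots> \<le> rk Z" using rk_mult_le(2)[OF cC Z(1)] dims by simp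
  finally show False using Z(3) by simp
qed

lemma regularized_rank_one: "regularized_rank rk (1\<^sub>m 1) = 1"
proof (rule antisym)
  have rk1: "rk (1\<^sub>m 1) = 1" using rk by (simp add: sylvester_rank_function_def)
  show "regularized_rank rk (1\<^sub>m 1) \<le> 1" using regularized_rank_le[of "1\<^sub>m 1" 1 1] rk1 by simp
  have "rk (1\<^sub>m 1) \<le> regularized_rank rk (1\<^sub>m 1)"
    by (rule rk_le_regularized_rank[where X = "1\<^sub>m 1"]) auto
  then show "1 \<le> regularized_rank rk (1\<^sub>m 1)" using rk1 by simp
qed

text \<open>Subadditivity uses approximants, superadditivity the reproducing relation of the
  cut-downs.\<close>

lemma regularized_rank_block_diag:
  assumes "A \<in> rect_mats" "B \<in> rect_mats"
  shows "regularized_rank rk (block_diag A B) = regularized_rank rk A + regularized_rank rk B"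
proof (rule antisym)
  define n m p q where "n = dim_row A" and "m = dim_col A" and "p = dim_row B" and "q = dim_col B"
  have dims: "1 \<le> n" "1 \<le> m" "1 \<le> p" "1 \<le> q"
    using assms by (auto simp: rect_mats_def n_def m_def p_def q_def)
  have cA: "A \<in> carrier_mat n m" and cB: "B \<in> carrier_mat p q"
    by (auto simp: n_def m_def p_def q_def)
  have cAB: "block_diag A B \<in> carrier_mat (n + p) (m + q)" using cA cB by simp
  have dims2: "1 \<le> n + p" "1 \<le> m + q" using dims by auto
  show "regularized_rank rk (block_diag A B) \<le> regularized_rank rk A + regularized_rank rk B"
  \<comment> \<open>Approximants of \<open>A\<close> and \<open>B\<close> combine to one of
    \<open>block_diag A B\<close>, on which \<open>rk\<close> is additive.\<close>
  proof (rule ccontr)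
    assume "\<not> regularized_rank rk (block_diag A B) \<le> regularized_rank rk A + regularized_rank rk B"
    then have "regularized_rank rk A + regularized_rank rk B < regularized_rank rk (block_diag A B)" by simp
    then obtain d where d: "0 < d" "\<And>Z. Z \<in> carrier_mat (n + p) (m + q) \<Longrightarrow>
        mat_norm (block_diag A B - Z) < d \<Longrightarrow> regularized_rank rk A + regularized_rank rk B < rk Z"
      using less_regularized_rank[OF cAB dims2] by blast
    have d2: "0 < d / 2" using d(1) by simp
    obtain Y where Y: "Y \<in> carrier_mat n m" "mat_norm (A - Y) < d / 2" "rk Y \<le> regularized_rank rk A"
      using regularized_rank_near[OF cA dims(1,2) d2] .
    obtain Z where Z: "Z \<in> carrier_mat p q" "mat_norm (B - Z) < d / 2" "rk Z \<le> regularized_rank rk B"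
      using regularized_rank_near[OF cB dims(3,4) d2] .
    have "mat_norm (block_diag A B - block_diag Y Z) \<le> mat_norm (A - Y) + mat_norm (B - Z)"
      unfolding block_diag_minus[OF cA Y(1) cB Z(1)] by (rule mat_norm_block_diag)
    then have "regularized_rank rk A + regularized_rank rk B < rk (block_diag Y Z)"
      using Y(2) Z(2) by (intro d(2) block_diag_carrier Y(1) Z(1)) simp
    then show False
      using Y(3) Z(3) rk_block_diag[OF rect_matsI[OF Y(1) dims(1,2)] rect_matsI[OF Z(1) dims(3,4)]] by simp
  qed
  \<comment> \<open>The pair of cut-downs is reproduced by
    \<open>block_diag X Y * block_diag A B\<close>, whatever the two independent levels
    \<open>e\<close> and \<open>f\<close> are.\<close>
  have both: "rk (mat_cut_down e (mat_abs A)) + rk (mat_cut_down f (mat_abs B))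
      \<le> regularized_rank rk (block_diag A B)" if e: "0 < e" and f: "0 < f" for e f
  proof -
    define c where "c = mat_cut_down e (mat_abs A)"
    define c' where "c' = mat_cut_down f (mat_abs B)"
    obtain X where X: "X \<in> carrier_mat m n" "c = X * A * c"
      using mat_cut_down_factor[OF cA dims(2) e] unfolding c_def .
    obtain Y where Y: "Y \<in> carrier_mat q p" "c' = Y * B * c'"
      using mat_cut_down_factor[OF cB dims(4) f] unfolding c'_def .
    have c: "c \<in> carrier_mat m m" and c': "c' \<in> carrier_mat q q"
      unfolding c_def c'_def using mat_cut_down_carrier[OF cA dims(2)] mat_cut_down_carrier[OF cB dims(4)] by auto
    have "block_diag X Y * block_diag A B * block_diag c c' = block_diag (X * A * c) (Y * B * c')"
      unfolding block_diag_mult[OF X(1) cA Y(1) cB]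
      by (rule block_diag_mult[OF mult_carrier_mat[OF X(1) cA] c mult_carrier_mat[OF Y(1) cB] c'])
    then have "block_diag c c' = block_diag X Y * block_diag A B * block_diag c c'"
      using X(2) Y(2) by simp
    then have "rk (block_diag c c') \<le> regularized_rank rk (block_diag A B)"
      by (intro rk_le_regularized_rank[OF cAB block_diag_carrier[OF X(1) Y(1)]
            block_diag_carrier[OF c c']] dims2)
    then show ?thesis
      using rk_block_diag[OF rect_matsI[OF c dims(2,2)] rect_matsI[OF c' dims(4,4)]]
      by (simp add: c_def c'_def)
  qed
  \<comment> \<open>The suprema are taken in turn, first over the level for \<open>B\<close>, then
    over that for \<open>A\<close>.\<close>
  have "regularized_rank rk B \<le> regularized_rank rk (block_diag A B) - rk (mat_cut_down e (mat_abs A))"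
    if "0 < e" for e
    using both[OF that] by (intro regularized_rank_leI) (simp add: algebra_simps)
  then have "regularized_rank rk A \<le> regularized_rank rk (block_diag A B) - regularized_rank rk B"
    by (intro regularized_rank_leI) (simp add: algebra_simps)
  then show "regularized_rank rk A + regularized_rank rk B \<le> regularized_rank rk (block_diag A B)" by simp
qed

lemma regularized_rank_nonneg:
  assumes "A \<in> rect_mats" shows "0 \<le> regularized_rank rk A"
proof -
  have A: "A \<in> carrier_mat (dim_row A) (dim_col A)" "1 \<le> dim_row A" "1 \<le> dim_col A"
    using assms by (auto simp: rect_mats_def)
  have "0 \<le> rk (mat_cut_down 1 (mat_abs A))"
    using mat_cut_down_carrier[OF A(1,3)] A by (intro rk_nonneg rect_matsI)
  also have "\<dots> \<le> regularized_rank rk A" using A by (rule rk_cut_down_le_regularized) simp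
  finally show ?thesis .
qed

lemma regularized_rank_dimension_function: "dimension_function (regularized_rank rk)"
  unfolding dimension_function_def
  using regularized_rank_nonneg regularized_rank_cuntz_mono regularized_rank_one
    regularized_rank_block_diag by (auto simp del: One_nat_def)

text \<open>\<open>A\<close> is a limit of matrices \<open>Z k\<close> with rank, hence also
  \<open>\<phi>\<close>, at most the regularized rank of \<open>A\<close>; lower semicontinuity
  carries this bound over to \<open>A\<close>.\<close>

lemma regularized_rank_greatest:
  assumes lsc: "mat_lower_semicontinuous \<phi>" and le: "\<And>A. A \<in> rect_mats \<Longrightarrow> \<phi> A \<le> rk A"
    and A: "A \<in> rect_mats"
  shows "\<phi> A \<le> regularized_rank rk A"
proof -
  define n m where "n = dim_row A" and "m = dim_col A"
  have cA: "A \<in> carrier_mat n m" and nm: "1 \<le> n" "1 \<le> m"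
    using A by (auto simp: rect_mats_def n_def m_def)
  have "\<exists>Z. Z \<in> carrier_mat n m \<and> mat_norm (A - Z) < inverse (real (Suc k)) \<and>
      rk Z \<le> regularized_rank rk A" for k
    using regularized_rank_near[OF cA nm, of "inverse (real (Suc k))"] by (metis inverse_positive_iff_positive
        of_nat_0_less_iff zero_less_Suc)
  then obtain Z where Z: "\<And>k. Z k \<in> carrier_mat n m"
    "\<And>k. mat_norm (A - Z k) < inverse (real (Suc k))" "\<And>k. rk (Z k) \<le> regularized_rank rk A"
    by metis
  have "mat_converges Z A"
    unfolding mat_converges_def
  proof (rule Lim_null_comparison)
    show "\<forall>\<^sub>F k in sequentially. norm (mat_norm (Z k - A)) \<le> inverse (real (Suc k))"
      using Z(2) mat_norm_minus_commute[OF cA Z(1)] by (intro always_eventually allI) (simp add: less_imp_le)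
  qed (rule LIMSEQ_inverse_real_of_nat)
  then have "ereal (\<phi> A) \<le> liminf (\<lambda>k. ereal (\<phi> (Z k)))"
    using lsc nm cA Z(1) unfolding mat_lower_semicontinuous_def by blast
  also have "\<dots> \<le> liminf (\<lambda>k. ereal (regularized_rank rk A))"
    using order_trans[OF le[OF rect_matsI[OF Z(1) nm]] Z(3)]
    by (intro Liminf_mono always_eventually allI) simp
  finally show ?thesis by (simp add: Liminf_const)
qed

end

theorem proposition5p12:
  shows "(\<forall>rk :: 'a::unital_cstar_algebra mat \<Rightarrow> real. sylvester_rank_function rk \<longrightarrow>
            dimension_function (regularized_rank rk) \<and>
            mat_lower_semicontinuous (regularized_rank rk) \<and>
            (\<forall>A\<in>rect_mats. regularized_rank rk A \<le> rk A) \<and>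
            (\<forall>\<phi>. dimension_function \<phi> \<longrightarrow> mat_lower_semicontinuous \<phi> \<longrightarrow>
                 (\<forall>A\<in>rect_mats. \<phi> A \<le> rk A) \<longrightarrow>
                 (\<forall>A\<in>rect_mats. \<phi> A \<le> regularized_rank rk A))) \<and>
         ((\<exists>rk :: 'a mat \<Rightarrow> real. sylvester_rank_function rk) \<longrightarrow>
          (\<exists>\<phi> :: 'a mat \<Rightarrow> real. dimension_function \<phi> \<and> mat_lower_semicontinuous \<phi>))"
proof (intro conjI allI impI ballI)
  fix rk :: "'a mat \<Rightarrow> real" assume rk: "sylvester_rank_function rk"
  show "dimension_function (regularized_rank rk)" by (rule regularized_rank_dimension_function[OF rk])
  show "mat_lower_semicontinuous (regularized_rank rk)"
    by (rule regularized_rank_lower_semicontinuous[OF rk])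
  show "regularized_rank rk A \<le> rk A" if "A \<in> rect_mats" for A
    using regularized_rank_le[OF rk, of A "dim_row A" "dim_col A"] that by (auto simp: rect_mats_def)
  show "\<phi> A \<le> regularized_rank rk A"
    if "mat_lower_semicontinuous \<phi>" "\<forall>A\<in>rect_mats. \<phi> A \<le> rk A" "A \<in> rect_mats" for \<phi> A
    using regularized_rank_greatest[OF rk] that by blast
next
  assume "\<exists>rk :: 'a mat \<Rightarrow> real. sylvester_rank_function rk"
  then show "\<exists>\<phi> :: 'a mat \<Rightarrow> real. dimension_function \<phi> \<and> mat_lower_semicontinuous \<phi>"
    using regularized_rank_dimension_function regularized_rank_lower_semicontinuous by blast
qed

end
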